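(* There exists a constant $c>0$ such that for every integer $k \geq 1$ there exists a directed graph $G$ of pathwidth at most $k$ with at most $k^{c}$ vertices such that every tropical circuit calculating $DST_G$ has at least $2^{\Omega(k \log\log k)}$ gates (nodes).
   Context: For a directed graph $G$, associate a variable $x_{u,v}$ with every arc $(u,v)\in E(G)$. Let $\mathcal{T}(G)$ be the family of functions $p:V(G)\to V(G)$ such that $p(v)=v$ for exactly one vertex $v$ (the root), and the arcs $(p(u),u)$ for all other vertices $u$ are arcs of $G$ and form a spanning out-tree rooted at $v$ (a tree oriented away from the root). $DST_G$ is the tropical $(\max,+)$ polynomial $\sum_{p\in\mathcal{T}(G)}\prod_{v: p(v)\neq v} x_{p(v),v}$; on a valuation $\nu$ (assignment of reals to variables) it evaluates to $\max_{p\in\mathcal{T}(G)}\sum_{v:p(v)\ne v}\nu(x_{p(v),v})$. A tropical circuit is a directed acyclic graph whose nodes have in-degree $0$ or $2$; in-degree-$0$ nodes are labeled by a variable or by the constant $0$; in-degree-$2$ nodes are labeled by $+$ or $\max$; one node is the output. On a valuation, input nodes evaluate to the variable's value, constant nodes to $0$, and $+$/$\max$ nodes to the sum/maximum of their two predecessors' values; the circuit's value is the output node's value. A circuit calculates a polynomial $p$ if its value equals $p(\nu)$ for every valuation $\nu$; its size is its number of nodes. The pathwidth of a directed graph is that of its underlying undirected graph: the minimum over sequences of bags $\beta_1,\dots,\beta_\ell\subseteq V(G)$ (each edge inside some bag, bags containing any given vertex contiguous) of $\max_i|\beta_i|-1$. *)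

theory Defs
  imports
    "HOL-Library.FuncSet"
    "HOL-Library.Landau_Symbols"
    "HOL-Analysis.Analysis"
    "Graph_Theory.Graph_Theory"
begin

section \<open>Pathwidth\<close>

definition underlying_edges :: "'a pair_pre_digraph \<Rightarrow> 'a set set" where
  "underlying_edges G = {{u, v} | u v. (u, v) \<in> parcs G}"

definition path_decomposition :: "'a set \<Rightarrow> 'a set set \<Rightarrow> 'a set list \<Rightarrow> bool" where
  "path_decomposition V E bs \<longleftrightarrow>
     bs \<noteq> [] \<and> \<Union>(set bs) = V \<and>
     (\<forall>e\<in>E. \<exists>b\<in>set bs. e \<subseteq> b) \<and>
     (\<forall>i j l. i \<le> j \<longrightarrow> j \<le> l \<longrightarrow> l < length bs \<longrightarrow> bs ! i \<inter> bs ! l \<subseteq> bs ! j)"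

text \<open>Integer-valued, so that subtracting 1 does not truncate.\<close>
definition width :: "'a set list \<Rightarrow> int" where
  "width bs = int (Max (card ` set bs)) - 1"

definition pathwidth :: "'a pair_pre_digraph \<Rightarrow> int" where
  "pathwidth G = Inf (width ` {bs. path_decomposition (pverts G) (underlying_edges G) bs})"

section \<open>Directed spanning trees\<close>

text \<open>A tree oriented away from its root \<open>r\<close>: there is exactly one directed walk from \<open>r\<close> to
  each vertex. This forces the in-degree of \<open>r\<close> to be 0 and that of every other vertex to be 1.\<close>
definition out_tree :: "('a, 'b) pre_digraph \<Rightarrow> 'a \<Rightarrow> bool" where
  "out_tree H r \<longleftrightarrow>
     wf_digraph H \<and> r \<in> verts H \<and> (\<forall>v\<in>verts H. \<exists>!q. pre_digraph.awalk H r q v)"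

definition parent_graph :: "'a pair_pre_digraph \<Rightarrow> ('a \<Rightarrow> 'a) \<Rightarrow> 'a pair_pre_digraph" where
  "parent_graph G p =
     \<lparr> pverts = pverts G, parcs = (\<lambda>u. (p u, u)) ` {u \<in> pverts G. p u \<noteq> u} \<rparr>"

text \<open>Functions from the vertex set to itself are taken to be extensional, so that every
  spanning tree is represented by exactly one \<open>p\<close>.\<close>
definition spanning_out_trees :: "'a pair_pre_digraph \<Rightarrow> ('a \<Rightarrow> 'a) set" where
  "spanning_out_trees G =
     {p \<in> pverts G \<rightarrow>\<^sub>E pverts G.
        (\<exists>!r. r \<in> pverts G \<and> p r = r) \<and>
        (\<exists>r\<in>pverts G. p r = r \<and> spanning (parent_graph G p) G \<and> out_tree (parent_graph G p) r)}"

text \<open>The variable of the arc \<open>(u, v)\<close> is the pair \<open>(u, v)\<close> itself. The maximum is meaningful only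
  if \<open>G\<close> is finite and has a spanning out-tree; otherwise the polynomial has no (real) values.\<close>
definition DST :: "'a pair_pre_digraph \<Rightarrow> ('a \<times> 'a \<Rightarrow> real) \<Rightarrow> real" where
  "DST G \<nu> =
     Max ((\<lambda>p. \<Sum>v\<in>{v \<in> pverts G. p v \<noteq> v}. \<nu> (p v, v)) ` spanning_out_trees G)"

lemma finite_spanning_out_trees:
  assumes "finite (pverts G)"
  shows "finite (spanning_out_trees G)"
  by (rule finite_subset[OF _ finite_PiE[OF assms, of "\<lambda>_. pverts G"]])
     (use assms in \<open>auto simp: spanning_out_trees_def\<close>)

section \<open>Tropical circuits\<close>

text \<open>A node of in-degree 2 refers to its two predecessors, which may coincide (parallel wires).\<close>
datatype (preds: 'n, vars: 'x) gate =
    Var 'x | Zero | Plus 'n 'n | Maximum 'n 'n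

record ('n, 'x) circuit =
  nodes :: "'n set"
  gate :: "'n \<Rightarrow> ('n, 'x) gate"
  out_node :: 'n

definition wires :: "('n, 'x) circuit \<Rightarrow> ('n \<times> 'n) set" where
  "wires C = {(m, n). n \<in> nodes C \<and> m \<in> preds (gate C n)}"

definition tropical_circuit :: "'x set \<Rightarrow> ('n, 'x) circuit \<Rightarrow> bool" where
  "tropical_circuit X C \<longleftrightarrow>
     finite (nodes C) \<and> out_node C \<in> nodes C \<and>
     (\<forall>n\<in>nodes C. preds (gate C n) \<subseteq> nodes C \<and> vars (gate C n) \<subseteq> X) \<and>
     acyclic (wires C)"

inductive has_value :: "('n, 'x) circuit \<Rightarrow> ('x \<Rightarrow> real) \<Rightarrow> 'n \<Rightarrow> real \<Rightarrow> bool"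
  for C :: "('n, 'x) circuit" and \<nu> :: "'x \<Rightarrow> real" where
  "gate C n = Var x \<Longrightarrow> has_value C \<nu> n (\<nu> x)"
| "gate C n = Zero \<Longrightarrow> has_value C \<nu> n 0"
| "gate C n = Plus l r \<Longrightarrow> has_value C \<nu> l a \<Longrightarrow> has_value C \<nu> r b \<Longrightarrow>
     has_value C \<nu> n (a + b)"
| "gate C n = Maximum l r \<Longrightarrow> has_value C \<nu> l a \<Longrightarrow> has_value C \<nu> r b \<Longrightarrow>
     has_value C \<nu> n (max a b)"

lemma has_value_unique:
  "has_value C \<nu> n a \<Longrightarrow> has_value C \<nu> n b \<Longrightarrow> a = b"
proof (induction arbitrary: b rule: has_value.induct)
  case (1 n x)
  from 1(2,1) show ?case by cases auto
next
  case (2 n)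
  from 2(2,1) show ?case by cases auto
next
  case (3 n l r a a')
  from 3(6,1) show ?case by cases (auto dest: 3(4,5))
next
  case (4 n l r a a')
  from 4(6,1) show ?case by cases (auto dest: 4(4,5))
qed

lemma has_value_ex1:
  assumes C: "tropical_circuit X C" and n: "n \<in> nodes C"
  shows "\<exists>!a. has_value C \<nu> n a"
proof -
  have "wires C \<subseteq> nodes C \<times> nodes C" and "finite (nodes C)" and "acyclic (wires C)"
    using C by (auto simp: tropical_circuit_def wires_def)
  then have "wf (wires C)"
    by (meson finite_SigmaI finite_acyclic_wf finite_subset)
  then have "n \<in> nodes C \<longrightarrow> (\<exists>a. has_value C \<nu> n a)"
  proof (induction n rule: wf_induct_rule)
    case (less n)
    show ?case
    proof
      assume n: "n \<in> nodes C"
      have p: "\<exists>a. has_value C \<nu> m a" if "m \<in> preds (gate C n)" for m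
        using less.IH[of m] that n C by (auto simp: wires_def tropical_circuit_def)
      show "\<exists>a. has_value C \<nu> n a"
      proof (cases "gate C n")
        case (Plus l r)
        then show ?thesis using p[of l] p[of r] by (auto intro: has_value.intros(3))
      next
        case (Maximum l r)
        then show ?thesis using p[of l] p[of r] by (auto intro: has_value.intros(4))
      qed (auto intro: has_value.intros(1,2))
    qed
  qed
  then show ?thesis using n has_value_unique by metis
qed

text \<open>A polynomial is given by its evaluation function on valuations.\<close>
definition calculates :: "('n, 'x) circuit \<Rightarrow> (('x \<Rightarrow> real) \<Rightarrow> real) \<Rightarrow> bool" where
  "calculates C f \<longleftrightarrow> (\<forall>\<nu>. has_value C \<nu> (out_node C) (f \<nu>))"

definition circuit_size :: "('n, 'x) circuit \<Rightarrow> nat" where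
  "circuit_size C = card (nodes C)"

end

theory Submission
  imports Defs "HOL-Real_Asymp.Real_Asymp"
begin

text \<open>Since valuations range over all reals, a circuit for \<open>DST\<close> produces exactly the arc sets of the spanning
  trees. Every tree passes through a gate at which between one third and two thirds of its arcs are
  accumulated, so the gates split the trees into classes. Within a class the set \<open>U\<close> of heads of the accumulated
  arcs is fixed, and the arcs into \<open>U\<close> of one tree can be combined with the remaining arcs of any other.

  The hard trees live on a ring of layers, each consisting of two copies of \<open>{..<m}\<close>. In every layer the active
  copy is attached to the next layer by a permutation, and the other copy is a directed path; the product of all
  permutations is a single cycle, cut open at one point. If \<open>U\<close> divides a copy, then inside the class this copy
  cannot be traversed in both directions, so many divided layers make the class exponentially small. Otherwise
  there are layers inside \<open>U\<close> and layers outside of \<open>U\<close>, whose permutations can be exchanged independently. This is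
  a rectangle of pairs of permutations whose products are all cyclic, which by Raz and Spieker has
  density \<open>(ln m)\<close> to the power \<open>- \<Omega>(m)\<close>.

  For the latter bound one passes to a subfamily all of whose subfamilies use nearly as many edges, so that almost
  all short lists of its edges occur jointly in one permutation. If both sides are dense, then the doubly
  stochastic matrices of marginals have entropy so close to maximal that one of \<open>O(ln ln m)\<close> averaging steps hardly
  lowers the entropy functional. Then the walk alternating between the two sides returns to its start within fewer
  than \<open>m\<close> steps with constant probability, so some short closed walk occurs jointly, contradicting
  cyclicity.\<close>

section \<open>Rigid subfamilies\<close>

text \<open>The set \<open>U\<close> depends on the circuit, and the graph leaves it no good choice.
  An exchange needs two layers whose active copies lie entirely on different sides of
  \<open>U\<close>. If the active copies were prescribed, \<open>U\<close> could have them all on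
  one side and be balanced by other vertices; hence each tree selects them. If \<open>U\<close> cut
  through the copies, no permutation could be exchanged as a whole; hence the inactive copies carry
  paths, whose two directions penalise a cut. With about m^2 layers both exceptional cases are rarer
  than exp (- q m).

  In the short cycle argument, J averaging steps reach walks of length about 2^J. An entropy deficit
  of (q + 2) m leaves little for one of the J steps if q is a small multiple of J. Counting walks
  requires entries not much larger than 1 / m, so large entries are cut off; as the lost mass may
  grow by a factor 2^J, the threshold is exp (2^(J + 6) (q + 3)) / m. Raised to the length of the
  walk, its excess over 1 / m must stay below a power of m, which permits J of order ln ln
  m.\<close>

definition edges_of :: "'a set \<Rightarrow> ('a \<Rightarrow> 'b) set \<Rightarrow> ('a \<times> 'b) set" where
  "edges_of I F = (\<Union>f\<in>F. (\<lambda>x. (x, f x)) ` I)"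

definition extending :: "('a \<Rightarrow> 'b) set \<Rightarrow> ('a \<times> 'b) list \<Rightarrow> ('a \<Rightarrow> 'b) set" where
  "extending F es = {f \<in> F. \<forall>(x, y)\<in>set es. f x = y}"

lemma finite_edges_of: "finite I \<Longrightarrow> finite F \<Longrightarrow> finite (edges_of I F)"
  by (auto simp: edges_of_def)

text \<open>\<open>G\<close> maximises its cardinality times exp of minus \<open>a\<close> times its
  number of edges. Optimality against the subfamilies of \<open>G\<close> is the last claim,
  optimality against \<open>F\<close> gives the lower bound on the size.\<close>

lemma exists_rigid_subfamily:
  fixes F :: "('a \<Rightarrow> 'b) set" and a :: real
  assumes "finite F" "F \<noteq> {}" "a \<ge> 0"
  obtains G where "G \<subseteq> F" "G \<noteq> {}"
    "real (card F) * exp (- a * card (edges_of I F)) \<le> card G"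
    "\<And>H. H \<subseteq> G \<Longrightarrow> H \<noteq> {} \<Longrightarrow>
       a * (real (card (edges_of I G)) - card (edges_of I H)) \<le> ln (card G / card H)"
proof -
  define w where "w G = real (card G) * exp (- a * card (edges_of I G))" for G :: "('a \<Rightarrow> 'b) set"
  let ?S = "Pow F - {{}}"
  have fin: "finite (w ` ?S)" and ne: "w ` ?S \<noteq> {}" using assms by auto
  from Max_in[OF fin ne] obtain G where G: "Max (w ` ?S) = w G" "G \<in> ?S"
    by (rule imageE)
  have max: "w H \<le> w G" if "H \<in> ?S" for H
    using Max_ge[OF fin imageI[OF that]] unfolding G(1) .
  show ?thesis
  proof (rule that)
    show "G \<subseteq> F" "G \<noteq> {}" using G(2) by auto
    have "w F \<le> w G" using max assms by auto
    also have "w G \<le> card G"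
      using assms by (simp add: w_def mult_left_le)
    finally show "real (card F) * exp (- a * card (edges_of I F)) \<le> card G" by (simp add: w_def)
    fix H assume H: "H \<subseteq> G" "H \<noteq> {}"
    have fG: "finite G" "finite H" using finite_subset[of G F] finite_subset[of H F] G(2) H assms(1) by auto
    have pos: "card G > 0" "card H > 0" using fG H G(2) by (auto simp: card_gt_0_iff)
    have "w H \<le> w G" using max H G(2) by auto
    then have "ln (w H) \<le> ln (w G)" using pos by (subst ln_le_cancel_iff) (auto simp: w_def)
    then show "a * (real (card (edges_of I G)) - card (edges_of I H)) \<le> ln (card G / card H)"
      using pos by (simp add: w_def ln_mult ln_div algebra_simps)
  qed
qed

text \<open>Rarely extendable edges can be discarded at a small cost in cardinality, so rigidity bounds
  their number. Hence almost all tuples of edges occur jointly in one member of the family.\<close>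
lemma few_rare_lists:
  fixes F :: "('a \<Rightarrow> 'b) set" and m L :: nat
  assumes F: "finite F" "F \<noteq> {}" and I: "finite I" and m: "m \<ge> 2"
    and small: "card (edges_of I F) \<le> m^2"
    and rigid: "\<And>H. H \<subseteq> F \<Longrightarrow> H \<noteq> {} \<Longrightarrow>
       real (card (edges_of I F)) - card (edges_of I H) \<le> m * ln (card F / card H)"
    and l: "l \<le> L"
  shows "real (card {es. length es = l \<and> set es \<subseteq> edges_of I F \<and>
           card (extending F es) < card F / real m ^ (3 * l)}) * m \<le> l * (4 * L * ln m) * real m ^ (2 * l)"
  using l
proof (induction l)
  case 0
  have "extending F [] = F" by (auto simp: extending_def)
  then have "{es. length es = 0 \<and> set es \<subseteq> edges_of I F \<and>
           card (extending F es) < card F / real m ^ (3 * 0)} = {}" by auto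
  then show ?case by (simp only:) simp
next
  case (Suc l)
  let ?E = "edges_of I F"
  let ?N = "real (card F)"
  define B where "B l = {es. length es = l \<and> set es \<subseteq> ?E \<and> card (extending F es) < card F / real m ^ (3 * l)}" for l
  define A where "A l = {es. set es \<subseteq> ?E \<and> length es = l}" for l
  define R where "R es = {e \<in> ?E. card (extending F (e # es)) < ?N / real m ^ (3 * Suc l)}" for es
  have finE: "finite ?E" using finite_edges_of I F by auto
  have finA: "finite (A l)" for l unfolding A_def using finite_lists_length_eq[OF finE] .
  have cardA: "real (card (A l)) \<le> real m ^ (2 * l)" for l
  proof -
    have "card (A l) = card ?E ^ l" unfolding A_def using card_lists_length_eq[OF finE] by simp
    also have "\<dots> \<le> (m^2)^l" using small by (rule power_mono) simp
    finally have "card (A l) \<le> m ^ (2 * l)" by (simp add: power_mult)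
    then show ?thesis by (metis of_nat_le_iff of_nat_power)
  qed
  have finB: "finite (B l)" for l by (rule finite_subset[OF _ finA[of l]]) (auto simp: A_def B_def)
  have smallR: "real (card ?E) \<le> (real m)^2"
    unfolding of_nat_power[symmetric] of_nat_le_iff by (fact small)
  have N: "?N > 0" using F by (simp add: card_gt_0_iff)
  have m0: "real m > 0" using m by simp
  \<comment> \<open>A list that is not rare has at least N / m^(3l) extensions, where N =
    \<open>card F\<close>. Each of the at most m^2 edges in \<open>R es\<close> occurs in fewer than
    N / m^(3l+3) of them, so discarding these leaves at least half. What is left avoids
    \<open>R es\<close>, and rigidity turns this into a bound on \<open>card (R es)\<close>. Of the
    exponent 3 per edge, 2 pay for the union bound and 1 for the half.\<close>
  have cR: "real (card (R es)) \<le> m * (4 * L * ln m)" if es: "es \<in> A l - B l" for es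
  proof -
    let ?X = "extending F es"
    have finR: "finite (R es)" using finE by (simp add: R_def)
    have cX: "?N / real m ^ (3 * l) \<le> card ?X" using es by (auto simp: A_def B_def)
    define H where "H = ?X - (\<Union>e\<in>R es. extending F (e # es))"
    have "real (card (\<Union>e\<in>R es. extending F (e # es))) \<le> (\<Sum>e\<in>R es. real (card (extending F (e # es))))"
      using card_UN_le[OF finR, of "\<lambda>e. extending F (e # es)"] by (metis of_nat_le_iff of_nat_sum)
    also have "\<dots> \<le> (\<Sum>e\<in>R es. ?N / real m ^ (3 * Suc l))"
      by (rule sum_mono) (auto simp: R_def)
    also have "\<dots> = card (R es) * (?N / real m ^ (3 * Suc l))" by simp
    also have "\<dots> \<le> (real m)^2 * (?N / real m ^ (3 * Suc l))"
    proof (rule mult_right_mono)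
      have "card (R es) \<le> card ?E" using finE by (intro card_mono) (auto simp: R_def)
      then show "real (card (R es)) \<le> (real m)^2" using smallR by linarith
    qed (use N m0 in simp)
    also have "\<dots> = ?N / real m ^ (3 * l) / m"
      using m0 by (simp add: field_simps power_add eval_nat_numeral)
    also have "\<dots> \<le> ?N / real m ^ (3 * l) / 2" using m N by (intro divide_left_mono) auto
    finally have rem: "real (card (\<Union>e\<in>R es. extending F (e # es))) \<le> ?N / real m ^ (3 * l) / 2" .
    have "real (card ?X) - card (\<Union>e\<in>R es. extending F (e # es)) \<le> card H"
      unfolding H_def using diff_card_le_card_Diff[of "\<Union>e\<in>R es. extending F (e # es)" ?X] finR F
      by (auto simp: extending_def)
    then have "?N / real m ^ (3 * l) / 2 \<le> card H" using rem cX by linarith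
    moreover have "?N / real m ^ (3 * l) / m \<le> ?N / real m ^ (3 * l) / 2" using m N by (intro divide_left_mono) auto
    ultimately have cH: "?N / real m ^ (3 * l + 1) \<le> card H" by (simp add: mult.commute)
    then have cH0: "real (card H) > 0" using N m0
      by (meson divide_pos_pos less_le_trans zero_less_power)
    then have "H \<noteq> {}" by auto
    have "H \<subseteq> F" by (auto simp: H_def extending_def)
    have "edges_of I H \<subseteq> ?E - R es"
    proof -
      have "(x, f x) \<notin> R es" if "f \<in> H" for f x
        using that by (auto simp: H_def extending_def)
      then show ?thesis using \<open>H \<subseteq> F\<close> by (auto simp: edges_of_def)
    qed
    then have "card (edges_of I H) \<le> card (?E - R es)" using finE by (intro card_mono) auto
    also have "\<dots> = card ?E - card (R es)" using finR by (intro card_Diff_subset) (auto simp: R_def)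
    finally have "card (edges_of I H) \<le> card ?E - card (R es)" .
    moreover have "card (R es) \<le> card ?E" using finE by (intro card_mono) (auto simp: R_def)
    ultimately have "real (card (R es)) \<le> real (card ?E) - card (edges_of I H)" by linarith
    also have "\<dots> \<le> m * ln (card F / card H)" using rigid \<open>H \<subseteq> F\<close> \<open>H \<noteq> {}\<close> by blast
    also have "\<dots> \<le> m * ln (real m ^ (3 * l + 1))"
    proof (intro mult_left_mono)
      have "card F / card H \<le> real m ^ (3 * l + 1)" using cH cH0 m0 by (simp add: field_simps)
      then show "ln (card F / card H) \<le> ln (real m ^ (3 * l + 1))"
        using N cH0 m0 by (subst ln_le_cancel_iff) auto
    qed simp
    also have "ln (real m ^ (3 * l + 1)) = (3 * l + 1) * ln m" using m0 by (subst ln_realpow) auto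
    also have "real m * ((3 * l + 1) * ln m) \<le> m * (4 * L * ln m)"
      using Suc.prems m by (intro mult_left_mono mult_right_mono) auto
    finally show ?thesis .
  qed
  \<comment> \<open>A rare list has a rare tail, or its head is rare for a tail that is not. The
    converse relation puts the head in front.\<close>
  have sub: "B (Suc l) \<subseteq> (\<lambda>(e, es). e # es) ` (?E \<times> B l \<union> (SIGMA es : A l - B l. R es)\<inverse>)"
  proof
    fix es' assume "es' \<in> B (Suc l)"
    then obtain e es where [simp]: "es' = e # es" and *: "length es = l" "e \<in> ?E" "set es \<subseteq> ?E"
      "card (extending F (e # es)) < card F / real m ^ (3 * Suc l)"
      by (auto simp: B_def length_Suc_conv)
    show "es' \<in> (\<lambda>(e, es). e # es) ` (?E \<times> B l \<union> (SIGMA es : A l - B l. R es)\<inverse>)"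
    proof (rule image_eqI)
      show "es' = (\<lambda>(e, es). e # es) (e, es)" by simp
      show "(e, es) \<in> ?E \<times> B l \<union> (SIGMA es : A l - B l. R es)\<inverse>"
        using * by (cases "es \<in> B l") (simp_all add: R_def A_def)
    qed
  qed
  have finS: "finite (SIGMA es : A l - B l. R es)" using finA finE by (auto simp: R_def)
  have finC: "finite ((SIGMA es : A l - B l. R es)\<inverse>)" using finS by simp
  have "card (B (Suc l)) \<le> card (?E \<times> B l \<union> (SIGMA es : A l - B l. R es)\<inverse>)"
    by (rule surj_card_le[OF _ sub]) (use finE finB finC in auto)
  also have "\<dots> \<le> card (?E \<times> B l) + card ((SIGMA es : A l - B l. R es)\<inverse>)" by (rule card_Un_le)
  also have "card ((SIGMA es : A l - B l. R es)\<inverse>) = card (SIGMA es : A l - B l. R es)"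
    by (rule card_inverse)
  also have "\<dots> = (\<Sum>es\<in>A l - B l. card (R es))"
    by (rule card_SigmaI) (use finA finE in \<open>auto simp: R_def\<close>)
  finally have "real (card (B (Suc l))) \<le> real (card ?E * card (B l) + (\<Sum>es\<in>A l - B l. card (R es)))"
    unfolding of_nat_le_iff by (simp add: card_cartesian_product)
  also have "\<dots> = real (card ?E) * card (B l) + (\<Sum>es\<in>A l - B l. real (card (R es)))" by simp
  also have "\<dots> \<le> (real m)^2 * card (B l) + (\<Sum>es\<in>A l - B l. m * (4 * L * ln m))"
  proof (intro add_mono mult_right_mono sum_mono)
    show "real (card ?E) \<le> (real m)^2" by (fact smallR)
  qed (use cR in auto)
  also have "(\<Sum>es\<in>A l - B l. m * (4 * L * ln m)) \<le> real m ^ (2 * l) * (m * (4 * L * ln m))"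
  proof -
    have "card (A l - B l) \<le> card (A l)" using finA by (intro card_mono) auto
    then have "real (card (A l - B l)) \<le> real m ^ (2 * l)" using cardA[of l] by linarith
    then have "real (card (A l - B l)) * (m * (4 * L * ln m)) \<le> real m ^ (2 * l) * (m * (4 * L * ln m))"
      using m by (intro mult_right_mono) auto
    then show ?thesis by simp
  qed
  finally have "real (card (B (Suc l))) \<le> (real m)^2 * real (card (B l)) + real m ^ (2 * l) * (m * (4 * L * ln m))"
    by simp
  then have "real (card (B (Suc l))) * m \<le> ((real m)^2 * real (card (B l)) + real m ^ (2 * l) * (m * (4 * L * ln m))) * m"
    using m0 by (intro mult_right_mono) auto
  also have "\<dots> = (real m)^2 * (real (card (B l)) * m) + real m ^ (2 * Suc l) * (4 * L * ln m)"
    by (simp add: algebra_simps power2_eq_square)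
  also have "\<dots> \<le> (real m)^2 * (l * (4 * L * ln m) * real m ^ (2 * l)) + real m ^ (2 * Suc l) * (4 * L * ln m)"
    using Suc by (intro add_mono mult_left_mono) (auto simp: B_def)
  also have "\<dots> = Suc l * (4 * L * ln m) * real m ^ (2 * Suc l)"
    by (simp add: algebra_simps power2_eq_square)
  finally show ?case by (simp add: B_def)
qed

section \<open>Entropy and averaging of doubly stochastic matrices\<close>

definition doubly_stochastic :: "'a set \<Rightarrow> ('a \<Rightarrow> 'a \<Rightarrow> real) \<Rightarrow> bool" where
  "doubly_stochastic I u \<longleftrightarrow> (\<forall>x\<in>I. \<forall>y\<in>I. u x y \<ge> 0) \<and>
     (\<forall>x\<in>I. (\<Sum>y\<in>I. u x y) = 1) \<and> (\<forall>y\<in>I. (\<Sum>x\<in>I. u x y) = 1)"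

definition mat_times :: "'a set \<Rightarrow> ('a \<Rightarrow> 'a \<Rightarrow> real) \<Rightarrow> ('a \<Rightarrow> 'a \<Rightarrow> real) \<Rightarrow> 'a \<Rightarrow> 'a \<Rightarrow> real" where
  "mat_times I u v x z = (\<Sum>y\<in>I. u x y * v y z)"

lemma mat_times_assoc: "mat_times I (mat_times I u v) w = mat_times I u (mat_times I v w)"
proof (intro ext)
  fix x z
  have "mat_times I (mat_times I u v) w x z = (\<Sum>k\<in>I. \<Sum>y\<in>I. u x y * v y k * w k z)"
    by (simp add: mat_times_def sum_distrib_right)
  also have "\<dots> = (\<Sum>y\<in>I. \<Sum>k\<in>I. u x y * v y k * w k z)" by (rule sum.swap)
  also have "\<dots> = mat_times I u (mat_times I v w) x z"
    by (simp add: mat_times_def sum_distrib_left mult.assoc)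
  finally show "mat_times I (mat_times I u v) w x z = mat_times I u (mat_times I v w) x z" .
qed

lemma sum_mat_times_row:
  "(\<Sum>z\<in>I. mat_times I u v x z) = (\<Sum>y\<in>I. u x y * (\<Sum>z\<in>I. v y z))"
  unfolding mat_times_def sum_distrib_left by (rule sum.swap)

lemma sum_mat_times_col:
  "(\<Sum>x\<in>I. mat_times I u v x z) = (\<Sum>y\<in>I. (\<Sum>x\<in>I. u x y) * v y z)"
  unfolding mat_times_def sum_distrib_right by (rule sum.swap)

lemma doubly_stochastic_mat_times:
  assumes "doubly_stochastic I u" "doubly_stochastic I v"
  shows "doubly_stochastic I (mat_times I u v)"
  using assms unfolding doubly_stochastic_def
  by (auto simp: sum_mat_times_row sum_mat_times_col) (auto simp: mat_times_def intro!: sum_nonneg)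

lemma doubly_stochastic_mean:
  assumes "doubly_stochastic I u" "doubly_stochastic I v"
  shows "doubly_stochastic I (\<lambda>x y. (u x y + v x y) / 2)"
  using assms unfolding doubly_stochastic_def
  by (auto simp: sum.distrib simp flip: sum_divide_distrib)

definition neg_entropy :: "'a set \<Rightarrow> ('a \<Rightarrow> 'a \<Rightarrow> real) \<Rightarrow> real" where
  "neg_entropy I u = (\<Sum>x\<in>I. \<Sum>y\<in>I. u x y * ln (u x y))"

text \<open>The tangent of t ln t at s, with a Hellinger term as remainder: ln x \<le> x - 1 is
  applied to sqrt (s / t) instead of s / t. The last assumption excludes s = 0 < t, where the value
  \<open>ln 0 = 0\<close> would make the claim false for small t.\<close>

lemma xlnx_ge:
  fixes t s :: real assumes "t \<ge> 0" "s \<ge> 0"  "s = 0 \<Longrightarrow> t = 0"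
  shows "t * ln t \<ge> s * ln s + (1 + ln s) * (t - s) + (sqrt t - sqrt s)^2"
proof (cases "t = 0 \<or> s = 0")
  case True
  then show ?thesis using assms by (auto simp: algebra_simps)
next
  case False
  then have ts: "t > 0" "s > 0" using assms by auto
  have "ln (sqrt (s / t)) \<le> sqrt (s / t) - 1" using ts by (intro ln_le_minus_one) auto
  then have "ln (s / t) \<le> 2 * sqrt (s / t) - 2" using ts by (simp add: ln_sqrt)
  then have "t * (ln s - ln t) \<le> t * (2 * sqrt (s / t) - 2)"
    using ts by (intro mult_left_mono) (auto simp: ln_div)
  also have "t * (2 * sqrt (s / t) - 2) = 2 * (sqrt t * sqrt s) - 2 * t"
  proof -
    have "t * sqrt (s / t) = sqrt t * sqrt t * (sqrt s / sqrt t)" using ts by (simp add: real_sqrt_divide)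
    also have "\<dots> = sqrt t * sqrt s" using ts by (simp add: field_simps)
    finally show ?thesis by (simp add: algebra_simps)
  qed
  finally show ?thesis using ts by (simp add: power2_eq_square algebra_simps)
qed

text \<open>\<open>xlnx_ge\<close> is applied entrywise with s = \<open>c x y\<close>. As
  \<open>c x y\<close> is the mean of \<open>u x y\<close> and the \<open>M x\<close>-average of the
  \<open>u j y\<close>, the linear terms cancel and the Hellinger terms remain. As the columns of
  \<open>M\<close> sum to 1, both halves of the upper bound sum to the entropy of
  \<open>u\<close>.\<close>

lemma neg_entropy_drop:
  assumes I: "finite I" and u: "doubly_stochastic I u" and M: "doubly_stochastic I M"
  defines "c \<equiv> \<lambda>x y. (u x y + mat_times I M u x y) / 2"
  shows "neg_entropy I u - neg_entropy I c \<ge>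
     (\<Sum>x\<in>I. \<Sum>y\<in>I. (sqrt (u x y) - sqrt (c x y))^2) / 2 +
     (\<Sum>x\<in>I. \<Sum>j\<in>I. M x j * (\<Sum>y\<in>I. (sqrt (u j y) - sqrt (c x y))^2)) / 2"
proof -
  let ?f = "\<lambda>t::real. t * ln t"
  have nn: "u x y \<ge> 0" "M x y \<ge> 0" "mat_times I M u x y \<ge> 0" if "x \<in> I" "y \<in> I" for x y
    using that u M by (auto simp: doubly_stochastic_def mat_times_def intro!: sum_nonneg)
  have key: "(?f (u x y) + (\<Sum>j\<in>I. M x j * ?f (u j y))) / 2 \<ge>
    ?f (c x y) + (sqrt (u x y) - sqrt (c x y))^2 / 2 + (\<Sum>j\<in>I. M x j * (sqrt (u j y) - sqrt (c x y))^2) / 2"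
    if xy: "x \<in> I" "y \<in> I" for x y
  proof -
    let ?c = "c x y"
    have c0: "?c \<ge> 0" using nn[OF xy] by (simp add: c_def)
    have z: "u x y = 0" "\<And>j. j \<in> I \<Longrightarrow> M x j * u j y = 0" if "?c = 0"
    proof -
      have *: "u x y = 0" "mat_times I M u x y = 0" using nn[OF xy] that by (auto simp: c_def)
      then show "u x y = 0" by simp
      fix j assume "j \<in> I"
      then show "M x j * u j y = 0" using *(2) nn xy I
        unfolding mat_times_def by (subst (asm) sum_nonneg_eq_0_iff) auto
    qed
    have a: "?f (u x y) \<ge> ?f ?c + (1 + ln ?c) * (u x y - ?c) + (sqrt (u x y) - sqrt ?c)^2"
      using nn[OF xy] c0 z by (intro xlnx_ge) auto
    have b: "M x j * ?f (u j y) \<ge> M x j * (?f ?c + (1 + ln ?c) * (u j y - ?c) + (sqrt (u j y) - sqrt ?c)^2)"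
      if j: "j \<in> I" for j
    proof (cases "M x j = 0")
      case False
      then show ?thesis using nn xy j c0 z(2)[OF _ j] by (intro mult_left_mono xlnx_ge) auto
    qed simp
    have row: "(\<Sum>j\<in>I. M x j) = 1" using M xy by (simp add: doubly_stochastic_def)
    have "(\<Sum>j\<in>I. M x j * ?f (u j y)) \<ge>
      (\<Sum>j\<in>I. M x j * (?f ?c + (1 + ln ?c) * (u j y - ?c) + (sqrt (u j y) - sqrt ?c)^2))"
      by (rule sum_mono) (rule b)
    also have "(\<Sum>j\<in>I. M x j * (?f ?c + (1 + ln ?c) * (u j y - ?c) + (sqrt (u j y) - sqrt ?c)^2)) =
      (\<Sum>j\<in>I. M x j) * ?f ?c + (1 + ln ?c) * (mat_times I M u x y - (\<Sum>j\<in>I. M x j) * ?c)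
      + (\<Sum>j\<in>I. M x j * (sqrt (u j y) - sqrt ?c)^2)"
      unfolding mat_times_def
      by (simp add: distrib_left distrib_right sum.distrib sum_distrib_left sum_distrib_right sum_subtractf
          right_diff_distrib left_diff_distrib mult_ac)
    finally have "(\<Sum>j\<in>I. M x j * ?f (u j y)) \<ge> ?f ?c + (1 + ln ?c) * (mat_times I M u x y - ?c)
      + (\<Sum>j\<in>I. M x j * (sqrt (u j y) - sqrt ?c)^2)" by (simp add: row)
    moreover have "(1 + ln ?c) * (u x y - ?c) + (1 + ln ?c) * (mat_times I M u x y - ?c) = 0"
      by (simp add: c_def field_simps)
    ultimately show ?thesis using a by argo
  qed
  have col: "(\<Sum>x\<in>I. \<Sum>y\<in>I. \<Sum>j\<in>I. M x j * ?f (u j y)) = neg_entropy I u"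
  proof -
    have "(\<Sum>x\<in>I. \<Sum>y\<in>I. \<Sum>j\<in>I. M x j * ?f (u j y)) = (\<Sum>x\<in>I. \<Sum>j\<in>I. M x j * (\<Sum>y\<in>I. ?f (u j y)))"
      by (simp add: sum_distrib_left) (intro sum.cong refl sum.swap)
    also have "\<dots> = (\<Sum>j\<in>I. (\<Sum>x\<in>I. M x j) * (\<Sum>y\<in>I. ?f (u j y)))"
      unfolding sum_distrib_right by (rule sum.swap)
    also have "\<dots> = neg_entropy I u" using M by (simp add: doubly_stochastic_def neg_entropy_def)
    finally show ?thesis .
  qed
  have "(\<Sum>x\<in>I. \<Sum>y\<in>I. ?f (c x y) + (sqrt (u x y) - sqrt (c x y))^2 / 2 + (\<Sum>j\<in>I. M x j * (sqrt (u j y) - sqrt (c x y))^2) / 2)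
    \<le> (\<Sum>x\<in>I. \<Sum>y\<in>I. (?f (u x y) + (\<Sum>j\<in>I. M x j * ?f (u j y))) / 2)"
    by (intro sum_mono key)
  also have "\<dots> = neg_entropy I u"
    by (simp add: sum.distrib col neg_entropy_def flip: sum_divide_distrib)
  finally have "(\<Sum>x\<in>I. \<Sum>y\<in>I. ?f (c x y)) + (\<Sum>x\<in>I. \<Sum>y\<in>I. (sqrt (u x y) - sqrt (c x y))^2) / 2
    + (\<Sum>x\<in>I. \<Sum>y\<in>I. \<Sum>j\<in>I. M x j * (sqrt (u j y) - sqrt (c x y))^2) / 2 \<le> neg_entropy I u"
    by (simp add: sum.distrib flip: sum_divide_distrib)
  moreover have "(\<Sum>x\<in>I. \<Sum>y\<in>I. \<Sum>j\<in>I. M x j * (sqrt (u j y) - sqrt (c x y))^2) =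
    (\<Sum>x\<in>I. \<Sum>j\<in>I. M x j * (\<Sum>y\<in>I. (sqrt (u j y) - sqrt (c x y))^2))"
    by (simp add: sum_distrib_left) (intro sum.cong refl sum.swap)
  ultimately show ?thesis by (simp add: neg_entropy_def)
qed

text \<open>Cauchy-Schwarz after factoring a - b = (sqrt a - sqrt b) (sqrt a + sqrt b).\<close>

lemma l1_le_hellinger:
  fixes a b :: "'a \<Rightarrow> real"
  assumes "\<And>y. y \<in> I \<Longrightarrow> a y \<ge> 0" "\<And>y. y \<in> I \<Longrightarrow> b y \<ge> 0" "sum a I = 1" "sum b I = 1"
  shows "(\<Sum>y\<in>I. \<bar>a y - b y\<bar>) \<le> 2 * sqrt (\<Sum>y\<in>I. (sqrt (a y) - sqrt (b y))^2)"
proof -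
  have "(\<Sum>y\<in>I. \<bar>a y - b y\<bar>) = (\<Sum>y\<in>I. \<bar>sqrt (a y) - sqrt (b y)\<bar> * \<bar>sqrt (a y) + sqrt (b y)\<bar>)"
  proof (rule sum.cong[OF refl])
    fix y assume "y \<in> I"
    then have "a y - b y = (sqrt (a y) - sqrt (b y)) * (sqrt (a y) + sqrt (b y))"
      using assms by (simp add: algebra_simps)
    then show "\<bar>a y - b y\<bar> = \<bar>sqrt (a y) - sqrt (b y)\<bar> * \<bar>sqrt (a y) + sqrt (b y)\<bar>"
      by (simp add: abs_mult)
  qed
  also have "\<dots> \<le> L2_set (\<lambda>y. sqrt (a y) - sqrt (b y)) I * L2_set (\<lambda>y. sqrt (a y) + sqrt (b y)) I"
    by (rule L2_set_mult_ineq)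
  also have "\<dots> \<le> L2_set (\<lambda>y. sqrt (a y) - sqrt (b y)) I * 2"
  proof -
    have "(\<Sum>y\<in>I. (sqrt (a y) + sqrt (b y))^2) \<le> (\<Sum>y\<in>I. 2 * a y + 2 * b y)"
    proof (rule sum_mono)
      fix y assume "y \<in> I"
      have "(sqrt (a y) + sqrt (b y))^2 \<le> (sqrt (a y) + sqrt (b y))^2 + (sqrt (a y) - sqrt (b y))^2" by simp
      also have "\<dots> = 2 * a y + 2 * b y"
        using assms(1,2)[OF \<open>y \<in> I\<close>] by (simp add: power2_eq_square algebra_simps)
      finally show "(sqrt (a y) + sqrt (b y))^2 \<le> 2 * a y + 2 * b y" .
    qed
    also have "\<dots> = 4" using assms(3,4) by (simp add: sum.distrib flip: sum_distrib_left)
    finally have "sqrt (\<Sum>y\<in>I. (sqrt (a y) + sqrt (b y))^2) \<le> sqrt 4" by (rule real_sqrt_le_mono)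
    then show ?thesis by (intro mult_left_mono) (auto simp: L2_set_def sum_nonneg)
  qed
  finally show ?thesis by (simp add: L2_set_def)
qed

lemma weighted_sqrt_le:
  fixes w f :: "'a \<Rightarrow> real"
  assumes "\<And>x. x \<in> A \<Longrightarrow> w x \<ge> 0" "\<And>x. x \<in> A \<Longrightarrow> f x \<ge> 0"
  shows "(\<Sum>x\<in>A. w x * sqrt (f x)) \<le> sqrt (sum w A) * sqrt (\<Sum>x\<in>A. w x * f x)"
proof -
  have "(\<Sum>x\<in>A. w x * sqrt (f x)) = (\<Sum>x\<in>A. \<bar>sqrt (w x)\<bar> * \<bar>sqrt (w x * f x)\<bar>)"
  proof (rule sum.cong[OF refl])
    fix x assume "x \<in> A"
    then have "w x = sqrt (w x) * sqrt (w x)" using assms by simp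
    then show "w x * sqrt (f x) = \<bar>sqrt (w x)\<bar> * \<bar>sqrt (w x * f x)\<bar>"
      using assms \<open>x \<in> A\<close> by (simp add: real_sqrt_mult)
  qed
  also have "\<dots> \<le> L2_set (\<lambda>x. sqrt (w x)) A * L2_set (\<lambda>x. sqrt (w x * f x)) A"
    by (rule L2_set_mult_ineq)
  also have "\<dots> = sqrt (sum w A) * sqrt (\<Sum>x\<in>A. w x * f x)"
    using assms by (simp add: L2_set_def)
  finally show ?thesis .
qed

text \<open>With M = u Q, a small drop means that row x of \<open>u\<close>, and also row j of
  \<open>u\<close> for typical j drawn from row x of M, is close to row x of the mean
  \<open>c\<close>. Drawing y from row x of \<open>u\<close> and then j from row y of
  \<open>Q\<close> has the distribution M, so for typical y row y of Q u is close to row x of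
  \<open>u\<close>.\<close>

lemma rows_close:
  fixes e :: real
  assumes I: "finite I" and u: "doubly_stochastic I u" and Q: "doubly_stochastic I Q"
    and drop: "neg_entropy I u - neg_entropy I (\<lambda>x y. (u x y + mat_times I (mat_times I u Q) u x y) / 2)
        \<le> e * card I"
    and e: "e \<ge> 0"
  shows "(\<Sum>x\<in>I. \<Sum>y\<in>I. u x y * (\<Sum>z\<in>I. \<bar>mat_times I Q u y z - u x z\<bar>)) \<le> 4 * sqrt (2 * e) * card I"
proof -
  define M where "M = mat_times I u Q"
  define c where "c x y = (u x y + mat_times I M u x y) / 2" for x y
  have M: "doubly_stochastic I M" unfolding M_def using doubly_stochastic_mat_times u Q by blast
  have c: "doubly_stochastic I c" unfolding c_def
    by (intro doubly_stochastic_mean u doubly_stochastic_mat_times M)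
  note ds = u[unfolded doubly_stochastic_def] Q[unfolded doubly_stochastic_def]
    M[unfolded doubly_stochastic_def] c[unfolded doubly_stochastic_def]
  define h where "h x j = (\<Sum>y\<in>I. (sqrt (u j y) - sqrt (c x y))^2)" for x j
  define d where "d x j = (\<Sum>y\<in>I. \<bar>u j y - c x y\<bar>)" for x j
  have h0: "h x j \<ge> 0" for x j by (simp add: h_def sum_nonneg)
  have d: "d x j \<le> 2 * sqrt (h x j)" if "x \<in> I" "j \<in> I" for x j
    unfolding d_def h_def using ds that by (intro l1_le_hellinger) auto
  have "(\<Sum>x\<in>I. h x x) / 2 + (\<Sum>x\<in>I. \<Sum>j\<in>I. M x j * h x j) / 2 \<le> e * card I"
    using neg_entropy_drop[OF I u M] drop unfolding M_def[symmetric] c_def[symmetric] h_def by linarith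
  moreover have "(\<Sum>x\<in>I. h x x) \<ge> 0" "(\<Sum>x\<in>I. \<Sum>j\<in>I. M x j * h x j) \<ge> 0"
    using ds h0 by (auto intro!: sum_nonneg)
  ultimately have H1: "(\<Sum>x\<in>I. h x x) \<le> 2 * e * card I"
    and H2: "(\<Sum>x\<in>I. \<Sum>j\<in>I. M x j * h x j) \<le> 2 * e * card I" by linarith+
  have "(\<Sum>x\<in>I. d x x) \<le> 2 * (\<Sum>x\<in>I. 1 * sqrt (h x x))"
    using d by (simp add: sum_distrib_left sum_mono)
  also have "(\<Sum>x\<in>I. 1 * sqrt (h x x)) \<le> sqrt (sum (\<lambda>_. 1) I) * sqrt (\<Sum>x\<in>I. 1 * h x x)"
    by (rule weighted_sqrt_le) (auto simp: h0)
  also have "\<dots> \<le> sqrt (card I) * sqrt (2 * e * card I)" using H1 by (intro mult_mono) (auto simp: h0 intro!: sum_nonneg)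
  also have sq: "sqrt (card I) * sqrt (2 * e * card I) = sqrt (2 * e) * card I"
    by (metis mult.commute mult.left_commute real_sqrt_mult_self real_sqrt_mult abs_of_nat)
  finally have D1: "(\<Sum>x\<in>I. d x x) \<le> 2 * sqrt (2 * e) * card I" by simp
  have "(\<Sum>x\<in>I. \<Sum>j\<in>I. M x j * d x j) \<le> (\<Sum>x\<in>I. \<Sum>j\<in>I. M x j * (2 * sqrt (h x j)))"
    using d ds by (intro sum_mono mult_left_mono) auto
  also have "\<dots> = 2 * (\<Sum>(x,j)\<in>I \<times> I. M x j * sqrt (h x j))"
    by (simp add: sum_distrib_left sum.cartesian_product mult_ac case_prod_unfold)
  also have "(\<Sum>(x,j)\<in>I \<times> I. M x j * sqrt (h x j)) \<le>
      sqrt (\<Sum>(x,j)\<in>I \<times> I. M x j) * sqrt (\<Sum>(x,j)\<in>I \<times> I. M x j * h x j)"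
    using weighted_sqrt_le[of "I \<times> I" "\<lambda>(x,j). M x j" "\<lambda>(x,j). h x j"] ds h0
    by (auto simp: case_prod_unfold)
  also have "(\<Sum>(x,j)\<in>I \<times> I. M x j) = card I"
    using ds by (simp flip: sum.cartesian_product)
  also have "(\<Sum>(x,j)\<in>I \<times> I. M x j * h x j) = (\<Sum>x\<in>I. \<Sum>j\<in>I. M x j * h x j)"
    by (simp add: sum.cartesian_product)
  also have "sqrt (card I) * sqrt (\<Sum>x\<in>I. \<Sum>j\<in>I. M x j * h x j) \<le> sqrt (card I) * sqrt (2 * e * card I)"
    using H2 by (intro mult_left_mono) auto
  finally have D2: "(\<Sum>x\<in>I. \<Sum>j\<in>I. M x j * d x j) \<le> 2 * sqrt (2 * e) * card I"
    unfolding sq by simp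
  \<comment> \<open>Triangle inequality through row x of \<open>c\<close>; row y of Q u is the
    \<open>Q y\<close>-average of the rows of \<open>u\<close>.\<close>
  have "(\<Sum>x\<in>I. \<Sum>y\<in>I. u x y * (\<Sum>z\<in>I. \<bar>mat_times I Q u y z - u x z\<bar>)) \<le>
    (\<Sum>x\<in>I. \<Sum>y\<in>I. u x y * ((\<Sum>j\<in>I. Q y j * d x j) + d x x))"
  proof (intro sum_mono mult_left_mono)
    fix x y assume xy: "x \<in> I" "y \<in> I"
    show "u x y \<ge> 0" using ds xy by auto
    have "(\<Sum>z\<in>I. \<bar>mat_times I Q u y z - u x z\<bar>) \<le> (\<Sum>z\<in>I. (\<Sum>j\<in>I. Q y j * \<bar>u j z - c x z\<bar>) + \<bar>u x z - c x z\<bar>)"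
    proof (rule sum_mono)
      fix z assume z: "z \<in> I"
      have "mat_times I Q u y z - c x z = (\<Sum>j\<in>I. Q y j * (u j z - c x z))"
        using ds xy by (simp add: mat_times_def right_diff_distrib sum_subtractf flip: sum_distrib_right)
      then have "\<bar>mat_times I Q u y z - c x z\<bar> \<le> (\<Sum>j\<in>I. \<bar>Q y j * (u j z - c x z)\<bar>)" by simp
      also have "\<dots> = (\<Sum>j\<in>I. Q y j * \<bar>u j z - c x z\<bar>)" using ds xy by (simp add: abs_mult)
      finally show "\<bar>mat_times I Q u y z - u x z\<bar> \<le> (\<Sum>j\<in>I. Q y j * \<bar>u j z - c x z\<bar>) + \<bar>u x z - c x z\<bar>" by linarith
    qed
    also have "\<dots> = (\<Sum>j\<in>I. Q y j * d x j) + d x x"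
      by (simp add: sum.distrib d_def sum_distrib_left) (rule sum.swap)
    finally show "(\<Sum>z\<in>I. \<bar>mat_times I Q u y z - u x z\<bar>) \<le> (\<Sum>j\<in>I. Q y j * d x j) + d x x" .
  qed
  also have "\<dots> = (\<Sum>x\<in>I. \<Sum>y\<in>I. \<Sum>j\<in>I. u x y * Q y j * d x j) + (\<Sum>x\<in>I. (\<Sum>y\<in>I. u x y) * d x x)"
    by (simp add: distrib_left sum.distrib sum_distrib_left sum_distrib_right mult_ac)
  also have "(\<Sum>x\<in>I. (\<Sum>y\<in>I. u x y) * d x x) = (\<Sum>x\<in>I. d x x)" using ds by simp
  also have "(\<Sum>x\<in>I. \<Sum>y\<in>I. \<Sum>j\<in>I. u x y * Q y j * d x j) = (\<Sum>x\<in>I. \<Sum>j\<in>I. M x j * d x j)"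
    unfolding M_def mat_times_def sum_distrib_right by (intro sum.cong refl sum.swap)
  finally show ?thesis using D1 D2 by linarith
qed

primrec alt_power :: "'a set \<Rightarrow> ('a \<Rightarrow> 'a \<Rightarrow> real) \<Rightarrow> ('a \<Rightarrow> 'a \<Rightarrow> real) \<Rightarrow> nat \<Rightarrow> 'a \<Rightarrow> 'a \<Rightarrow> real" where
  "alt_power I P Q 0 = P"
| "alt_power I P Q (Suc l) = mat_times I (mat_times I P Q) (alt_power I P Q l)"

lemma alt_power_mult:
  "mat_times I (mat_times I (alt_power I P Q a) Q) (alt_power I P Q b) = alt_power I P Q (Suc (a + b))"
  by (induction a) (simp_all add: mat_times_assoc)

text \<open>Nonnegative combinations of the alternating powers \<open>(P Q)\<^sup>l P\<close> with \<open>l < 2\<^sup>k\<close>: the time is doubled in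
  each step, while averaging avoids periodicity.\<close>
primrec smoothed :: "'a set \<Rightarrow> ('a \<Rightarrow> 'a \<Rightarrow> real) \<Rightarrow> ('a \<Rightarrow> 'a \<Rightarrow> real) \<Rightarrow> nat \<Rightarrow> 'a \<Rightarrow> 'a \<Rightarrow> real" where
  "smoothed I P Q 0 = P"
| "smoothed I P Q (Suc k) = (\<lambda>x y. (smoothed I P Q k x y +
     mat_times I (mat_times I (smoothed I P Q k) Q) (smoothed I P Q k) x y) / 2)"

definition mat_trace :: "'a set \<Rightarrow> ('a \<Rightarrow> 'a \<Rightarrow> real) \<Rightarrow> real" where
  "mat_trace I u = (\<Sum>x\<in>I. u x x)"

lemma mat_trace_commute: "mat_trace I (mat_times I u v) = mat_trace I (mat_times I v u)"
  unfolding mat_trace_def mat_times_def by (subst sum.swap) (simp add: mult.commute)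

lemma mat_times_mean:
  "mat_times I c (\<lambda>x y. (u x y + v x y) / 2) = (\<lambda>x y. (mat_times I c u x y + mat_times I c v x y) / 2)"
  by (auto simp: mat_times_def sum_divide_distrib sum.distrib[symmetric] field_simps intro!: ext sum.cong)

lemma mat_trace_mean: "mat_trace I (\<lambda>x y. (u x y + v x y) / 2) = (mat_trace I u + mat_trace I v) / 2"
  by (simp add: mat_trace_def sum.distrib flip: sum_divide_distrib)

text \<open>A convex combination cannot exceed all of its terms. In S Q S both factors S have to be
  expanded; the induction hypothesis treats one at a time, and by cyclicity of the trace everything
  else moves into the arbitrary matrix \<open>c\<close>.\<close>

lemma mat_trace_smoothed_less:
  assumes "\<And>l. l < 2 ^ k \<Longrightarrow> mat_trace I (mat_times I c (alt_power I P Q l)) < t"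
  shows "mat_trace I (mat_times I c (smoothed I P Q k)) < t"
  using assms
proof (induction k arbitrary: c)
  case (Suc k)
  let ?S = "smoothed I P Q k" and ?R = "alt_power I P Q"
  have "mat_trace I (mat_times I c (mat_times I (mat_times I ?S Q) ?S)) =
      mat_trace I (mat_times I (mat_times I (mat_times I Q ?S) c) ?S)"
    by (metis mat_times_assoc mat_trace_commute)
  also have "\<dots> < t"
  proof (rule Suc.IH)
    fix l :: nat assume l: "l < 2 ^ k"
    have "mat_trace I (mat_times I (mat_times I (mat_times I Q ?S) c) (?R l)) =
        mat_trace I (mat_times I (mat_times I (mat_times I c (?R l)) Q) ?S)"
      by (metis mat_times_assoc mat_trace_commute)
    also have "\<dots> < t"
    proof (rule Suc.IH)
      fix l' :: nat assume l': "l' < 2 ^ k"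
      have "mat_times I (mat_times I (mat_times I c (?R l)) Q) (?R l') = mat_times I c (?R (Suc (l + l')))"
        by (simp only: mat_times_assoc flip: alt_power_mult)
      then show "mat_trace I (mat_times I (mat_times I (mat_times I c (?R l)) Q) (?R l')) < t"
        using Suc.prems[of "Suc (l + l')"] l l' by simp
    qed
    finally show "mat_trace I (mat_times I (mat_times I (mat_times I Q ?S) c) (?R l)) < t" .
  qed
  finally have "mat_trace I (mat_times I c (mat_times I (mat_times I ?S Q) ?S)) < t" .
  moreover have "mat_trace I (mat_times I c ?S) < t" using Suc by auto
  ultimately show ?case by (simp add: mat_times_mean mat_trace_mean)
qed simp

lemma doubly_stochastic_smoothed:
  assumes "doubly_stochastic I P" "doubly_stochastic I Q"
  shows "doubly_stochastic I (smoothed I P Q k)"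
  by (induction k) (auto intro!: doubly_stochastic_mean doubly_stochastic_mat_times assms)

text \<open>The tangent inequality at the uniform matrix, where the linear terms sum to 0.\<close>

lemma neg_entropy_ge:
  assumes I: "finite I" "I \<noteq> {}" and u: "doubly_stochastic I u"
  shows "neg_entropy I u \<ge> - (card I * ln (card I))"
proof -
  define s where "s = 1 / real (card I)"
  have c: "card I > 0" using I by (simp add: card_gt_0_iff)
  have "(\<Sum>x\<in>I. \<Sum>y\<in>I. s * ln s + (1 + ln s) * (u x y - s)) \<le> neg_entropy I u"
    unfolding neg_entropy_def
  proof (intro sum_mono)
    fix x y assume "x \<in> I" "y \<in> I"
    then have "u x y \<ge> 0" using u by (simp add: doubly_stochastic_def)
    then have "u x y * ln (u x y) \<ge> s * ln s + (1 + ln s) * (u x y - s) + (sqrt (u x y) - sqrt s)^2"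
      using c by (intro xlnx_ge) (auto simp: s_def)
    then show "s * ln s + (1 + ln s) * (u x y - s) \<le> u x y * ln (u x y)"
      using zero_le_power2[of "sqrt (u x y) - sqrt s"] by linarith
  qed
  also have "(\<Sum>x\<in>I. \<Sum>y\<in>I. s * ln s + (1 + ln s) * (u x y - s)) =
      card I * (card I * (s * ln s)) + (1 + ln s) * ((\<Sum>x\<in>I. \<Sum>y\<in>I. u x y) - card I * (card I * s))"
    by (simp add: sum.distrib sum_subtractf flip: sum_distrib_left)
  also have "(\<Sum>x\<in>I. \<Sum>y\<in>I. u x y) = card I" using u by (simp add: doubly_stochastic_def)
  finally show ?thesis using c by (simp add: s_def ln_div)
qed

text \<open>Telescoping: \<open>P\<close> starts at most \<open>e * J * card I\<close> above the
  minimum of the functional, so J steps cannot all descend by more than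
  \<open>e * card I\<close>.\<close>

lemma exists_small_drop:
  fixes e :: real and J :: nat
  assumes I: "finite I" "I \<noteq> {}" and PQ: "doubly_stochastic I P" "doubly_stochastic I Q"
    and P: "neg_entropy I P \<le> e * J * card I - card I * ln (card I)" and J: "J > 0"
  obtains k where "k < J"
    "neg_entropy I (smoothed I P Q k) - neg_entropy I (smoothed I P Q (Suc k)) \<le> e * card I"
proof -
  let ?n = "\<lambda>k. neg_entropy I (smoothed I P Q k)"
  have "\<exists>k<J. ?n k - ?n (Suc k) \<le> e * card I"
  proof (rule ccontr)
    assume "\<not> ?thesis"
    then have "(\<Sum>k<J. e * card I) < (\<Sum>k<J. ?n k - ?n (Suc k))"
      using J by (intro sum_strict_mono) auto
    also have "\<dots> = ?n 0 - ?n J" by (induction J) auto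
    also have "\<dots> \<le> e * J * card I"
      using P neg_entropy_ge[OF I doubly_stochastic_smoothed[OF PQ, of J]] by simp
    finally show False by (simp add: mult_ac)
  qed
  then show ?thesis using that by blast
qed

section \<open>Loss of mass under products and smoothing\<close>

definition mat_le :: "'a set \<Rightarrow> ('a \<Rightarrow> 'a \<Rightarrow> real) \<Rightarrow> ('a \<Rightarrow> 'a \<Rightarrow> real) \<Rightarrow> bool" where
  "mat_le I u v \<longleftrightarrow> (\<forall>x\<in>I. \<forall>y\<in>I. 0 \<le> u x y \<and> u x y \<le> v x y)"

definition mat_loss :: "'a set \<Rightarrow> ('a \<Rightarrow> 'a \<Rightarrow> real) \<Rightarrow> ('a \<Rightarrow> 'a \<Rightarrow> real) \<Rightarrow> real" where
  "mat_loss I u v = (\<Sum>x\<in>I. \<Sum>y\<in>I. v x y - u x y)"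

lemma mat_le_mat_times:
  assumes "mat_le I u' u" "mat_le I v' v"
  shows "mat_le I (mat_times I u' v') (mat_times I u v)"
  using assms unfolding mat_le_def mat_times_def
  by (auto intro!: sum_nonneg sum_mono mult_mono intro: order_trans)

text \<open>The total mass of a product is the sum over y of column sum y of the first factor times
  row sum y of the second. These sums are at most 1, and 1 - a b \<le> (1 - a) + (1 - b) for such a
  and b.\<close>

lemma mat_loss_mat_times:
  assumes u: "mat_le I u' u" "doubly_stochastic I u" and v: "mat_le I v' v" "doubly_stochastic I v"
  shows "mat_loss I (mat_times I u' v') (mat_times I u v) \<le> mat_loss I u' u + mat_loss I v' v"
proof -
  note u = u[unfolded mat_le_def doubly_stochastic_def] and v = v[unfolded mat_le_def doubly_stochastic_def]
  have "mat_loss I (mat_times I u' v') (mat_times I u v) =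
     (\<Sum>x\<in>I. \<Sum>z\<in>I. mat_times I u v x z) - (\<Sum>x\<in>I. \<Sum>z\<in>I. mat_times I u' v' x z)"
    by (simp add: mat_loss_def sum_subtractf)
  also have "(\<Sum>x\<in>I. \<Sum>z\<in>I. mat_times I u' v' x z) = (\<Sum>y\<in>I. (\<Sum>x\<in>I. u' x y) * (\<Sum>z\<in>I. v' y z))"
    by (simp only: sum_mat_times_row) (subst sum.swap, simp add: sum_distrib_right)
  also have "(\<Sum>x\<in>I. \<Sum>z\<in>I. mat_times I u v x z) = (\<Sum>y\<in>I. (\<Sum>x\<in>I. u x y) * (\<Sum>z\<in>I. v y z))"
    by (simp only: sum_mat_times_row) (subst sum.swap, simp add: sum_distrib_right)
  also have "\<dots> = (\<Sum>y\<in>I. 1)" using u v by simp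
  also have "\<dots> - (\<Sum>y\<in>I. (\<Sum>x\<in>I. u' x y) * (\<Sum>z\<in>I. v' y z)) \<le>
     (\<Sum>y\<in>I. (1 - (\<Sum>x\<in>I. u' x y)) + (1 - (\<Sum>z\<in>I. v' y z)))"
    unfolding sum_subtractf[symmetric]
  proof (rule sum_mono)
    fix y assume y: "y \<in> I"
    have "(\<Sum>x\<in>I. u' x y) \<le> (\<Sum>x\<in>I. u x y)" using u y by (intro sum_mono) auto
    then have "1 - (\<Sum>x\<in>I. u' x y) \<ge> 0" using u y by simp
    moreover have "(\<Sum>x\<in>I. v' y x) \<le> (\<Sum>x\<in>I. v y x)" using v y by (intro sum_mono) auto
    then have "1 - (\<Sum>x\<in>I. v' y x) \<ge> 0" using v y by simp
    ultimately have "(1 - (\<Sum>x\<in>I. u' x y)) * (1 - (\<Sum>x\<in>I. v' y x)) \<ge> 0" by simp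
    then show "1 - (\<Sum>x\<in>I. u' x y) * (\<Sum>z\<in>I. v' y z) \<le> 1 - (\<Sum>x\<in>I. u' x y) + (1 - (\<Sum>z\<in>I. v' y z))"
      by (simp add: algebra_simps)
  qed
  also have "\<dots> = (\<Sum>y\<in>I. 1 - (\<Sum>x\<in>I. u' x y)) + (\<Sum>y\<in>I. 1 - (\<Sum>z\<in>I. v' y z))" by (rule sum.distrib)
  also have "(\<Sum>y\<in>I. 1 - (\<Sum>z\<in>I. v' y z)) = mat_loss I v' v"
    using v by (auto simp: mat_loss_def sum_subtractf)
  also have "(\<Sum>y\<in>I. 1 - (\<Sum>x\<in>I. u' x y)) = mat_loss I u' u"
  proof -
    have "mat_loss I u' u = (\<Sum>y\<in>I. \<Sum>x\<in>I. u x y - u' x y)" unfolding mat_loss_def by (rule sum.swap)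
    then show ?thesis using u by (auto simp: sum_subtractf)
  qed
  finally show ?thesis .
qed

lemma mat_le_smoothed:
  assumes "mat_le I P' P" "mat_le I Q' Q"
  shows "mat_le I (smoothed I P' Q' k) (smoothed I P Q k)"
proof (induction k)
  case (Suc k)
  have "mat_le I (mat_times I (mat_times I (smoothed I P' Q' k) Q') (smoothed I P' Q' k))
     (mat_times I (mat_times I (smoothed I P Q k) Q) (smoothed I P Q k))"
    by (intro mat_le_mat_times Suc assms)
  then show ?case using Suc unfolding mat_le_def by (auto intro: add_mono)
qed (use assms in simp)

text \<open>S Q S has two factors S and one Q, so the loss x becomes at most 2 x + d in each
  step.\<close>

lemma mat_loss_smoothed:
  assumes P: "mat_le I P' P" "doubly_stochastic I P" "mat_loss I P' P \<le> d"
    and Q: "mat_le I Q' Q" "doubly_stochastic I Q" "mat_loss I Q' Q \<le> d"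
  shows "mat_loss I (smoothed I P' Q' k) (smoothed I P Q k) \<le> (2 ^ (k + 1) - 1) * d"
proof (induction k)
  case 0
  then show ?case using P by simp
next
  case (Suc k)
  let ?u = "smoothed I P Q k" and ?u' = "smoothed I P' Q' k"
  have u: "mat_le I ?u' ?u" "doubly_stochastic I ?u"
    using mat_le_smoothed doubly_stochastic_smoothed P Q by blast+
  have d0: "mat_loss I Q' Q \<ge> 0" using Q by (auto simp: mat_loss_def mat_le_def intro!: sum_nonneg)
  have l0: "mat_loss I ?u' ?u \<ge> 0" using u by (auto simp: mat_loss_def mat_le_def intro!: sum_nonneg)
  have "mat_loss I (mat_times I (mat_times I ?u' Q') ?u') (mat_times I (mat_times I ?u Q) ?u)
      \<le> mat_loss I (mat_times I ?u' Q') (mat_times I ?u Q) + mat_loss I ?u' ?u"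
    by (intro mat_loss_mat_times mat_le_mat_times doubly_stochastic_mat_times u P Q)
  also have "mat_loss I (mat_times I ?u' Q') (mat_times I ?u Q) \<le> mat_loss I ?u' ?u + mat_loss I Q' Q"
    by (intro mat_loss_mat_times u Q)
  finally have 1: "mat_loss I (mat_times I (mat_times I ?u' Q') ?u') (mat_times I (mat_times I ?u Q) ?u)
    \<le> 2 * mat_loss I ?u' ?u + d" using Q by simp
  have "mat_loss I (smoothed I P' Q' (Suc k)) (smoothed I P Q (Suc k)) =
    (mat_loss I ?u' ?u + mat_loss I (mat_times I (mat_times I ?u' Q') ?u') (mat_times I (mat_times I ?u Q) ?u)) / 2"
    by (simp add: mat_loss_def sum.distrib sum_subtractf flip: sum_divide_distrib) argo
  also have "\<dots> \<le> 2 * mat_loss I ?u' ?u + d"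
    using 1 l0 d0 Q(3) by argo
  also have "\<dots> \<le> 2 * ((2 ^ (k + 1) - 1) * d) + d" using Suc by simp
  finally show ?case by (simp add: algebra_simps)
qed

text \<open>By averaging, a single row a of \<open>u\<close> satisfies the hypothesis with error
  \<open>w\<close>. If g y z \<ge> a z / 2 and g z y \<ge> a y / 2 held for all pairs, the trace
  would be at least 1 / 4, since a sums to 1. A pair violating one of these has a correspondingly
  large error term, which is subtracted.\<close>

lemma trace_square_ge:
  fixes w :: real
  assumes I: "finite I" "I \<noteq> {}" and u: "doubly_stochastic I u"
    and g: "\<And>x y. x \<in> I \<Longrightarrow> y \<in> I \<Longrightarrow> g x y \<ge> 0"
    and close: "(\<Sum>x\<in>I. \<Sum>y\<in>I. u x y * (\<Sum>z\<in>I. \<bar>g y z - u x z\<bar>)) \<le> w * card I"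
  shows "mat_trace I (mat_times I g g) \<ge> (1 - 4 * w) / 4"
proof -
  have "\<exists>x\<in>I. (\<Sum>y\<in>I. u x y * (\<Sum>z\<in>I. \<bar>g y z - u x z\<bar>)) \<le> w"
  proof (rule ccontr)
    assume "\<not> ?thesis"
    then have "(\<Sum>x\<in>I. w) < (\<Sum>x\<in>I. \<Sum>y\<in>I. u x y * (\<Sum>z\<in>I. \<bar>g y z - u x z\<bar>))"
      using I by (intro sum_strict_mono) auto
    then show False using close by (simp add: mult.commute)
  qed
  then obtain x where x: "x \<in> I" "(\<Sum>y\<in>I. u x y * (\<Sum>z\<in>I. \<bar>g y z - u x z\<bar>)) \<le> w" by blast
  let ?a = "u x"
  have a: "?a y \<ge> 0" if "y \<in> I" for y using u x that by (simp add: doubly_stochastic_def)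
  have s: "sum ?a I = 1" using u x by (simp add: doubly_stochastic_def)
  have key: "?a y * ?a z - 2 * (?a y * \<bar>g y z - ?a z\<bar>) - 2 * (?a z * \<bar>g z y - ?a y\<bar>) \<le> 4 * (g y z * g z y)"
    if yz: "y \<in> I" "z \<in> I" for y z
  proof (cases "g y z \<ge> ?a z / 2 \<and> g z y \<ge> ?a y / 2")
    case True
    then have "?a z / 2 * (?a y / 2) \<le> g y z * g z y" using a yz by (intro mult_mono) (auto simp: g)
    moreover have "?a y * \<bar>g y z - ?a z\<bar> \<ge> 0" "?a z * \<bar>g z y - ?a y\<bar> \<ge> 0" using a yz by auto
    ultimately show ?thesis by (simp add: mult.commute)
  next
    case False
    have "?a y * ?a z \<le> 2 * (?a y * \<bar>g y z - ?a z\<bar>) + 2 * (?a z * \<bar>g z y - ?a y\<bar>)"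
    proof (cases "g y z \<ge> ?a z / 2")
      case True
      then have "g z y < ?a y / 2" using False by simp
      moreover have "?a y - g z y \<le> \<bar>g z y - ?a y\<bar>" by simp
      ultimately have "?a y \<le> 2 * \<bar>g z y - ?a y\<bar>" using a[OF yz(1)] by argo
      then have "?a z * ?a y \<le> ?a z * (2 * \<bar>g z y - ?a y\<bar>)" using a yz by (intro mult_left_mono) auto
      moreover have "?a y * \<bar>g y z - ?a z\<bar> \<ge> 0" using a yz by auto
      ultimately show ?thesis by (simp add: mult.commute)
    next
      case False
      then have "g y z < ?a z / 2" by simp
      moreover have "?a z - g y z \<le> \<bar>g y z - ?a z\<bar>" by simp
      ultimately have "?a z \<le> 2 * \<bar>g y z - ?a z\<bar>" using a[OF yz(2)] by argo
      then have "?a y * ?a z \<le> ?a y * (2 * \<bar>g y z - ?a z\<bar>)" using a yz by (intro mult_left_mono) auto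
      moreover have "?a z * \<bar>g z y - ?a y\<bar> \<ge> 0" using a yz by auto
      ultimately show ?thesis by (simp add: mult.commute)
    qed
    moreover have "g y z * g z y \<ge> 0" using yz by (simp add: g)
    ultimately show ?thesis by linarith
  qed
  have "(\<Sum>y\<in>I. \<Sum>z\<in>I. ?a y * ?a z - 2 * (?a y * \<bar>g y z - ?a z\<bar>) - 2 * (?a z * \<bar>g z y - ?a y\<bar>))
     \<le> (\<Sum>y\<in>I. \<Sum>z\<in>I. 4 * (g y z * g z y))"
    by (intro sum_mono key)
  also have "\<dots> = 4 * mat_trace I (mat_times I g g)"
    by (simp add: mat_trace_def mat_times_def sum_distrib_left)
  also have "(\<Sum>y\<in>I. \<Sum>z\<in>I. ?a y * ?a z - 2 * (?a y * \<bar>g y z - ?a z\<bar>) - 2 * (?a z * \<bar>g z y - ?a y\<bar>)) =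
     (\<Sum>y\<in>I. \<Sum>z\<in>I. ?a y * ?a z) - 2 * (\<Sum>y\<in>I. \<Sum>z\<in>I. ?a y * \<bar>g y z - ?a z\<bar>)
      - 2 * (\<Sum>y\<in>I. \<Sum>z\<in>I. ?a z * \<bar>g z y - ?a y\<bar>)"
    by (simp add: sum_subtractf sum_distrib_left)
  also have "(\<Sum>y\<in>I. \<Sum>z\<in>I. ?a z * \<bar>g z y - ?a y\<bar>) = (\<Sum>y\<in>I. \<Sum>z\<in>I. ?a y * \<bar>g y z - ?a z\<bar>)"
    by (rule sum.swap)
  also have "(\<Sum>y\<in>I. \<Sum>z\<in>I. ?a y * ?a z) = 1" using s by (simp flip: sum_distrib_left)
  finally have "1 - 2 * (\<Sum>y\<in>I. \<Sum>z\<in>I. ?a y * \<bar>g y z - ?a z\<bar>) - 2 * (\<Sum>y\<in>I. \<Sum>z\<in>I. ?a y * \<bar>g y z - ?a z\<bar>)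
    \<le> 4 * mat_trace I (mat_times I g g)" .
  moreover have "(\<Sum>y\<in>I. \<Sum>z\<in>I. ?a y * \<bar>g y z - ?a z\<bar>) \<le> w" using x(2) by (simp add: sum_distrib_left)
  ultimately show ?thesis by argo
qed

text \<open>Entropy is controlled for the doubly stochastic \<open>P\<close>, whereas walks are
  counted with the minorants \<open>P'\<close> and \<open>Q'\<close>. A smoothing step that hardly
  changes the entropy makes the square of Q u have large trace, and the small loss of mass transfers
  this to Q' u'. Expanding both factors u' yields one alternating power that is responsible.\<close>

lemma exists_heavy_closed_walks:
  fixes J :: nat
  assumes I: "finite I" "I \<noteq> {}" and J: "J > 0"
    and P: "mat_le I P' P" "doubly_stochastic I P" "mat_loss I P' P \<le> card I / 2 ^ (J + 6)"
    and Q: "mat_le I Q' Q" "doubly_stochastic I Q" "mat_loss I Q' Q \<le> card I / 2 ^ (J + 6)"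
    and ent: "neg_entropy I P \<le> J / 2 ^ 15 * card I - card I * ln (card I)"
  obtains l where "l < 2 ^ (J + 1)" "mat_trace I (mat_times I Q' (alt_power I P' Q' l)) \<ge> 1 / 8"
proof -
  \<comment> \<open>With e = 1 / 2^15 the error in \<open>rows_close\<close> is 4 sqrt (2 / 2^15) =
    1 / 32. The loss of mass adds at most 2^J / 2^(J+6) = 1 / 64. This stays below w = 1 / 16, for
    which \<open>trace_square_ge\<close> gives 3 / 16.\<close>
  obtain k where k: "k < J"
    "neg_entropy I (smoothed I P Q k) - neg_entropy I (smoothed I P Q (Suc k)) \<le> 1 / 2 ^ 15 * card I"
    using exists_small_drop[OF I P(2) Q(2), of "1 / 2 ^ 15" J] J ent by (auto simp: mult_ac)
  let ?u = "smoothed I P Q k" and ?u' = "smoothed I P' Q' k"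
  have u: "doubly_stochastic I ?u" using P Q doubly_stochastic_smoothed by blast
  have u': "mat_le I ?u' ?u" using P Q mat_le_smoothed by blast
  define g where "g = mat_times I Q' ?u'"
  define G where "G = mat_times I Q ?u"
  have gG: "mat_le I g G" unfolding g_def G_def by (intro mat_le_mat_times Q u')
  have "mat_loss I g G \<le> mat_loss I Q' Q + mat_loss I ?u' ?u"
    unfolding g_def G_def by (intro mat_loss_mat_times Q u u')
  also have "\<dots> \<le> card I / 2 ^ (J + 6) + (2 ^ (k + 1) - 1) * (card I / 2 ^ (J + 6))"
    using mat_loss_smoothed[OF P Q] Q by (intro add_mono)
  also have "\<dots> = 2 ^ (k + 1) * (card I / 2 ^ (J + 6))" by (simp only: left_diff_distrib)
  also have "\<dots> \<le> 2 ^ J * (card I / 2 ^ (J + 6))"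
    using k by (intro mult_right_mono power_increasing) auto
  also have "\<dots> = card I / 64" by (simp add: power_add)
  finally have loss: "mat_loss I g G \<le> card I / 64" .
  have "(\<Sum>x\<in>I. \<Sum>y\<in>I. ?u x y * (\<Sum>z\<in>I. \<bar>G y z - ?u x z\<bar>)) \<le> 4 * sqrt (2 * (1 / 2 ^ 15)) * card I"
    unfolding G_def using k by (intro rows_close I u Q) auto
  also have "sqrt (2 * (1 / 2 ^ 15)) = 1 / (2 ^ 7 :: real)"
    by (rule real_sqrt_unique) (auto simp: power_one_over power_mult[symmetric])
  finally have cl: "(\<Sum>x\<in>I. \<Sum>y\<in>I. ?u x y * (\<Sum>z\<in>I. \<bar>G y z - ?u x z\<bar>)) \<le> card I / 32" by simp
  have "(\<Sum>x\<in>I. \<Sum>y\<in>I. ?u x y * (\<Sum>z\<in>I. \<bar>g y z - ?u x z\<bar>)) \<le>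
     (\<Sum>x\<in>I. \<Sum>y\<in>I. ?u x y * ((\<Sum>z\<in>I. G y z - g y z) + (\<Sum>z\<in>I. \<bar>G y z - ?u x z\<bar>)))"
  proof (intro sum_mono mult_left_mono)
    fix x y assume xy: "x \<in> I" "y \<in> I"
    show "?u x y \<ge> 0" using u xy by (simp add: doubly_stochastic_def)
    show "(\<Sum>z\<in>I. \<bar>g y z - ?u x z\<bar>) \<le> (\<Sum>z\<in>I. G y z - g y z) + (\<Sum>z\<in>I. \<bar>G y z - ?u x z\<bar>)"
      unfolding sum.distrib[symmetric]
    proof (rule sum_mono)
      fix z assume "z \<in> I"
      then have "G y z \<ge> g y z" using gG xy by (simp add: mat_le_def)
      then show "\<bar>g y z - ?u x z\<bar> \<le> G y z - g y z + \<bar>G y z - ?u x z\<bar>" by linarith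
    qed
  qed
  also have "\<dots> = (\<Sum>x\<in>I. \<Sum>y\<in>I. ?u x y * (\<Sum>z\<in>I. G y z - g y z)) +
     (\<Sum>x\<in>I. \<Sum>y\<in>I. ?u x y * (\<Sum>z\<in>I. \<bar>G y z - ?u x z\<bar>))"
    by (simp add: distrib_left sum.distrib)
  also have "(\<Sum>x\<in>I. \<Sum>y\<in>I. ?u x y * (\<Sum>z\<in>I. G y z - g y z)) = (\<Sum>y\<in>I. (\<Sum>x\<in>I. ?u x y) * (\<Sum>z\<in>I. G y z - g y z))"
    by (subst sum.swap) (simp add: sum_distrib_right)
  also have "\<dots> = mat_loss I g G" using u by (simp add: doubly_stochastic_def mat_loss_def)
  finally have "(\<Sum>x\<in>I. \<Sum>y\<in>I. ?u x y * (\<Sum>z\<in>I. \<bar>g y z - ?u x z\<bar>)) \<le> 1 / 16 * card I"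
    using loss cl by linarith
  then have "mat_trace I (mat_times I g g) \<ge> (1 - 4 * (1 / 16)) / 4"
    using gG by (intro trace_square_ge[OF I u]) (auto simp: mat_le_def)
  then have tr: "mat_trace I (mat_times I g g) \<ge> 1 / 8" by simp
  have "\<exists>l<2 ^ (J + 1). mat_trace I (mat_times I Q' (alt_power I P' Q' l)) \<ge> 1 / 8"
  proof (rule ccontr)
    assume neg: "\<not> ?thesis"
    have "mat_trace I (mat_times I g g) = mat_trace I (mat_times I (mat_times I g Q') ?u')"
      unfolding g_def by (metis mat_times_assoc)
    also have "\<dots> < 1 / 8"
    proof (rule mat_trace_smoothed_less)
      fix l :: nat assume l: "l < 2 ^ k"
      have "mat_trace I (mat_times I (mat_times I g Q') (alt_power I P' Q' l)) =
         mat_trace I (mat_times I (mat_times I (mat_times I Q' (alt_power I P' Q' l)) Q') ?u')"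
        unfolding g_def by (metis mat_times_assoc mat_trace_commute)
      also have "\<dots> < 1 / 8"
      proof (rule mat_trace_smoothed_less)
        fix l' :: nat assume l': "l' < 2 ^ k"
        have "mat_times I (mat_times I (mat_times I Q' (alt_power I P' Q' l)) Q') (alt_power I P' Q' l') =
          mat_times I Q' (alt_power I P' Q' (Suc (l + l')))"
          by (simp only: mat_times_assoc flip: alt_power_mult)
        moreover have "Suc (l + l') < 2 ^ (J + 1)"
        proof -
          have "(2::nat) ^ k \<le> 2 ^ J" using k by (intro power_increasing) auto
          then show ?thesis using l l' unfolding power_add power_one_right by linarith
        qed
        ultimately show "mat_trace I (mat_times I (mat_times I (mat_times I Q' (alt_power I P' Q' l)) Q') (alt_power I P' Q' l')) < 1 / 8"
          using neg by auto
      qed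
      finally show "mat_trace I (mat_times I (mat_times I g Q') (alt_power I P' Q' l)) < 1 / 8" .
    qed
    finally show False using tr by simp
  qed
  then show ?thesis using that by blast
qed

section \<open>Closed walks alternating between two permutations\<close>

text \<open>Walks that take \<open>E\<close>-edges and \<open>F\<close>-edges in turn, starting and
  ending with an \<open>E\<close>-edge. Only the \<open>l + 1\<close> edges of \<open>E\<close> are
  recorded; they determine the \<open>l\<close> edges of \<open>F\<close> in between.\<close>

primrec alt_walks :: "('a \<times> 'a) set \<Rightarrow> ('a \<times> 'a) set \<Rightarrow> nat \<Rightarrow> 'a \<Rightarrow> 'a \<Rightarrow> ('a \<times> 'a) list set" where
  "alt_walks E F 0 x y = (if (x, y) \<in> E then {[(x, y)]} else {})"
| "alt_walks E F (Suc l) x y =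
     (\<Union>(y', x')\<in>{(y', x'). (x, y') \<in> E \<and> (y', x') \<in> F}. (#) (x, y') ` alt_walks E F l x' y)"

text \<open>The \<open>F\<close>-edges of a closed walk, each leading from the end of a recorded
  edge to the start of the next one in cyclic order.\<close>

definition links :: "('a \<times> 'a) list \<Rightarrow> ('a \<times> 'a) list" where
  "links es = zip (map snd es) (rotate1 (map fst es))"

lemma alt_walks_props:
  assumes "es \<in> alt_walks E F l x y"
  shows "length es = Suc l" "set es \<subseteq> E" "fst (hd es) = x" "snd (last es) = y"
    "(y, z) \<in> F \<Longrightarrow> set (zip (map snd es) (tl (map fst es) @ [z])) \<subseteq> F"
  using assms
proof (induction l arbitrary: es x)
  case (Suc l)
  {
    case 1 then show ?case using Suc.IH(1) by auto
  next
    case 2 then show ?case using Suc.IH(2) by fastforce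
  next
    case 3 then show ?case by auto
  next
    case 4
    then obtain es' y' x' where "es = (x, y') # es'" "es' \<in> alt_walks E F l x' y" by auto
    moreover from Suc.IH(1)[OF this(2)] have "es' \<noteq> []" by auto
    ultimately show ?case using Suc.IH(4) by auto
  next
    case 5
    then obtain es' y' x' where *: "es = (x, y') # es'" "es' \<in> alt_walks E F l x' y" "(y', x') \<in> F" by auto
    from Suc.IH(1)[OF *(2)] obtain e es'' where e: "es' = e # es''" by (cases es') auto
    with Suc.IH(3)[OF *(2)] have "fst e = x'" by simp
    moreover have "set (zip (map snd es') (tl (map fst es') @ [z])) \<subseteq> F" by (rule Suc.IH(5)[OF 5(1) *(2)])
    ultimately show ?case using * e by auto
  }
qed (auto split: if_splits)

lemma set_links_alt_walks:
  assumes "es \<in> alt_walks E F l x y" "(y, x) \<in> F"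
  shows "set (links es) \<subseteq> F"
proof -
  have "es \<noteq> []" "fst (hd es) = x" using alt_walks_props(1,3)[OF assms(1)] by auto
  then have "rotate1 (map fst es) = tl (map fst es) @ [x]" by (cases es) auto
  then show ?thesis using alt_walks_props(5)[OF assms] by (simp add: links_def)
qed

text \<open>Hence a bound on the number of rare lists of \<open>F\<close>-edges also bounds the
  number of walks spoilt by them.\<close>

lemma inj_links: "inj links"
proof (rule injI)
  fix es es' :: "('a \<times> 'a) list" assume eq: "links es = links es'"
  have *: "map snd es = map fst (links es)" "rotate1 (map fst es) = map snd (links es)" for es :: "('a \<times> 'a) list"
    by (simp_all add: links_def)
  have 1: "map snd es = map snd es'" by (simp only: * eq)
  have "rotate1 (map fst es) = rotate1 (map fst es')" by (simp only: * eq)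
  then have 2: "map fst es = map fst es'" by (rule injD[OF inj_rotate1])
  show "es = es'" using 1 2 by (rule pair_list_eqI[rotated])
qed

lemma alt_walks_iterate:
  assumes "es \<in> alt_walks E F l x y"
    and "\<forall>(a, b)\<in>set es. f a = b"
    and "\<forall>(a, b)\<in>set (zip (map snd es) (tl (map fst es) @ [z])). g a = b"
  shows "((g \<circ> f) ^^ Suc l) x = z"
  using assms
proof (induction l arbitrary: es x)
  case 0
  then show ?case by (auto split: if_splits)
next
  case (Suc l)
  then obtain es' y' x' where *: "es = (x, y') # es'" "es' \<in> alt_walks E F l x' y" "(y', x') \<in> F" by auto
  from alt_walks_props(1)[OF *(2)] obtain e es'' where e: "es' = e # es''" by (cases es') auto
  with alt_walks_props(3)[OF *(2)] have "fst e = x'" by simp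
  then have "(g \<circ> f) x = x'" using Suc.prems(2,3) * e by auto
  moreover have "((g \<circ> f) ^^ Suc l) x' = z"
    using Suc.prems(2,3) * e \<open>fst e = x'\<close> by (intro Suc.IH[OF *(2)]) auto
  ultimately show ?case by (metis comp_apply funpow_Suc_right)
qed

lemma finite_alt_walks: "finite E \<Longrightarrow> finite (alt_walks E F l x y)"
  by (rule finite_subset[OF _ finite_lists_length_eq[of E "Suc l"]])
     (auto dest: alt_walks_props(1,2))

text \<open>The alternating power is a sum over walks, each weighted by a product of 2 l + 1 entries
  of size at most \<open>B\<close>.\<close>

lemma alt_power_le_card:
  assumes I: "finite I" and EF: "E \<subseteq> I \<times> I" "F \<subseteq> I \<times> I" and B: "B \<ge> 0"
    and P: "\<And>x y. x \<in> I \<Longrightarrow> y \<in> I \<Longrightarrow> 0 \<le> P x y \<and> P x y \<le> (if (x, y) \<in> E then B else 0)"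
    and Q: "\<And>x y. x \<in> I \<Longrightarrow> y \<in> I \<Longrightarrow> 0 \<le> Q x y \<and> Q x y \<le> (if (x, y) \<in> F then B else 0)"
    and xy: "x \<in> I" "y \<in> I"
  shows "0 \<le> alt_power I P Q l x y \<and> alt_power I P Q l x y \<le> B ^ (2 * l + 1) * card (alt_walks E F l x y)"
  using xy
proof (induction l arbitrary: x)
  case 0
  then show ?case using P[OF 0] by (cases "(x, y) \<in> E") auto
next
  case (Suc l)
  define S where "S = {(y', x'). (x, y') \<in> E \<and> (y', x') \<in> F}"
  have S: "S \<subseteq> I \<times> I" using EF by (auto simp: S_def)
  have finS: "finite S" using finite_subset[OF S] I by simp
  have finE: "finite E" "finite F" using EF I by (auto intro: finite_subset)
  have eq: "alt_power I P Q (Suc l) x y = (\<Sum>(y', x')\<in>I \<times> I. P x y' * Q y' x' * alt_power I P Q l x' y)"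
    by (simp add: mat_times_def sum_distrib_right flip: sum.cartesian_product) (rule sum.swap)
  have nn: "0 \<le> alt_power I P Q (Suc l) x y"
    unfolding eq using P Q Suc by (auto intro!: sum_nonneg)
  have "alt_power I P Q (Suc l) x y \<le> (\<Sum>(y', x')\<in>I \<times> I.
     if (y', x') \<in> S then B * B * (B ^ (2 * l + 1) * card (alt_walks E F l x' y)) else 0)"
    unfolding eq
  proof (rule sum_mono, clarify)
    fix y' x' assume I': "y' \<in> I" "x' \<in> I"
    have a: "0 \<le> P x y' \<and> P x y' \<le> (if (x, y') \<in> E then B else 0)"
      "0 \<le> Q y' x' \<and> Q y' x' \<le> (if (y', x') \<in> F then B else 0)"
      using P Q I' Suc.prems by blast+
    have b: "0 \<le> alt_power I P Q l x' y" "alt_power I P Q l x' y \<le> B ^ (2 * l + 1) * card (alt_walks E F l x' y)"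
      using Suc.IH[OF I'(2) Suc.prems(2)] by auto
    show "P x y' * Q y' x' * alt_power I P Q l x' y \<le>
       (if (y', x') \<in> S then B * B * (B ^ (2 * l + 1) * card (alt_walks E F l x' y)) else 0)"
    proof (cases "(y', x') \<in> S")
      case True
      then have "P x y' \<le> B" "Q y' x' \<le> B" using a by (auto simp: S_def)
      then have "P x y' * Q y' x' * alt_power I P Q l x' y \<le> B * B * (B ^ (2 * l + 1) * card (alt_walks E F l x' y))"
        using a b B by (intro mult_mono) auto
      then show ?thesis using True by simp
    next
      case False
      then have "P x y' = 0 \<or> Q y' x' = 0" using a by (auto simp: S_def)
      then show ?thesis using False by auto
    qed
  qed
  also have "(\<Sum>(y', x')\<in>I \<times> I. if (y', x') \<in> S then B * B * (B ^ (2 * l + 1) * card (alt_walks E F l x' y)) else 0)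
     = (\<Sum>(y', x')\<in>S. B * B * (B ^ (2 * l + 1) * card (alt_walks E F l x' y)))"
    using I S by (intro sum.mono_neutral_cong_right) auto
  also have "\<dots> = B ^ (2 * Suc l + 1) * (\<Sum>(y', x')\<in>S. card (alt_walks E F l x' y))"
    by (simp add: sum_distrib_left case_prod_unfold mult_ac)
  also have "(\<Sum>(y', x')\<in>S. card (alt_walks E F l x' y)) = card (alt_walks E F (Suc l) x y)"
  proof -
    have "card (alt_walks E F (Suc l) x y) = (\<Sum>s\<in>S. card (case s of (y', x') \<Rightarrow> (#) (x, y') ` alt_walks E F l x' y))"
      unfolding alt_walks.simps S_def[symmetric]
    proof (rule card_UN_disjoint[OF finS])
      show "\<forall>s\<in>S. finite (case s of (y', x') \<Rightarrow> (#) (x, y') ` alt_walks E F l x' y)"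
        using finE by (auto intro!: finite_imageI finite_alt_walks)
      show "\<forall>s\<in>S. \<forall>t\<in>S. s \<noteq> t \<longrightarrow> (case s of (y', x') \<Rightarrow> (#) (x, y') ` alt_walks E F l x' y) \<inter>
         (case t of (y', x') \<Rightarrow> (#) (x, y') ` alt_walks E F l x' y) = {}"
      \<comment> \<open>The recorded edges reveal the pair: y' ends the first edge, and x' starts
        the second one.\<close>
      proof (intro ballI impI)
        fix s t assume "s \<in> S" "t \<in> S" "s \<noteq> t"
        obtain y1 x1 y2 x2 where [simp]: "s = (y1, x1)" "t = (y2, x2)" by (cases s, cases t)
        show "(case s of (y', x') \<Rightarrow> (#) (x, y') ` alt_walks E F l x' y) \<inter>
          (case t of (y', x') \<Rightarrow> (#) (x, y') ` alt_walks E F l x' y) = {}"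
        proof (rule ccontr)
          assume "\<not> ?thesis"
          then obtain es where es: "es \<in> alt_walks E F l x1 y" "es \<in> alt_walks E F l x2 y" "y1 = y2" by auto
          have "x1 = x2" using alt_walks_props(3)[OF es(1)] alt_walks_props(3)[OF es(2)] by simp
          then show False using \<open>s \<noteq> t\<close> es(3) by simp
        qed
      qed
    qed
    also have "\<dots> = (\<Sum>(y', x')\<in>S. card (alt_walks E F l x' y))"
      by (intro sum.cong refl) (auto simp: card_image)
    finally show ?thesis by simp
  qed
  finally show ?case by (rule conjI[OF nn])
qed

text \<open>The closing edge \<open>(y, x)\<close> is not recorded, being the last entry of
  \<open>links\<close>.\<close>

definition closed_walks :: "('a \<times> 'a) set \<Rightarrow> ('a \<times> 'a) set \<Rightarrow> nat \<Rightarrow> ('a \<times> 'a) list set" where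
  "closed_walks E F l = (\<Union>(y, x)\<in>F. alt_walks E F l x y)"

lemma trace_le_card_closed_walks:
  assumes I: "finite I" and EF: "E \<subseteq> I \<times> I" "F \<subseteq> I \<times> I" and B: "B \<ge> 0"
    and P: "\<And>x y. x \<in> I \<Longrightarrow> y \<in> I \<Longrightarrow> 0 \<le> P x y \<and> P x y \<le> (if (x, y) \<in> E then B else 0)"
    and Q: "\<And>x y. x \<in> I \<Longrightarrow> y \<in> I \<Longrightarrow> 0 \<le> Q x y \<and> Q x y \<le> (if (x, y) \<in> F then B else 0)"
  shows "mat_trace I (mat_times I Q (alt_power I P Q l)) \<le> B ^ (2 * l + 2) * card (closed_walks E F l)"
proof -
  have finE: "finite E" "finite F" using EF I by (auto intro: finite_subset)
  have "mat_trace I (mat_times I Q (alt_power I P Q l)) = (\<Sum>(y, x)\<in>I \<times> I. Q y x * alt_power I P Q l x y)"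
    by (simp add: mat_trace_def mat_times_def sum.cartesian_product)
  also have "\<dots> \<le> (\<Sum>(y, x)\<in>I \<times> I. if (y, x) \<in> F then B * (B ^ (2 * l + 1) * card (alt_walks E F l x y)) else 0)"
  proof (rule sum_mono, clarify)
    fix y x assume xy: "y \<in> I" "x \<in> I"
    note b = alt_power_le_card[OF I EF B P Q xy(2,1), of l]
    have q: "0 \<le> Q y x \<and> Q y x \<le> (if (y, x) \<in> F then B else 0)" using Q xy by blast
    show "Q y x * alt_power I P Q l x y \<le> (if (y, x) \<in> F then B * (B ^ (2 * l + 1) * card (alt_walks E F l x y)) else 0)"
    proof (cases "(y, x) \<in> F")
      case True
      have "Q y x * alt_power I P Q l x y \<le> B * (B ^ (2 * l + 1) * card (alt_walks E F l x y))"
        using b q True B by (intro mult_mono) auto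
      then show ?thesis using True by simp
    next
      case False
      then have "Q y x = 0" using q by auto
      then show ?thesis using False by simp
    qed
  qed
  also have "\<dots> = (\<Sum>(y, x)\<in>F. B * (B ^ (2 * l + 1) * card (alt_walks E F l x y)))"
    using I EF by (intro sum.mono_neutral_cong_right) auto
  also have "\<dots> = B ^ (2 * l + 2) * (\<Sum>(y, x)\<in>F. card (alt_walks E F l x y))"
    by (simp add: sum_distrib_left case_prod_unfold mult_ac)
  also have "(\<Sum>(y, x)\<in>F. card (alt_walks E F l x y)) = card (closed_walks E F l)"
  proof -
    have "card (closed_walks E F l) = (\<Sum>s\<in>F. card (case s of (y, x) \<Rightarrow> alt_walks E F l x y))"
      unfolding closed_walks_def
    proof (rule card_UN_disjoint[OF finE(2)])
      show "\<forall>s\<in>F. finite (case s of (y, x) \<Rightarrow> alt_walks E F l x y)"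
        using finE by (auto intro!: finite_imageI finite_alt_walks)
      show "\<forall>s\<in>F. \<forall>t\<in>F. s \<noteq> t \<longrightarrow> (case s of (y, x) \<Rightarrow> alt_walks E F l x y) \<inter>
         (case t of (y, x) \<Rightarrow> alt_walks E F l x y) = {}"
      proof (intro ballI impI)
        fix s t assume "s \<in> F" "t \<in> F" "s \<noteq> t"
        obtain y1 x1 y2 x2 where [simp]: "s = (y1, x1)" "t = (y2, x2)" by (cases s, cases t)
        show "(case s of (y, x) \<Rightarrow> alt_walks E F l x y) \<inter> (case t of (y, x) \<Rightarrow> alt_walks E F l x y) = {}"
        proof (rule ccontr)
          assume "\<not> ?thesis"
          then obtain es where es: "es \<in> alt_walks E F l x1 y1" "es \<in> alt_walks E F l x2 y2" by auto
          have "x1 = x2" using alt_walks_props(3)[OF es(1)] alt_walks_props(3)[OF es(2)] by simp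
          moreover have "y1 = y2" using alt_walks_props(4)[OF es(1)] alt_walks_props(4)[OF es(2)] by simp
          ultimately show False using \<open>s \<noteq> t\<close> by simp
        qed
      qed
    qed
    also have "\<dots> = (\<Sum>(y, x)\<in>F. card (alt_walks E F l x y))" by (simp add: case_prod_unfold)
    finally show ?thesis by simp
  qed
  finally show ?thesis .
qed

section \<open>Marginals of random permutations and their truncation\<close>

definition marginal :: "('a \<Rightarrow> 'a) set \<Rightarrow> 'a \<Rightarrow> 'a \<Rightarrow> real" where
  "marginal F x y = card {f \<in> F. f x = y} / card F"

lemma marginal_nonneg: "marginal F x y \<ge> 0"
  by (simp add: marginal_def)

lemma marginal_pos_iff:
  assumes "finite F" "x \<in> I"
  shows "marginal F x y > 0 \<longleftrightarrow> (x, y) \<in> edges_of I F"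
proof -
  have "marginal F x y > 0 \<longleftrightarrow> {f \<in> F. f x = y} \<noteq> {}"
    using assms by (auto simp: marginal_def zero_less_divide_iff card_gt_0_iff)
  also have "\<dots> \<longleftrightarrow> (x, y) \<in> edges_of I F" using assms by (auto simp: edges_of_def)
  finally show ?thesis .
qed

lemma doubly_stochastic_marginal:
  assumes I: "finite I" and F: "finite F" "F \<noteq> {}" "F \<subseteq> {f. f permutes I}"
  shows "doubly_stochastic I (marginal F)"
  unfolding doubly_stochastic_def
proof (intro conjI ballI)
  have N: "card F > 0" using F by (simp add: card_gt_0_iff)
  fix x assume x: "x \<in> I"
  have im: "(\<lambda>f. f x) ` F \<subseteq> I" "(\<lambda>f. inv f x) ` F \<subseteq> I"
    using F(3) x permutes_in_image permutes_inv by fastforce+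
  have "(\<Sum>y\<in>I. card {f \<in> F. f x = y}) = card F"
    using sum.group[OF F(1) I im(1), of "\<lambda>_. 1::nat"] by simp
  then show "(\<Sum>y\<in>I. marginal F x y) = 1"
    using N by (simp add: marginal_def flip: sum_divide_distrib of_nat_sum)
  have eq: "{f \<in> F. f y = x} = {f \<in> F. inv f x = y}" for y
    using F by (auto simp: permutes_inverses)
  have "(\<Sum>y\<in>I. card {f \<in> F. inv f x = y}) = card F"
    using sum.group[OF F(1) I im(2), of "\<lambda>_. 1::nat"] by simp
  then show "(\<Sum>y\<in>I. marginal F y x) = 1"
    using N by (simp add: marginal_def eq flip: sum_divide_distrib of_nat_sum)
qed (simp add: marginal_nonneg)

text \<open>Gibbs' inequality against the product of the marginals.\<close>
lemma neg_entropy_marginal: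
  assumes I: "finite I" and F: "finite F" "F \<noteq> {}" "F \<subseteq> {f. f permutes I}"
  shows "neg_entropy I (marginal F) \<le> - ln (card F)"
proof -
  let ?N = "real (card F)" and ?p = "marginal F"
  have N: "?N > 0" using F by (simp add: card_gt_0_iff)
  \<comment> \<open>The product measure with these marginals. Its mass on all functions from
    \<open>I\<close> to \<open>I\<close> is 1, so that \<open>F\<close> receives at most 1.\<close>
  define q where "q f = (\<Prod>x\<in>I. ?p x (f x))" for f
  have q: "q f > 0" and lnq: "ln (q f) = (\<Sum>x\<in>I. ln (?p x (f x)))" if f: "f \<in> F" for f
  proof -
    have p: "?p x (f x) > 0" if "x \<in> I" for x
      using marginal_pos_iff[OF F(1) that] f that by (auto simp: edges_of_def)
    show "q f > 0" unfolding q_def by (intro prod_pos) (use p in auto)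
    have "?p x (f x) \<noteq> 0" if "x \<in> I" for x using p[OF that] by simp
    then show "ln (q f) = (\<Sum>x\<in>I. ln (?p x (f x)))" unfolding q_def using I by (subst ln_prod) auto
  qed
  \<comment> \<open>Permutations are the identity outside of \<open>I\<close>, while the product
    formula concerns extensional functions.\<close>
  have inj: "inj_on (\<lambda>f. restrict f I) F"
  proof (rule inj_onI)
    fix f g assume fg: "f \<in> F" "g \<in> F" "restrict f I = restrict g I"
    then have "f permutes I" "g permutes I" using F by auto
    then show "f = g" using fg(3) by (metis permutes_not_in restrict_apply' ext)
  qed
  have "(\<Sum>f\<in>F. q f) = (\<Sum>f\<in>(\<lambda>f. restrict f I) ` F. q f)"
    by (simp add: sum.reindex[OF inj] q_def)
  also have "\<dots> \<le> (\<Sum>f\<in>PiE I (\<lambda>_. I). q f)"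
    using I F by (intro sum_mono2) (auto simp: finite_PiE permutes_in_image q_def marginal_nonneg intro!: prod_nonneg)
  also have "\<dots> = (\<Prod>x\<in>I. \<Sum>y\<in>I. ?p x y)"
    unfolding q_def using I by (subst prod_sum_PiE) auto
  also have "\<dots> = 1" using doubly_stochastic_marginal[OF I F] by (simp add: doubly_stochastic_def)
  finally have sq: "(\<Sum>f\<in>F. q f) \<le> 1" .
  have "(\<Sum>f\<in>F. ln ?N + ln (q f)) \<le> (\<Sum>f\<in>F. ?N * q f - 1)"
  proof (rule sum_mono)
    fix f assume "f \<in> F"
    then have "q f > 0" by (rule q)
    then have "ln (?N * q f) = ln ?N + ln (q f)" "?N * q f > 0" using N by (simp_all add: ln_mult)
    then show "ln ?N + ln (q f) \<le> ?N * q f - 1" using ln_le_minus_one[of "?N * q f"] by simp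
  qed
  also have "\<dots> = ?N * (\<Sum>f\<in>F. q f) - ?N" by (simp add: sum_subtractf sum_distrib_left)
  also have "\<dots> \<le> 0" using sq N by simp
  finally have le: "?N * ln ?N + (\<Sum>f\<in>F. ln (q f)) \<le> 0" by (simp add: sum.distrib)
  have "(\<Sum>f\<in>F. ln (q f)) = (\<Sum>x\<in>I. \<Sum>f\<in>F. ln (?p x (f x)))"
    using lnq by (simp add: sum.swap[of _ I F])
  also have "\<dots> = (\<Sum>x\<in>I. \<Sum>y\<in>I. ?N * (?p x y * ln (?p x y)))"
  proof (rule sum.cong[OF refl])
    fix x assume x: "x \<in> I"
    have im: "(\<lambda>f. f x) ` F \<subseteq> I" using F(3) x permutes_in_image by fastforce
    have "(\<Sum>f\<in>F. ln (?p x (f x))) = (\<Sum>y\<in>I. \<Sum>f\<in>{f \<in> F. f x = y}. ln (?p x (f x)))"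
      using sum.group[OF F(1) I im, of "\<lambda>f. ln (?p x (f x))"] by simp
    also have "\<dots> = (\<Sum>y\<in>I. ?N * (?p x y * ln (?p x y)))"
      using N by (intro sum.cong refl) (simp add: marginal_def)
    finally show "(\<Sum>f\<in>F. ln (?p x (f x))) = (\<Sum>y\<in>I. ?N * (?p x y * ln (?p x y)))" .
  qed
  also have "\<dots> = ?N * neg_entropy I ?p" by (simp add: neg_entropy_def sum_distrib_left)
  finally have "?N * (ln ?N + neg_entropy I ?p) \<le> 0" using le by (simp add: algebra_simps)
  then show ?thesis using N by (simp add: mult_le_0_iff)
qed

definition truncate :: "real \<Rightarrow> ('a \<Rightarrow> 'a \<Rightarrow> real) \<Rightarrow> 'a \<Rightarrow> 'a \<Rightarrow> real" where
  "truncate B u x y = (if u x y \<le> B then u x y else 0)"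

text \<open>With n = \<open>card I\<close>, an entry u above exp b / n satisfies u ln (n u) \<ge> b
  u, and every entry satisfies u ln (n u) \<ge> - 1 / n. Summation bounds b times the lost mass by
  the entropy deficit plus n.\<close>

lemma truncate_loss:
  fixes k b :: real
  assumes I: "finite I" "I \<noteq> {}" and u: "doubly_stochastic I u"
    and ent: "neg_entropy I u \<le> k * card I - card I * ln (card I)"
  shows "b * mat_loss I (truncate (exp b / card I) u) u \<le> (k + 1) * card I"
proof -
  let ?m = "real (card I)"
  have m: "?m > 0" using I by (simp add: card_gt_0_iff)
  have "(\<Sum>x\<in>I. \<Sum>y\<in>I. b * (u x y - truncate (exp b / card I) u x y) - 1 / ?m) \<le>
      (\<Sum>x\<in>I. \<Sum>y\<in>I. u x y * ln (u x y) + u x y * ln ?m)"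
  proof (intro sum_mono)
    fix x y assume "x \<in> I" "y \<in> I"
    then have nn: "u x y \<ge> 0" using u by (simp add: doubly_stochastic_def)
    show "b * (u x y - truncate (exp b / card I) u x y) - 1 / ?m \<le> u x y * ln (u x y) + u x y * ln ?m"
    proof (cases "u x y = 0")
      case True
      then show ?thesis using m by (simp add: truncate_def)
    next
      case False
      then have pos: "u x y > 0" using nn by simp
      have eq: "u x y * ln (u x y) + u x y * ln ?m = u x y * ln (?m * u x y)"
        using pos m by (simp add: ln_mult algebra_simps)
      show ?thesis
      proof (cases "u x y \<le> exp b / ?m")
        case True
        have "ln (1 / (?m * u x y)) \<le> 1 / (?m * u x y) - 1" using pos m by (intro ln_le_minus_one) auto
        then have "- ln (?m * u x y) \<le> 1 / (?m * u x y)" using pos m by (simp add: ln_div)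
        then have "u x y * (- ln (?m * u x y)) \<le> u x y * (1 / (?m * u x y))" using pos by (intro mult_left_mono) auto
        also have "\<dots> = 1 / ?m" using pos by simp
        finally show ?thesis using True eq by (simp add: truncate_def)
      next
        case False
        then have "exp b \<le> ?m * u x y" using m by (simp add: field_simps)
        then have "b \<le> ln (?m * u x y)" using pos m by (metis exp_gt_zero ln_exp ln_le_cancel_iff mult_pos_pos)
        then have "u x y * b \<le> u x y * ln (?m * u x y)" using pos by (intro mult_left_mono) auto
        then show ?thesis using False eq m
          by (simp add: truncate_def mult.commute) (metis add_increasing2 divide_nonneg_nonneg le_add_same_cancel1 of_nat_0_le_iff zero_le_one diff_le_eq)
      qed
    qed
  qed
  also have "\<dots> = neg_entropy I u + (\<Sum>x\<in>I. \<Sum>y\<in>I. u x y) * ln ?m"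
    by (simp add: neg_entropy_def sum.distrib sum_distrib_right)
  also have "(\<Sum>x\<in>I. \<Sum>y\<in>I. u x y) = ?m" using u by (simp add: doubly_stochastic_def)
  also have "(\<Sum>x\<in>I. \<Sum>y\<in>I. b * (u x y - truncate (exp b / card I) u x y) - 1 / ?m) =
     b * mat_loss I (truncate (exp b / card I) u) u - ?m"
  proof -
    have "(\<Sum>x\<in>I. \<Sum>y\<in>I. 1 / ?m) = ?m" using m by simp
    then show ?thesis by (simp only: mat_loss_def sum_distrib_left sum_subtractf[of _ "\<lambda>_. 1 / ?m"]
        sum_subtractf[of _ "\<lambda>_. sum (\<lambda>_. 1 / ?m) I"])
  qed
  finally show ?thesis using ent by (simp add: algebra_simps)
qed

lemma mat_le_truncate: "doubly_stochastic I u \<Longrightarrow> mat_le I (truncate B u) u"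
  by (auto simp: mat_le_def truncate_def doubly_stochastic_def)

lemma fact_ge_exp: "fact m \<ge> real m ^ m * exp (- real m)"
proof -
  have "real m ^ m /\<^sub>R fact m \<le> (\<Sum>n. real m ^ n /\<^sub>R fact n)"
    using summable_exp_generic[of "real m"]
    by (intro order_trans[OF _ sum_le_suminf[of _ "{m}"]]) (auto intro!: divide_nonneg_nonneg)
  then have "real m ^ m / fact m \<le> exp m" by (simp add: exp_def divide_inverse mult.commute)
  then show ?thesis by (simp add: exp_minus field_simps)
qed

text \<open>Rigidity is used with a = 1 / m: as there are at most m^2 edges, passing to the
  subfamily costs at most a factor exp (- m). Another exp (- m) comes from m! \<ge> (m / e)^m; hence
  q + 2.\<close>

lemma rigid_permutations:
  fixes q :: real and m :: nat
  assumes F: "F \<subseteq> {f. f permutes {..<m}}" "card F \<ge> fact m * exp (- q * m)" and m: "m > 0"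
  obtains G where "G \<subseteq> F" "G \<noteq> {}" "finite G"
    "neg_entropy {..<m} (marginal G) \<le> (q + 2) * m - m * ln m"
    "card (edges_of {..<m} G) \<le> m^2"
    "\<And>H. H \<subseteq> G \<Longrightarrow> H \<noteq> {} \<Longrightarrow>
       real (card (edges_of {..<m} G)) - card (edges_of {..<m} H) \<le> m * ln (card G / card H)"
proof -
  have finF: "finite F" using F(1) finite_permutations[of "{..<m}"] finite_subset by blast
  have "0 < fact m * exp (- q * m)" by simp
  then have "0 < real (card F)" using F(2) by (rule less_le_trans)
  then have F0: "F \<noteq> {}" by auto
  have m0: "real m > 0" using m by simp
  obtain G where G: "G \<subseteq> F" "G \<noteq> {}"
    "real (card F) * exp (- (1 / m) * card (edges_of {..<m} F)) \<le> card G"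
    "\<And>H. H \<subseteq> G \<Longrightarrow> H \<noteq> {} \<Longrightarrow>
       1 / m * (real (card (edges_of {..<m} G)) - card (edges_of {..<m} H)) \<le> ln (card G / card H)"
    using exists_rigid_subfamily[OF finF F0, of "1 / m" "{..<m}"] by auto
  have small: "card (edges_of {..<m} H) \<le> m^2" if "H \<subseteq> F" for H
  proof -
    have "edges_of {..<m} H \<subseteq> {..<m} \<times> {..<m}"
      using that F(1) by (auto simp: edges_of_def dest!: subsetD dest: permutes_nat_less permutes_in_image[THEN iffD2, of _ "{..<m}", simplified])
    then have "card (edges_of {..<m} H) \<le> card ({..<m} \<times> {..<m})" by (intro card_mono) auto
    then show ?thesis by (simp add: power2_eq_square)
  qed
  have finG: "finite G" using G(1) finF finite_subset by blast
  have GP: "G \<subseteq> {f. f permutes {..<m}}" using G(1) F(1) by blast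
  show ?thesis
  proof (rule that)
    have "real (card (edges_of {..<m} F)) \<le> real m * real m"
      using small[of F] by (metis of_nat_le_iff of_nat_mult order_refl power2_eq_square)
    then have "1 / m * card (edges_of {..<m} F) \<le> m" using m0 by (simp add: field_simps)
    then have "exp (- real m) \<le> exp (- (1 / m) * card (edges_of {..<m} F))" by simp
    moreover have "real m ^ m * exp (- real m) * exp (- q * m) \<le> card F"
      by (rule order_trans[OF mult_right_mono[OF fact_ge_exp] F(2)]) simp
    ultimately have "real m ^ m * exp (- real m) * exp (- q * m) * exp (- real m)
        \<le> card F * exp (- (1 / m) * card (edges_of {..<m} F))"
      by (intro mult_mono) auto
    then have "real m ^ m * exp (- real m) * exp (- q * m) * exp (- real m) \<le> card G" using G(3) by linarith
    moreover have "real m ^ m = exp (m * ln m)" using m0 by (simp add: exp_of_nat_mult)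
    ultimately have "exp (m * ln m - (q + 2) * m) \<le> card G"
      by (simp add: algebra_simps flip: exp_add)
    then have "m * ln m - (q + 2) * m \<le> ln (card G)" 
      by (metis exp_gt_zero exp_le_cancel_iff exp_ln less_le_trans)
    moreover have "neg_entropy {..<m} (marginal G) \<le> - ln (card G)"
      by (rule neg_entropy_marginal) (use finG G GP in auto)
    ultimately show "neg_entropy {..<m} (marginal G) \<le> (q + 2) * m - m * ln m" by linarith
    fix H assume "H \<subseteq> G" "H \<noteq> {}"
    from G(4)[OF this] show "real (card (edges_of {..<m} G)) - card (edges_of {..<m} H) \<le> m * ln (card G / card H)"
      using m0 by (simp add: field_simps)
  qed (use G finG small in auto)
qed

text \<open>The final contradiction of \<open>exists_short_cycle\<close>, and the origin of 3 J +
  10. With q + 3 \<le> 2^J and L \<le> 2^(J+1), the exponent 2 L 2^(J+6) (q + 3) is at most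
  2^(3J+8), a quarter of ln m. The remaining factors are polynomial in ln m.\<close>

lemma closing_numerics:
  fixes m J L :: nat and q :: real
  assumes q: "q \<ge> 0" "q + 2 \<le> J / 2 ^ 15" and m: "ln m \<ge> 2 ^ (3 * J + 10)" and L: "L \<le> 2 ^ (J + 1)"
  shows "64 * real L ^ 2 * ln m * exp (2 ^ (J + 6) * (q + 3)) ^ (2 * L) < m"
proof -
  define t where "t = ln (real m)"
  have t: "t \<ge> 2 ^ (3 * J + 10)" using m by (simp add: t_def)
  have "(1024::real) = 1 * 2 ^ 10" by simp
  also have "\<dots> \<le> 2 ^ (3 * J) * 2 ^ 10" by (intro mult_right_mono) auto
  also have "\<dots> \<le> t" using t by (simp add: power_add)
  finally have t0: "t \<ge> 1024" .
  then have m0: "real m > 0" unfolding t_def by (cases "m = 0") auto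
  have mt: "real m = exp t" using m0 by (simp add: t_def)
  have "J < 2 ^ J" by (rule less_exp)
  then have "real J + 1 \<le> 2 ^ J" by (metis Suc_leI of_nat_Suc of_nat_le_iff of_nat_numeral of_nat_power add.commute)
  moreover have "J / 2 ^ 15 \<le> real J" by (simp add: divide_le_eq)
  ultimately have q3: "q + 3 \<le> 2 ^ J" using q by linarith
  have L': "real L \<le> 2 ^ (J + 1)" using L by (metis of_nat_le_iff of_nat_numeral of_nat_power)
  have "exp (2 ^ (J + 6) * (q + 3)) ^ (2 * L) = exp (2 * L * (2 ^ (J + 6) * (q + 3)))"
    by (simp flip: exp_of_nat_mult)
  also have "\<dots> \<le> exp (t / 4)"
  proof -
    have "2 * L * (2 ^ (J + 6) * (q + 3)) \<le> 2 * 2 ^ (J + 1) * (2 ^ (J + 6) * 2 ^ J)"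
      using L' q3 q by (intro mult_mono) auto
    also have "\<dots> = (2::real) ^ (J + J + J + 8)" by (simp only: power_add) simp
    also have "J + J + J + 8 = 3 * J + 8" by simp
    also have "(2::real) ^ (3 * J + 8) = 2 ^ (3 * J + 10) / 4" by (simp add: power_add)
    finally show ?thesis using t by simp
  qed
  finally have e: "exp (2 ^ (J + 6) * (q + 3)) ^ (2 * L) \<le> exp (t / 4)" .
  have "64 * real L ^ 2 \<le> 64 * (2 ^ (J + 1)) ^ 2" using L' by (intro mult_left_mono power_mono) auto
  also have "\<dots> = 2 ^ (2 * J + 8)" by (simp add: power_add power_mult_distrib flip: power_mult)
  also have "\<dots> \<le> (2::real) ^ (3 * J + 10)" by (intro power_increasing) auto
  finally have L2: "64 * real L ^ 2 \<le> t" using t by simp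
  have "64 * real L ^ 2 * ln m * exp (2 ^ (J + 6) * (q + 3)) ^ (2 * L) \<le> t * t * exp (t / 4)"
    using L2 e t0 by (intro mult_mono) (auto simp: t_def)
  also have "\<dots> < exp (3 * t / 4) * exp (t / 4)"
  proof (rule mult_strict_right_mono)
    have "t * t * 64 < t * t * t" using t0 by (intro mult_strict_left_mono) auto
    then have "t * t < (t / 4) ^ 3" by (simp add: power3_eq_cube)
    also have "\<dots> \<le> (1 + t / 4) ^ 3" using t0 by (intro power_mono) auto
    also have "\<dots> \<le> exp (t / 4) ^ 3" using t0 by (intro power_mono exp_ge_add_one_self) auto
    also have "\<dots> = exp (3 * t / 4)" by (simp flip: exp_of_nat_mult)
    finally show "t * t < exp (3 * t / 4)" .
  qed auto
  also have "\<dots> = m" by (simp add: mt flip: exp_add)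
  finally show ?thesis .
qed

text \<open>The bound of Raz and Spieker for the Hamiltonian cycle problem on pairs of perfect matchings.\<close>
lemma exists_short_cycle:
  fixes m J :: nat and q :: real
  assumes q: "q \<ge> 0" "q + 2 \<le> J / 2 ^ 15" and m: "ln m \<ge> 2 ^ (3 * J + 10)"
    and F: "F \<subseteq> {f. f permutes {..<m}}" "card F \<ge> fact m * exp (- q * m)"
    and G: "G \<subseteq> {f. f permutes {..<m}}" "card G \<ge> fact m * exp (- q * m)"
  obtains f g x l where "f \<in> F" "g \<in> G" "x < m" "0 < l" "l < m" "((g \<circ> f) ^^ l) x = x"
proof -
  let ?I = "{..<m}"
  have "(2::real) ^ (3 * J + 10) > 0" by simp
  then have "ln (real m) > 0" using m by linarith
  then have m2: "m \<ge> 2" by (cases "m = 0 \<or> m = 1") auto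
  then have m0: "real m > 0" "m > 0" by auto
  have J: "J > 0" using q by (cases "J = 0") auto
  have I: "finite ?I" "?I \<noteq> {}" using m0 by auto
  obtain A where A: "A \<subseteq> F" "A \<noteq> {}" "finite A"
    "neg_entropy ?I (marginal A) \<le> (q + 2) * m - m * ln m"
    "card (edges_of ?I A) \<le> m^2"
    "\<And>H. H \<subseteq> A \<Longrightarrow> H \<noteq> {} \<Longrightarrow>
       real (card (edges_of ?I A)) - card (edges_of ?I H) \<le> m * ln (card A / card H)"
    using rigid_permutations[OF F m0(2)] by metis
  obtain B where B: "B \<subseteq> G" "B \<noteq> {}" "finite B"
    "neg_entropy ?I (marginal B) \<le> (q + 2) * m - m * ln m"
    "card (edges_of ?I B) \<le> m^2"
    "\<And>H. H \<subseteq> B \<Longrightarrow> H \<noteq> {} \<Longrightarrow>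
       real (card (edges_of ?I B)) - card (edges_of ?I H) \<le> m * ln (card B / card H)"
    using rigid_permutations[OF G m0(2)] by metis
  define P where "P = marginal A"
  define Q where "Q = marginal B"
  have P: "doubly_stochastic ?I P" unfolding P_def using A F by (intro doubly_stochastic_marginal) auto
  have Q: "doubly_stochastic ?I Q" unfolding Q_def using B G by (intro doubly_stochastic_marginal) auto
  \<comment> \<open>Chosen so that truncation at exp b / m loses at most m / 2^(J+6), the loss that
    \<open>exists_heavy_closed_walks\<close> tolerates.\<close>
  define b where "b = 2 ^ (J + 6) * (q + 3)"
  have b: "b > 0" using q by (simp add: b_def)
  define M where "M = exp b / m"
  have M: "M > 0" using m0 by (simp add: M_def)
  have loss: "mat_loss ?I (truncate M u) u \<le> card ?I / 2 ^ (J + 6)"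
    if u: "doubly_stochastic ?I u" "neg_entropy ?I u \<le> (q + 2) * m - m * ln m" for u
  proof -
    have "b * mat_loss ?I (truncate (exp b / card ?I) u) u \<le> (q + 2 + 1) * card ?I"
      using u by (intro truncate_loss[OF I]) auto
    then have "mat_loss ?I (truncate M u) u \<le> (q + 3) * m / b" using b by (simp add: M_def field_simps)
    also have "\<dots> = card ?I / 2 ^ (J + 6)" using q mult_divide_mult_cancel_left[of "q + 3" "real m" "2 ^ (J + 6)"]
      by (simp add: b_def mult.commute)
    finally show ?thesis .
  qed
  have ent: "neg_entropy ?I P \<le> J / 2 ^ 15 * card ?I - card ?I * ln (card ?I)"
    using A(4) mult_right_mono[OF q(2), of "real m"] by (simp add: P_def)
  obtain l where l: "l < 2 ^ (J + 1)"
    "mat_trace ?I (mat_times ?I (truncate M Q) (alt_power ?I (truncate M P) (truncate M Q) l)) \<ge> 1 / 8"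
    using exists_heavy_closed_walks[OF I J mat_le_truncate[OF P] P loss[OF P]
        mat_le_truncate[OF Q] Q loss[OF Q] ent] A(4) B(4) by (metis P_def Q_def)
  define L where "L = Suc l"
  have L: "L \<le> 2 ^ (J + 1)" using l by (simp add: L_def)
  let ?E = "edges_of ?I A" and ?F = "edges_of ?I B"
  have sub: "edges_of ?I H \<subseteq> ?I \<times> ?I" if "H \<subseteq> {f. f permutes ?I}" for H
    using that permutes_in_image by (fastforce simp: edges_of_def)
  have E: "?E \<subseteq> ?I \<times> ?I" using A F by (intro sub) auto
  have F': "?F \<subseteq> ?I \<times> ?I" using B G by (intro sub) auto
  have finEF: "finite ?E" "finite ?F" using E F' finite_subset by blast+
  have tr: "0 \<le> truncate M (marginal H) x y \<and> truncate M (marginal H) x y \<le> (if (x, y) \<in> edges_of ?I H then M else 0)"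
    if "finite H" "x \<in> ?I" for H x y
  proof (cases "(x, y) \<in> edges_of ?I H")
    case False
    then have "marginal H x y = 0"
      using marginal_pos_iff[OF that] marginal_nonneg[of H x y] by (metis less_eq_real_def)
    then show ?thesis using False by (simp add: truncate_def)
  qed (use marginal_nonneg[of H x y] M in \<open>auto simp: truncate_def\<close>)
  have "1 / 8 \<le> M ^ (2 * l + 2) * card (closed_walks ?E ?F l)"
    using l(2) trace_le_card_closed_walks[OF I(1) E F', of M "truncate M P" "truncate M Q" l]
      tr A(3) B(3) M unfolding P_def Q_def by fastforce
  also have "M ^ (2 * l + 2) = exp b ^ (2 * L) / real m ^ (2 * L)"
    by (simp add: M_def L_def power_divide)
  \<comment> \<open>Relative to m^(2L), the closed walks amount to at least 1 / (8 exp b ^ (2L)),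
    but the rare lists only to O(L^2 ln m / m).\<close>
  finally have many: "real m ^ (2 * L) \<le> 8 * exp b ^ (2 * L) * card (closed_walks ?E ?F l)"
    using m0 by (simp add: field_simps)
  \<comment> \<open>A list that is not bad occurs jointly in some member of the family; the
    threshold is that of \<open>few_rare_lists\<close>.\<close>
  define bad where "bad A es \<longleftrightarrow> card (extending A es) < card A / real m ^ (3 * L)" for A :: "(nat \<Rightarrow> nat) set" and es
  define BA where "BA = {es. length es = L \<and> set es \<subseteq> ?E \<and> bad A es}"
  define BB where "BB = {es. length es = L \<and> set es \<subseteq> ?F \<and> bad B es}"
  have BA: "real (card BA) * m \<le> 4 * L^2 * ln m * real m ^ (2 * L)"
    using few_rare_lists[OF A(3,2) I(1) m2 A(5,6) order_refl, of L] unfolding BA_def bad_def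
    by (simp add: power2_eq_square mult_ac)
  have BB: "real (card BB) * m \<le> 4 * L^2 * ln m * real m ^ (2 * L)"
    using few_rare_lists[OF B(3,2) I(1) m2 B(5,6) order_refl, of L] unfolding BB_def bad_def
    by (simp add: power2_eq_square mult_ac)
  have finB: "finite BA" "finite BB"
    using finite_lists_length_eq[OF finEF(1), of L] finite_lists_length_eq[OF finEF(2), of L]
    unfolding BA_def BB_def by (auto intro: rev_finite_subset)
  have "\<exists>es\<in>closed_walks ?E ?F l. \<not> bad A es \<and> \<not> bad B (links es)"
  proof (rule ccontr)
    assume neg: "\<not> ?thesis"
    have "closed_walks ?E ?F l \<subseteq> BA \<union> links -` BB"
    proof
      fix es assume es: "es \<in> closed_walks ?E ?F l"
      then obtain x y where w: "(y, x) \<in> ?F" "es \<in> alt_walks ?E ?F l x y" by (auto simp: closed_walks_def)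
      have "length es = L" "set es \<subseteq> ?E"
        using alt_walks_props(1)[OF w(2)] alt_walks_props(2)[OF w(2)] by (simp_all only: L_def)
      moreover have "length (links es) = length es" by (simp add: links_def)
      moreover have "set (links es) \<subseteq> ?F" by (rule set_links_alt_walks[OF w(2,1)])
      moreover have "bad A es \<or> bad B (links es)" using neg es by blast
      ultimately show "es \<in> BA \<union> links -` BB" unfolding BA_def BB_def by auto
    qed
    moreover have "finite (links -` BB)" using finB inj_links by (intro finite_vimageI)
    ultimately have "card (closed_walks ?E ?F l) \<le> card BA + card (links -` BB)"
      using finB by (meson card_Un_le card_mono finite_UnI le_trans)
    moreover have "card (links -` BB) \<le> card BB"
      using card_vimage_inj_on_le[OF inj_links[THEN inj_on_subset, OF subset_UNIV] finB(2), of UNIV] by simp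
    ultimately have "real (card (closed_walks ?E ?F l)) * m \<le> (real (card BA) + real (card BB)) * m"
      by (intro mult_right_mono) auto
    also have "\<dots> \<le> 8 * L^2 * ln m * real m ^ (2 * L)" using BA BB by (simp add: distrib_right)
    finally have c: "real (card (closed_walks ?E ?F l)) * m \<le> 8 * L^2 * ln m * real m ^ (2 * L)" .
    have "real m ^ (2 * L) * m \<le> 8 * exp b ^ (2 * L) * card (closed_walks ?E ?F l) * m"
      using many by (intro mult_right_mono) auto
    also have "\<dots> = 8 * exp b ^ (2 * L) * (card (closed_walks ?E ?F l) * m)" by simp
    also have "\<dots> \<le> 8 * exp b ^ (2 * L) * (8 * L^2 * ln m * real m ^ (2 * L))"
      using c by (intro mult_left_mono) auto
    finally have "real m ^ (2 * L) * m \<le> real m ^ (2 * L) * (64 * L^2 * ln m * exp b ^ (2 * L))"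
      by (simp add: mult_ac)
    then have "m \<le> 64 * L^2 * ln m * exp b ^ (2 * L)" using m0 by simp
    then show False using closing_numerics[OF q m L] by (simp add: b_def)
  qed
  then obtain es x y where es: "(y, x) \<in> ?F" "es \<in> alt_walks ?E ?F l x y" "\<not> bad A es" "\<not> bad B (links es)"
    by (auto simp: closed_walks_def)
  have ne: "extending H es' \<noteq> {}" if "\<not> bad H es'" "finite H" "H \<noteq> {}" for H es'
  proof
    assume "extending H es' = {}"
    moreover have "card H > 0" using that by (simp add: card_gt_0_iff)
    ultimately show False using that m0 by (simp add: bad_def)
  qed
  obtain f where f: "f \<in> A" "\<forall>(a, c)\<in>set es. f a = c"
    using ne[OF es(3) A(3,2)] by (auto simp: extending_def)
  obtain g where g: "g \<in> B" "\<forall>(a, c)\<in>set (links es). g a = c"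
    using ne[OF es(4) B(3,2)] by (auto simp: extending_def)
  have "rotate1 (map fst es) = tl (map fst es) @ [x]"
    using alt_walks_props(1,3)[OF es(2)] by (cases es) auto
  then have "((g \<circ> f) ^^ Suc l) x = x"
    using g(2) by (intro alt_walks_iterate[OF es(2) f(2)]) (simp add: links_def)
  moreover have "x < m" using es(1) F' by auto
  moreover have "Suc l < m"
  proof -
    have "2 ^ (J + 1) \<le> (2::real) ^ (3 * J + 10)" by (intro power_increasing) auto
    also have "\<dots> \<le> ln m" by (rule m)
    also have "\<dots> < m" using ln_less_self m0 by auto
    finally have "2 ^ (J + 1) < m" by (metis of_nat_less_iff of_nat_numeral of_nat_power)
    then show ?thesis using l by linarith
  qed
  moreover have "f \<in> F" "g \<in> G" using f(1) g(1) A(1) B(1) by blast+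
  ultimately show ?thesis using that[of f g x "Suc l"] by blast
qed

section \<open>Monomials of tropical circuits\<close>

text \<open>Monomials as exponent vectors. Multiplicities are kept, since an addition gate may add a
  variable to itself.\<close>

inductive produces :: "('n, 'x) circuit \<Rightarrow> 'n \<Rightarrow> ('x \<Rightarrow> nat) \<Rightarrow> bool" for C where
  "gate C n = Var x \<Longrightarrow> produces C n (\<lambda>y. of_bool (y = x))"
| "gate C n = Zero \<Longrightarrow> produces C n (\<lambda>y. 0)"
| "gate C n = Plus l r \<Longrightarrow> produces C l a \<Longrightarrow> produces C r b \<Longrightarrow> produces C n (\<lambda>y. a y + b y)"
| "gate C n = Maximum l r \<Longrightarrow> produces C l a \<Longrightarrow> produces C n a"
| "gate C n = Maximum l r \<Longrightarrow> produces C r b \<Longrightarrow> produces C n b"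

lemma produces_support:
  assumes "tropical_circuit X C" "produces C n b" "n \<in> nodes C" "b x \<noteq> 0"
  shows "x \<in> X"
  using assms(2,3,4)
proof (induction rule: produces.induct)
  case (1 n x)
  then show ?case using assms(1) by (fastforce simp: tropical_circuit_def split: if_splits)
next
  case (3 n l r a b)
  then have "l \<in> nodes C" "r \<in> nodes C" using assms(1) by (fastforce simp: tropical_circuit_def)+
  then show ?case using 3 by auto
next
  case (4 n l r a)
  then have "l \<in> nodes C" using assms(1) by (fastforce simp: tropical_circuit_def)
  then show ?case using 4 by auto
next
  case (5 n l r b)
  then have "r \<in> nodes C" using assms(1) by (fastforce simp: tropical_circuit_def)
  then show ?case using 5 by auto
qed auto

definition linear_form :: "'x set \<Rightarrow> ('x \<Rightarrow> nat) \<Rightarrow> ('x \<Rightarrow> real) \<Rightarrow> real" where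
  "linear_form X b \<nu> = (\<Sum>x\<in>X. real (b x) * \<nu> x)"

lemma linear_form_add: "linear_form X (\<lambda>y. a y + b y) \<nu> = linear_form X a \<nu> + linear_form X b \<nu>"
  by (simp add: linear_form_def distrib_right sum.distrib)

lemma linear_form_indicator:
  assumes "finite X" "S \<subseteq> X"
  shows "linear_form X (\<lambda>x. of_bool (x \<in> S)) \<nu> = (\<Sum>x\<in>S. \<nu> x)"
  unfolding linear_form_def using assms by (intro sum.mono_neutral_cong_right) auto

lemma has_value_is_max:
  assumes C: "tropical_circuit X C" and X: "finite X"
    and v: "has_value C \<nu> n a" and n: "n \<in> nodes C"
  shows "(\<forall>b. produces C n b \<longrightarrow> linear_form X b \<nu> \<le> a) \<and> (\<exists>b. produces C n b \<and> linear_form X b \<nu> = a)"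
  using v n
proof (induction rule: has_value.induct)
  case (1 n x)
  then have "x \<in> X" using C by (fastforce simp: tropical_circuit_def)
  then have lf: "linear_form X (\<lambda>y. of_bool (y = x)) \<nu> = \<nu> x"
    using linear_form_indicator[OF X, of "{x}" \<nu>] by simp
  have eq: "b = (\<lambda>y. of_bool (y = x))" if "produces C n b" for b
    using that
  proof cases
    case (1 x')
    then have "x' = x" using \<open>gate C n = Var x\<close> by simp
    then show ?thesis using 1 by simp
  qed (use \<open>gate C n = Var x\<close> in simp_all)
  show ?case
  proof (intro conjI allI impI)
    fix b assume "produces C n b"
    then show "linear_form X b \<nu> \<le> \<nu> x" using eq[of b] lf by simp
  next
    show "\<exists>b. produces C n b \<and> linear_form X b \<nu> = \<nu> x"
      using produces.intros(1)[OF 1(1)] lf by (intro exI[of _ "(\<lambda>y. of_bool (y = x))"] conjI)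
  qed
next
  case (2 n)
  have eq: "b = (\<lambda>y. 0)" if "produces C n b" for b
    using that by cases (use \<open>gate C n = Zero\<close> in simp_all)
  have lf: "linear_form X (\<lambda>y. 0) \<nu> = 0" by (simp add: linear_form_def)
  show ?case
  proof (intro conjI allI impI)
    fix b assume "produces C n b"
    then show "linear_form X b \<nu> \<le> 0" using eq[of b] lf by simp
  next
    show "\<exists>b. produces C n b \<and> linear_form X b \<nu> = 0"
      using produces.intros(2)[OF 2(1)] lf by (intro exI[of _ "(\<lambda>y. 0)"] conjI)
  qed
next
  case (3 n l r a a')
  then have nodes: "l \<in> nodes C" "r \<in> nodes C" using C by (fastforce simp: tropical_circuit_def)+
  have IH: "linear_form X b \<nu> \<le> a" if "produces C l b" for b using 3(4)[OF nodes(1)] that by blast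
  have IH': "linear_form X b \<nu> \<le> a'" if "produces C r b" for b using 3(5)[OF nodes(2)] that by blast
  obtain b where b: "produces C l b" "linear_form X b \<nu> = a" using 3(4)[OF nodes(1)] by blast
  obtain b' where b': "produces C r b'" "linear_form X b' \<nu> = a'" using 3(5)[OF nodes(2)] by blast
  have "produces C n (\<lambda>y. b y + b' y)" "linear_form X (\<lambda>y. b y + b' y) \<nu> = a + a'"
    using produces.intros(3)[OF 3(1) b(1) b'(1)] b(2) b'(2) by (simp_all add: linear_form_add)
  moreover have "linear_form X c \<nu> \<le> a + a'" if "produces C n c" for c
    using that
  proof cases
    case (3 l' r' c c')
    then have "l' = l" "r' = r" using \<open>gate C n = Plus l r\<close> by simp_all
    then show ?thesis using 3 IH[of c] IH'[of c'] by (simp add: linear_form_add)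
  qed (use \<open>gate C n = Plus l r\<close> in simp_all)
  ultimately show ?case by blast
next
  case (4 n l r a a')
  then have nodes: "l \<in> nodes C" "r \<in> nodes C" using C by (fastforce simp: tropical_circuit_def)+
  have IH: "linear_form X b \<nu> \<le> a" if "produces C l b" for b using 4(4)[OF nodes(1)] that by blast
  have IH': "linear_form X b \<nu> \<le> a'" if "produces C r b" for b using 4(5)[OF nodes(2)] that by blast
  obtain b where b: "produces C l b" "linear_form X b \<nu> = a" using 4(4)[OF nodes(1)] by blast
  obtain b' where b': "produces C r b'" "linear_form X b' \<nu> = a'" using 4(5)[OF nodes(2)] by blast
  have "\<exists>c. produces C n c \<and> linear_form X c \<nu> = max a a'"
  proof (cases "a \<le> a'")
    case True
    then show ?thesis using produces.intros(5)[OF 4(1) b'(1)] b'(2) by (intro exI[of _ b']) simp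
  next
    case False
    then show ?thesis using produces.intros(4)[OF 4(1) b(1)] b(2) by (intro exI[of _ b]) simp
  qed
  moreover have "linear_form X c \<nu> \<le> max a a'" if "produces C n c" for c
    using that
  proof cases
    case (4 l' r')
    then have "l' = l" using \<open>gate C n = Maximum l r\<close> by simp
    then show ?thesis using 4 IH[of c] by simp
  next
    case (5 l' r')
    then have "r' = r" using \<open>gate C n = Maximum l r\<close> by simp
    then show ?thesis using 5 IH'[of c] by simp
  qed (use \<open>gate C n = Maximum l r\<close> in simp_all)
  ultimately show ?case by blast
qed

text \<open>A produced monomial lies in the Newton polytope, whose only lattice points are its vertices.\<close>
lemma produces_out_node:
  fixes \<A> :: "'x set set"
  assumes C: "tropical_circuit X C" and X: "finite X"
    and A: "\<A> \<noteq> {}" "\<And>S. S \<in> \<A> \<Longrightarrow> S \<subseteq> X" "\<And>S. S \<in> \<A> \<Longrightarrow> card S = d"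
    and calc: "calculates C (\<lambda>\<nu>. Max ((\<lambda>S. \<Sum>x\<in>S. \<nu> x) ` \<A>))"
  shows "produces C (out_node C) b \<longleftrightarrow> (\<exists>S\<in>\<A>. b = (\<lambda>x. of_bool (x \<in> S)))"
proof -
  let ?o = "out_node C"
  have o: "?o \<in> nodes C" using C by (simp add: tropical_circuit_def)
  have finA: "finite \<A>" using A(2) X by (intro finite_subset[of \<A> "Pow X"]) auto
  have finS: "finite S" if "S \<in> \<A>" for S using A(2)[OF that] X finite_subset by blast
  have val: "has_value C \<nu> ?o (Max ((\<lambda>S. \<Sum>x\<in>S. \<nu> x) ` \<A>))" for \<nu>
    using calc by (simp add: calculates_def)
  have le: "\<exists>S\<in>\<A>. linear_form X b \<nu> \<le> (\<Sum>x\<in>S. \<nu> x)" if "produces C ?o b" for b \<nu>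
  proof -
    have "Max ((\<lambda>S. \<Sum>x\<in>S. \<nu> x) ` \<A>) \<in> (\<lambda>S. \<Sum>x\<in>S. \<nu> x) ` \<A>" using finA A(1) by (intro Max_in) auto
    then obtain S where S: "Max ((\<lambda>S. \<Sum>x\<in>S. \<nu> x) ` \<A>) = (\<Sum>x\<in>S. \<nu> x)" "S \<in> \<A>" by (rule imageE)
    have "linear_form X b \<nu> \<le> Max ((\<lambda>S. \<Sum>x\<in>S. \<nu> x) ` \<A>)"
      using has_value_is_max[OF C X val o, of \<nu>] that by blast
    then show ?thesis unfolding S(1) using S(2) by (rule bexI)
  qed
  have ge: "\<exists>b. produces C ?o b \<and> (\<Sum>x\<in>S. \<nu> x) \<le> linear_form X b \<nu>" if "S \<in> \<A>" for S \<nu>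
  proof -
    have "(\<Sum>x\<in>S. \<nu> x) \<le> Max ((\<lambda>S. \<Sum>x\<in>S. \<nu> x) ` \<A>)" using finA that by (intro Max_ge) auto
    moreover obtain b where "produces C ?o b" "linear_form X b \<nu> = Max ((\<lambda>S. \<Sum>x\<in>S. \<nu> x) ` \<A>)"
      using has_value_is_max[OF C X val o] by blast
    ultimately show ?thesis by metis
  qed
  have main: "\<exists>S\<in>\<A>. b = (\<lambda>x. of_bool (x \<in> S))" if b: "produces C ?o b" for b
  proof -
    have supp: "b x = 0" if "x \<notin> X" for x using produces_support[OF C b o] that by blast
    \<comment> \<open>The valuations constantly 1 and constantly -1 bound the degree from above and
      from below.\<close>
    have "linear_form X b (\<lambda>_. 1) \<le> d" "linear_form X b (\<lambda>_. -1) \<le> - real d"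
      using le[OF b, of "\<lambda>_. 1"] le[OF b, of "\<lambda>_. -1"] A(3) by (auto simp: sum_negf)
    then have total: "(\<Sum>x\<in>X. real (b x)) = d" by (simp add: linear_form_def sum_negf)
    have le1: "b x \<le> 1" for x
    proof (cases "x \<in> X")
      case True
      \<comment> \<open>Weight on a single variable bounds its exponent by 1, because the members of
        \<open>\<A>\<close> are sets.\<close>
      obtain S where "S \<in> \<A>" "linear_form X b (\<lambda>y. of_bool (y = x)) \<le> (\<Sum>y\<in>S. of_bool (y = x))"
        using le[OF b] by blast
      moreover have "linear_form X b (\<lambda>y. of_bool (y = x)) = b x"
        using True X by (simp add: linear_form_def if_distrib cong: if_cong)
      moreover have "(\<Sum>y\<in>S. of_bool (y = x)) \<le> (1::real)"
        using finS[OF \<open>S \<in> \<A>\<close>] by (cases "x \<in> S") auto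
      ultimately show ?thesis by linarith
    qed (simp add: supp)
    define D where "D = {x. b x \<noteq> 0}"
    have D: "D \<subseteq> X" using supp unfolding D_def by force
    have finD: "finite D" using finite_subset[OF D X] .
    have bD: "b = (\<lambda>x. of_bool (x \<in> D))"
    proof
      fix x show "b x = of_bool (x \<in> D)" using le1[of x] by (auto simp: D_def)
    qed
    have "linear_form X b (\<lambda>_. 1) = card D" unfolding bD by (simp add: linear_form_indicator[OF X D])
    then have cD: "card D = d" using total by (simp add: linear_form_def)
    \<comment> \<open>The indicator of \<open>D\<close> as valuation: some member has weight at
      least d = \<open>card D\<close>, and having d elements it equals \<open>D\<close>.\<close>
    obtain S where S: "S \<in> \<A>" "linear_form X b (\<lambda>x. of_bool (x \<in> D)) \<le> (\<Sum>x\<in>S. of_bool (x \<in> D))"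
      using le[OF b] by blast
    have "linear_form X b (\<lambda>x. of_bool (x \<in> D)) = card D" unfolding bD by (simp add: linear_form_indicator[OF X D])
    moreover have "(\<Sum>x\<in>S. of_bool (x \<in> D)) = real (card (S \<inter> D))"
      using finS[OF S(1)] by simp
    ultimately have "card D \<le> card (S \<inter> D)" using S(2) by simp
    then have "S \<inter> D = D" using finD by (intro card_seteq) auto
    moreover have "S \<inter> D = S" using \<open>card D \<le> card (S \<inter> D)\<close> cD A(3)[OF S(1)] finS[OF S(1)]
      by (intro card_seteq) auto
    ultimately have "S = D" by blast
    then show ?thesis using S(1) bD by blast
  qed
  show ?thesis
  proof
    assume "\<exists>S\<in>\<A>. b = (\<lambda>x. of_bool (x \<in> S))"
    then obtain S where S: "S \<in> \<A>" "b = (\<lambda>x. of_bool (x \<in> S))" by blast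
    \<comment> \<open>Conversely, some produced monomial weighs at least \<open>card S\<close> on
      the indicator of \<open>S\<close>. It comes from a member of \<open>\<A>\<close> of the same
      size, hence from \<open>S\<close>.\<close>
    obtain b' where b': "produces C ?o b'" "(\<Sum>x\<in>S. of_bool (x \<in> S)) \<le> linear_form X b' (\<lambda>x. of_bool (x \<in> S))"
      using ge[OF S(1)] by blast
    obtain S' where S': "S' \<in> \<A>" "b' = (\<lambda>x. of_bool (x \<in> S'))" using main[OF b'(1)] by blast
    have "linear_form X b' (\<lambda>x. of_bool (x \<in> S)) = card (S' \<inter> S)"
      unfolding S'(2) using finS[OF S'(1)] by (simp add: linear_form_indicator[OF X A(2)[OF S'(1)]])
    then have "card S \<le> card (S' \<inter> S)" using b'(2) finS[OF S(1)] by simp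
    then have "S' \<inter> S = S" by (intro card_seteq finS S(1)) auto
    moreover have "S' \<inter> S = S'"
      using \<open>card S \<le> card (S' \<inter> S)\<close> A(3)[OF S(1)] A(3)[OF S'(1)] by (intro card_seteq finS S'(1)) auto
    ultimately have "S = S'" by blast
    then show "produces C ?o b" using S S' b' by simp
  qed (rule main)
qed

text \<open>Descend along a derivation of \<open>b\<close>. At an addition gate whose monomial has
  degree above \<open>t\<close>, one summand has degree above t / 2; continue there and move the
  other summand into the completion \<open>c'\<close>. The property \<open>R\<close> of all
  monomials of the gate survives, because replacing one summand gives another monomial of the gate
  above.\<close>

lemma exists_balanced_gate:
  fixes t :: nat
  assumes C: "tropical_circuit X C" and t: "t > 0" and X: "finite X"
    and b: "produces C n b" and n: "n \<in> nodes C"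
    and c: "\<And>b'. produces C n b' \<Longrightarrow> R (\<lambda>x. b' x + c x)" and big: "t < 2 * (\<Sum>x\<in>X. b x)"
  shows "\<exists>n'\<in>nodes C. \<exists>b' c'. produces C n' b' \<and> (\<lambda>x. b' x + c' x) = (\<lambda>x. b x + c x) \<and>
     (\<forall>b''. produces C n' b'' \<longrightarrow> R (\<lambda>x. b'' x + c' x)) \<and> t < 2 * (\<Sum>x\<in>X. b' x) \<and> (\<Sum>x\<in>X. b' x) \<le> t"
  using b n c big
proof (induction arbitrary: c rule: produces.induct)
  case (1 n x)
  have "(\<Sum>y\<in>X. of_bool (y = x)) \<le> (1::nat)"
    using X by (cases "x \<in> X") auto
  then show ?case using t 1 produces.intros(1)[OF 1(1)]
    by (intro bexI[of _ n] exI[of _ "\<lambda>y. of_bool (y = x)"] exI[of _ c]) auto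
next
  case (2 n)
  then show ?case by auto
next
  case (3 n l r a b)
  then have nodes: "l \<in> nodes C" "r \<in> nodes C" using C by (fastforce simp: tropical_circuit_def)+
  note prod = produces.intros(3)[OF 3(1)]
  show ?case
  proof (cases "(\<Sum>x\<in>X. a x + b x) \<le> t")
    case True
    then show ?thesis using 3(6-8) prod[OF 3(2,3)]
      by (intro bexI[of _ n] exI[of _ "\<lambda>y. a y + b y"] exI[of _ c]) auto
  next
    case False
    then have "t < 2 * (\<Sum>x\<in>X. a x) \<or> t < 2 * (\<Sum>x\<in>X. b x)" by (simp add: sum.distrib) linarith
    then show ?thesis
    proof
      assume w: "t < 2 * (\<Sum>x\<in>X. a x)"
      have "R (\<lambda>x. b' x + (b x + c x))" if "produces C l b'" for b'
        using 3(7)[OF prod[OF that 3(3)]] by (simp add: add.assoc)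
      from 3(4)[OF nodes(1) this w] show ?thesis by (simp add: add.assoc)
    next
      assume w: "t < 2 * (\<Sum>x\<in>X. b x)"
      have "R (\<lambda>x. b' x + (a x + c x))" if "produces C r b'" for b'
        using 3(7)[OF prod[OF 3(2) that]] by (simp add: add_ac)
      from 3(5)[OF nodes(2) this w] show ?thesis by (simp add: add_ac)
    qed
  qed
next
  case (4 n l r a)
  then have "l \<in> nodes C" using C by (fastforce simp: tropical_circuit_def)
  from 4(3)[OF this _ 4(6)] 4(5) produces.intros(4)[OF 4(1)] show ?case by blast
next
  case (5 n l r a)
  then have "r \<in> nodes C" using C by (fastforce simp: tropical_circuit_def)
  from 5(3)[OF this _ 5(6)] 5(5) produces.intros(5)[OF 5(1)] show ?case by blast
qed

section \<open>Spanning trees as parent functions\<close>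

lemma cas_snoc: "pre_digraph.cas H u (q @ [e]) v \<longleftrightarrow> pre_digraph.cas H u q (tail H e) \<and> head H e = v"
  by (induction q arbitrary: u) (auto simp: pre_digraph.cas.simps)

lemma cas_append: "pre_digraph.cas H u q v \<Longrightarrow> pre_digraph.cas H v q' w \<Longrightarrow> pre_digraph.cas H u (q @ q') w"
  by (induction q arbitrary: u) (auto simp: pre_digraph.cas.simps)

lemma parent_graph_simps:
  "verts (with_proj (parent_graph G p)) = pverts G"
  "arcs (with_proj (parent_graph G p)) = (\<lambda>u. (p u, u)) ` {u \<in> pverts G. p u \<noteq> u}"
  "pverts (parent_graph G p) = pverts G"
  "parcs (parent_graph G p) = (\<lambda>u. (p u, u)) ` {u \<in> pverts G. p u \<noteq> u}"
  "tail (with_proj (parent_graph G p)) = fst" "head (with_proj (parent_graph G p)) = snd"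
  by (simp_all add: parent_graph_def with_proj_def)

text \<open>The iterates of \<open>p\<close> from v, read backwards, form a walk from
  \<open>r\<close> to v. It is unique because the only arc of the parent graph into v \<noteq> r is
  \<open>(p v, v)\<close>, and no arc enters \<open>r\<close>.\<close>

lemma spanning_out_treesI:
  assumes G: "pair_wf_digraph G" and p: "p \<in> pverts G \<rightarrow>\<^sub>E pverts G" and r: "r \<in> pverts G" "p r = r"
    and arcs: "\<And>v. v \<in> pverts G \<Longrightarrow> v \<noteq> r \<Longrightarrow> (p v, v) \<in> parcs G \<and> p v \<noteq> v"
    and reach: "\<And>v. v \<in> pverts G \<Longrightarrow> \<exists>k. (p ^^ k) v = r"
  shows "p \<in> spanning_out_trees G"
proof -
  let ?H = "parent_graph G p"
  let ?D = "with_proj ?H"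
  have pV: "p v \<in> pverts G" if "v \<in> pverts G" for v using p that by auto
  have wf: "wf_digraph ?D" by standard (auto simp: parent_graph_simps pV)
  have "\<exists>q. pre_digraph.awalk ?D r q v" if "(p ^^ k) v = r" "v \<in> pverts G" for k v
    using that
  proof (induction k arbitrary: v)
    case 0
    then show ?case using r
      by (intro exI[of _ "[]"]) (simp add: pre_digraph.awalk_def pre_digraph.cas.simps parent_graph_simps)
  next
    case (Suc k)
    show ?case
    proof (cases "v = r")
      case True
      then show ?thesis using r
        by (intro exI[of _ "[]"]) (simp add: pre_digraph.awalk_def pre_digraph.cas.simps parent_graph_simps)
    next
      case False
      have "(p ^^ k) (p v) = r" using Suc.prems(1) by (simp add: funpow_swap1)
      then obtain q where q: "pre_digraph.awalk ?D r q (p v)" using Suc.IH pV Suc.prems(2) by blast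
      then have "pre_digraph.awalk ?D r (q @ [(p v, v)]) v"
        using False arcs[OF Suc.prems(2)] Suc.prems(2)
        by (auto simp: pre_digraph.awalk_def cas_snoc parent_graph_simps)
      then show ?thesis by blast
    qed
  qed
  then have ex: "\<exists>q. pre_digraph.awalk ?D r q v" if "v \<in> pverts G" for v using reach that by blast
  have unique: "q = q'" if "pre_digraph.awalk ?D r q v" "pre_digraph.awalk ?D r q' v" for q q' v
    using that
  proof (induction q arbitrary: q' v rule: rev_induct)
    case Nil
    then have "v = r" by (simp add: pre_digraph.awalk_def pre_digraph.cas.simps)
    show ?case
    proof (cases q' rule: rev_cases)
      case (snoc q1 e)
      then show ?thesis using Nil.prems(2) \<open>v = r\<close> r by (auto simp: pre_digraph.awalk_def cas_snoc parent_graph_simps)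
    qed simp
  next
    case (snoc e q)
    then have e: "e = (p v, v)" "p v \<noteq> v" "pre_digraph.awalk ?D r q (p v)"
      by (auto simp: pre_digraph.awalk_def cas_snoc parent_graph_simps)
    show ?case
    proof (cases q' rule: rev_cases)
      case Nil
      then have "v = r" using snoc.prems(2) by (simp add: pre_digraph.awalk_def pre_digraph.cas.simps)
      then show ?thesis using e r by simp
    next
      case q': (snoc q1 e')
      then have "e' = (p v, v)" "pre_digraph.awalk ?D r q1 (p v)"
        using snoc.prems(2) by (auto simp: pre_digraph.awalk_def cas_snoc parent_graph_simps)
      then show ?thesis using snoc.IH[OF e(3)] e q' by simp
    qed
  qed
  have "out_tree ?D r"
    unfolding out_tree_def using wf r ex unique by (auto simp: parent_graph_simps)
  moreover have "spanning ?D G"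
  proof -
    have "parcs ?H \<subseteq> parcs G"
      using arcs r by (auto simp: parent_graph_def)
    moreover have "wf_digraph (with_proj G)"
    proof -
      interpret pair_wf_digraph G by (rule G)
      show ?thesis by unfold_locales
    qed
    ultimately show ?thesis
      using wf by (auto simp: spanning_def subgraph_def compatible_def parent_graph_def)
  qed
  moreover have "\<exists>!v. v \<in> pverts G \<and> p v = v" using r arcs by blast
  ultimately show ?thesis using p r by (auto simp: spanning_out_trees_def)
qed

text \<open>A vertex without incoming arcs in \<open>G\<close> is fixed by \<open>p\<close>, hence
  it is the root. A periodic vertex v other than \<open>r\<close> would lie on a nonempty closed
  walk; appended to the walk from the root to v, it would give a second such walk.\<close>

lemma spanning_out_treesD:
  assumes p: "p \<in> spanning_out_trees G" and r: "r \<in> pverts G" "\<And>u. (u, r) \<notin> parcs G"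
  shows "p \<in> pverts G \<rightarrow>\<^sub>E pverts G" "p r = r"
    "\<And>v. v \<in> pverts G \<Longrightarrow> v \<noteq> r \<Longrightarrow> p v \<noteq> v \<and> (p v, v) \<in> parcs G"
    "\<And>v k. v \<in> pverts G \<Longrightarrow> k > 0 \<Longrightarrow> (p ^^ k) v = v \<Longrightarrow> v = r"
proof -
  let ?H = "parent_graph G p"
  let ?D = "with_proj ?H"
  show "p \<in> pverts G \<rightarrow>\<^sub>E pverts G" using p by (simp add: spanning_out_trees_def)
  then have pV: "p v \<in> pverts G" if "v \<in> pverts G" for v using that by auto
  from p obtain r' where r': "r' \<in> pverts G" "p r' = r'" "spanning ?D G" "out_tree ?D r'"
    and un: "\<exists>!v. v \<in> pverts G \<and> p v = v" by (auto simp: spanning_out_trees_def)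
  have arc: "(p v, v) \<in> parcs G" if "v \<in> pverts G" "p v \<noteq> v" for v
    using r'(3) that by (auto simp: spanning_def subgraph_def parent_graph_def)
  show pr: "p r = r" using arc[OF r(1)] r(2) by blast
  then have "r' = r" using un r r' by blast
  show ne: "p v \<noteq> v \<and> (p v, v) \<in> parcs G" if "v \<in> pverts G" "v \<noteq> r" for v
    using un pr r(1) that arc by blast
  fix v k assume v: "v \<in> pverts G" "k > (0::nat)" "(p ^^ k) v = v"
  show "v = r"
  proof (rule ccontr)
    assume "v \<noteq> r"
    have stay: "(p ^^ j) r = r" for j by (induction j) (auto simp: pr)
    have nr: "(p ^^ i) v \<noteq> r" if "i \<le> k" for i
    proof
      assume "(p ^^ i) v = r"
      then have "(p ^^ (k - i + i)) v = r" by (simp only: funpow_add comp_apply stay)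
      then show False using that v(3) \<open>v \<noteq> r\<close> by simp
    qed
    have "\<exists>w. length w = j \<and> pre_digraph.awalk ?D ((p ^^ j) v) w v" if "j \<le> k" for j
      using that
    proof (induction j)
      case 0
      then show ?case using v by (simp add: pre_digraph.awalk_def pre_digraph.cas.simps parent_graph_simps)
    next
      case (Suc j)
      let ?u = "(p ^^ j) v"
      obtain w where w: "length w = j" "pre_digraph.awalk ?D ?u w v" using Suc by auto
      then have u: "?u \<in> pverts G" by (simp add: pre_digraph.awalk_def parent_graph_simps)
      moreover have "p ?u \<noteq> ?u" using ne[OF u nr] Suc.prems by simp
      ultimately have "pre_digraph.awalk ?D (p ?u) ((p ?u, ?u) # w) v"
        using w pV[OF u] by (auto simp: pre_digraph.awalk_def pre_digraph.cas.simps parent_graph_simps)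
      then show ?case using w(1) by (intro exI[of _ "(p ?u, ?u) # w"]) simp
    qed
    from this[of k] obtain w where w: "length w = k" "pre_digraph.awalk ?D v w v" using v by auto
    have uq: "\<exists>!q. pre_digraph.awalk ?D r' q v"
      using r'(4) v(1) by (simp add: out_tree_def parent_graph_simps)
    then obtain q where q: "pre_digraph.awalk ?D r' q v" by blast
    then have "pre_digraph.awalk ?D r' (q @ w) v"
      using w by (auto simp: pre_digraph.awalk_def intro: cas_append)
    then have "q @ w = q" using uq q by blast
    then show False using w(1) v(2) by simp
  qed
qed

definition tree_arcs :: "'a set \<Rightarrow> ('a \<Rightarrow> 'a) \<Rightarrow> ('a \<times> 'a) set" where
  "tree_arcs W p = (\<lambda>v. (p v, v)) ` W"

text \<open>Every spanning tree has exactly one arc into each vertex other than the root. Hence all monomials of a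
  gate that can be completed in a common way have the same set of heads.\<close>
lemma circuit_cover:
  fixes C :: "('n, 'a \<times> 'a) circuit"
  assumes G: "pair_wf_digraph G" "finite (pverts G)" "finite (parcs G)"
    and r: "r \<in> pverts G" "\<And>u. (u, r) \<notin> parcs G"
    and C: "tropical_circuit (parcs G) C" "calculates C (DST G)"
    and H: "H \<subseteq> spanning_out_trees G" "H \<noteq> {}"
    and t: "0 < t" "t < 2 * card (pverts G - {r})"
  obtains node :: "('a \<Rightarrow> 'a) \<Rightarrow> 'n" and U :: "('a \<Rightarrow> 'a) \<Rightarrow> 'a set"
  where "node ` H \<subseteq> nodes C"
    and "\<And>h. h \<in> H \<Longrightarrow> U h \<subseteq> pverts G - {r} \<and> t < 2 * card (U h) \<and> card (U h) \<le> t"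
    and "\<And>h h'. h \<in> H \<Longrightarrow> h' \<in> H \<Longrightarrow> node h = node h' \<Longrightarrow> U h = U h' \<and>
      (\<exists>p\<in>spanning_out_trees G. \<forall>v\<in>pverts G - {r}. p v = (if v \<in> U h then h v else h' v))"
proof -
  let ?W = "pverts G - {r}" and ?T = "spanning_out_trees G" and ?X = "parcs G"
  note tree = spanning_out_treesD[OF _ r]
  define d where "d = card ?W"
  let ?A = "tree_arcs ?W ` ?T"
  have inj: "inj_on (\<lambda>v. (p v, v)) A" for p :: "'a \<Rightarrow> 'a" and A by (auto intro: inj_onI)
  have A: "?A \<noteq> {}" "\<And>S. S \<in> ?A \<Longrightarrow> S \<subseteq> ?X" "\<And>S. S \<in> ?A \<Longrightarrow> card S = d"
  proof -
    show "?A \<noteq> {}" using H by auto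
    fix S assume "S \<in> ?A"
    then obtain p where p: "p \<in> ?T" "S = tree_arcs ?W p" by auto
    show "S \<subseteq> ?X" using tree(3)[OF p(1)] p(2) by (auto simp: tree_arcs_def)
    show "card S = d" using p(2) by (simp add: tree_arcs_def card_image[OF inj] d_def)
  qed
  have "DST G = (\<lambda>\<nu>. Max ((\<lambda>S. \<Sum>x\<in>S. \<nu> x) ` ?A))"
  proof
    fix \<nu> :: "'a \<times> 'a \<Rightarrow> real"
    have "(\<Sum>v\<in>{v \<in> pverts G. p v \<noteq> v}. \<nu> (p v, v)) = (\<Sum>x\<in>tree_arcs ?W p. \<nu> x)" if "p \<in> ?T" for p
    proof -
      have "{v \<in> pverts G. p v \<noteq> v} = ?W" using tree(2,3)[OF that] r by auto
      then show ?thesis by (simp add: tree_arcs_def sum.reindex[OF inj])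
    qed
    then have "(\<lambda>p. \<Sum>v\<in>{v \<in> pverts G. p v \<noteq> v}. \<nu> (p v, v)) ` ?T = (\<lambda>S. \<Sum>x\<in>S. \<nu> x) ` ?A"
      unfolding image_image by (rule image_cong[OF refl])
    then show "DST G \<nu> = Max ((\<lambda>S. \<Sum>x\<in>S. \<nu> x) ` ?A)" by (simp only: DST_def)
  qed
  then have out: "produces C (out_node C) b \<longleftrightarrow> (\<exists>S\<in>?A. b = (\<lambda>x. of_bool (x \<in> S)))" for b
    using produces_out_node[OF C(1) G(3) A] C(2) by simp
  define R where "R b \<longleftrightarrow> (\<exists>p\<in>?T. b = (\<lambda>x. of_bool (x \<in> tree_arcs ?W p)))" for b :: "'a \<times> 'a \<Rightarrow> nat"
  \<comment> \<open>At the gate \<open>n\<close> the tree \<open>h\<close> splits into a balanced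
    produced part \<open>b\<close> and a part \<open>c\<close> that completes every monomial of
    \<open>n\<close> to a tree.\<close>
  define Z where "Z h n b c \<longleftrightarrow>
     n \<in> nodes C \<and> produces C n b \<and> (\<lambda>x. b x + c x) = (\<lambda>x. of_bool (x \<in> tree_arcs ?W h)) \<and>
     (\<forall>b'. produces C n b' \<longrightarrow> R (\<lambda>x. b' x + c x)) \<and> t < 2 * (\<Sum>x\<in>?X. b x) \<and> (\<Sum>x\<in>?X. b x) \<le> t"
    for h n b and c :: "'a \<times> 'a \<Rightarrow> nat"
  have "\<exists>n b c. Z h n b c" if "h \<in> H" for h
  proof -
    let ?b = "\<lambda>x. of_bool (x \<in> tree_arcs ?W h)::nat"
    have hA: "tree_arcs ?W h \<in> ?A" using that H by auto
    have b: "produces C (out_node C) ?b" using out hA by blast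
    have "(\<Sum>x\<in>?X. ?b x) = (\<Sum>x\<in>tree_arcs ?W h. 1)"
      using A(2)[OF hA] G(3) by (intro sum.mono_neutral_cong_right) auto
    also have "\<dots> = d" using A(3)[OF hA] by simp
    finally have "t < 2 * (\<Sum>x\<in>?X. ?b x)" using t(2) by (simp add: d_def)
    moreover have "R (\<lambda>x. b' x + (\<lambda>_. 0) x)" if "produces C (out_node C) b'" for b'
      using that out by (auto simp: R_def)
    moreover have "out_node C \<in> nodes C" using C(1) by (simp add: tropical_circuit_def)
    ultimately show ?thesis
      using exists_balanced_gate[OF C(1) t(1) G(3) b, of R "\<lambda>_. 0"] unfolding Z_def by simp blast
  qed
  then obtain n b c where "\<And>h. h \<in> H \<Longrightarrow> Z h (n h) (b h) (c h)" by metis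
  then have nbc: "n h \<in> nodes C \<and> produces C (n h) (b h) \<and>
     (\<lambda>x. b h x + c h x) = (\<lambda>x. of_bool (x \<in> tree_arcs ?W h)) \<and>
     (\<forall>b'. produces C (n h) b' \<longrightarrow> R (\<lambda>x. b' x + c h x)) \<and> t < 2 * (\<Sum>x\<in>?X. b h x) \<and> (\<Sum>x\<in>?X. b h x) \<le> t"
    if "h \<in> H" for h using that unfolding Z_def by blast
  \<comment> \<open>Natural exponents with sums in {0, 1} are indicators of disjoint sets.\<close>
  have split: "\<exists>B D. b' = (\<lambda>x. of_bool (x \<in> B)) \<and> c' = (\<lambda>x. of_bool (x \<in> D)) \<and> B \<inter> D = {} \<and> B \<union> D = S"
    if "(\<lambda>x. b' x + c' x) = (\<lambda>x. of_bool (x \<in> S))" for b' c' :: "'a \<times> 'a \<Rightarrow> nat" and S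
  proof -
    have eq: "b' x + c' x = of_bool (x \<in> S)" for x using fun_cong[OF that, of x] by simp
    show ?thesis
    proof (intro exI conjI)
      show "b' = (\<lambda>x. of_bool (x \<in> {x. b' x \<noteq> 0}))"
      proof
        show "b' x = of_bool (x \<in> {x. b' x \<noteq> 0})" for x using eq[of x] by (cases "x \<in> S") auto
      qed
      show "c' = (\<lambda>x. of_bool (x \<in> {x. c' x \<noteq> 0}))"
      proof
        show "c' x = of_bool (x \<in> {x. c' x \<noteq> 0})" for x using eq[of x] by (cases "x \<in> S") auto
      qed
      show "{x. b' x \<noteq> 0} \<inter> {x. c' x \<noteq> 0} = {}"
      proof (rule equals0I)
        fix x assume "x \<in> {x. b' x \<noteq> 0} \<inter> {x. c' x \<noteq> 0}"
        then show False using eq[of x] by (cases "x \<in> S") auto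
      qed
      show "{x. b' x \<noteq> 0} \<union> {x. c' x \<noteq> 0} = S"
      proof (rule set_eqI)
        show "x \<in> {x. b' x \<noteq> 0} \<union> {x. c' x \<noteq> 0} \<longleftrightarrow> x \<in> S" for x using eq[of x] by (cases "x \<in> S") auto
      qed
    qed
  qed
  define B where "B h = {x. b h x \<noteq> 0}" for h
  define D where "D h = {x. c h x \<noteq> 0}" for h
  have BD: "b h = (\<lambda>x. of_bool (x \<in> B h))" "c h = (\<lambda>x. of_bool (x \<in> D h))"
    "B h \<inter> D h = {}" "B h \<union> D h = tree_arcs ?W h" if hH: "h \<in> H" for h
  proof -
    obtain B' D' where *: "b h = (\<lambda>x. of_bool (x \<in> B'))" "c h = (\<lambda>x. of_bool (x \<in> D'))" "B' \<inter> D' = {}" "B' \<union> D' = tree_arcs ?W h"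
      using split[of "b h" "c h" "tree_arcs ?W h"] nbc[OF hH] by blast
    then have "B h = B'" "D h = D'" by (auto simp: B_def D_def)
    then show "b h = (\<lambda>x. of_bool (x \<in> B h))" "c h = (\<lambda>x. of_bool (x \<in> D h))"
      "B h \<inter> D h = {}" "B h \<union> D h = tree_arcs ?W h" using * by auto
  qed
  have cross: "\<exists>p\<in>?T. B h \<union> D h' = tree_arcs ?W p \<and> B h \<inter> D h' = {}"
    if "h \<in> H" "h' \<in> H" "n h = n h'" for h h'
  proof -
    have "produces C (n h') (b h)" using nbc[OF that(1)] that(3) by simp
    then have "R (\<lambda>x. b h x + c h' x)" using nbc[OF that(2)] by blast
    then obtain p where p: "p \<in> ?T" "(\<lambda>x. b h x + c h' x) = (\<lambda>x. of_bool (x \<in> tree_arcs ?W p))"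
      by (auto simp: R_def)
    from split[OF p(2)] obtain B' D' where *: "b h = (\<lambda>x. of_bool (x \<in> B'))" "c h' = (\<lambda>x. of_bool (x \<in> D'))" "B' \<inter> D' = {}" "B' \<union> D' = tree_arcs ?W p"
      by blast
    then have "B h = B'" "D h' = D'" by (auto simp: B_def D_def)
    then show ?thesis using * p(1) by auto
  qed
  \<comment> \<open>Together \<open>B h\<close> and \<open>D h'\<close> are the arcs of a tree,
    which has one arc into each vertex of \<open>?W\<close>. So their heads partition
    \<open>?W\<close>, and for fixed \<open>h'\<close> the heads of \<open>B h\<close> are the same
    for all \<open>h\<close> at the gate.\<close>
  have heads: "snd ` B h = ?W - snd ` D h'" if hh: "h \<in> H" "h' \<in> H" "n h = n h'" for h h'
  proof -
    obtain p where p: "B h \<union> D h' = tree_arcs ?W p" "B h \<inter> D h' = {}" using cross[OF hh] by auto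
    have 1: "snd x \<in> ?W" "x = (p (snd x), snd x)" if "x \<in> B h \<union> D h'" for x
      using that unfolding p(1) by (auto simp: tree_arcs_def)
    have 2: "(p v, v) \<in> B h \<union> D h'" if "v \<in> ?W" for v using that unfolding p(1) by (auto simp: tree_arcs_def)
    show ?thesis
    proof (intro subset_antisym subsetI)
      fix v assume "v \<in> snd ` B h"
      then obtain x where x: "v = snd x" "x \<in> B h" by (rule imageE)
      have "v \<notin> snd ` D h'"
      proof
        assume "v \<in> snd ` D h'"
        then obtain x' where x': "v = snd x'" "x' \<in> D h'" by (rule imageE)
        have "x = (p v, v)" using 1(2)[of x] x by simp
        moreover have "x' = (p v, v)" using 1(2)[of x'] x' by simp
        ultimately show False using x(2) x'(2) p(2) by blast
      qed
      then show "v \<in> ?W - snd ` D h'" using 1(1)[of x] x by simp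
    next
      fix v assume v: "v \<in> ?W - snd ` D h'"
      then have "(p v, v) \<notin> D h'" by force
      then have "(p v, v) \<in> B h" using 2[of v] v by blast
      then show "v \<in> snd ` B h" by force
    qed
  qed
  show ?thesis
  proof (rule that[of n "\<lambda>h. snd ` B h"])
    show "n ` H \<subseteq> nodes C" using nbc by auto
    fix h assume h: "h \<in> H"
    have "B h \<subseteq> tree_arcs ?W h" using BD(4)[OF h] by auto
    then have "inj_on snd (B h)" by (rule inj_on_subset[rotated]) (auto simp: tree_arcs_def inj_on_def)
    then have "card (snd ` B h) = card (B h)" by (rule card_image)
    also have "\<dots> = (\<Sum>x\<in>?X. b h x)"
    proof -
      have "B h \<subseteq> ?X" using \<open>B h \<subseteq> tree_arcs ?W h\<close> A(2) h H by blast
      then have "(\<Sum>x\<in>?X. b h x) = (\<Sum>x\<in>B h. 1)"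
        unfolding BD(1)[OF h] using G(3) by (intro sum.mono_neutral_cong_right) auto
      then show ?thesis by simp
    qed
    finally have "card (snd ` B h) = (\<Sum>x\<in>?X. b h x)" .
    then show "snd ` B h \<subseteq> ?W \<and> t < 2 * card (snd ` B h) \<and> card (snd ` B h) \<le> t"
      using nbc[OF h] heads[OF h h refl] by auto
  next
    fix h h' assume hh: "h \<in> H" "h' \<in> H" "n h = n h'"
    have "snd ` B h = snd ` B h'" using heads[OF hh] heads[OF hh(2,2) refl] by simp
    moreover obtain p where p: "p \<in> ?T" "B h \<union> D h' = tree_arcs ?W p" "B h \<inter> D h' = {}" using cross[OF hh] by auto
    have "p v = (if v \<in> snd ` B h then h v else h' v)" if v: "v \<in> ?W" for v
    proof (cases "v \<in> snd ` B h")
      case True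
      then obtain u where u: "(u, v) \<in> B h" by auto
      then have "(u, v) \<in> tree_arcs ?W p" "(u, v) \<in> tree_arcs ?W h" using p(2) BD(4)[OF hh(1)] by auto
      then show ?thesis using True by (auto simp: tree_arcs_def)
    next
      case False
      then have "v \<in> snd ` D h'" using heads[OF hh] v by auto
      then obtain u where u: "(u, v) \<in> D h'" by auto
      then have "(u, v) \<in> tree_arcs ?W p" "(u, v) \<in> tree_arcs ?W h'" using p(2) BD(4)[OF hh(2)] by auto
      then show ?thesis using False by (auto simp: tree_arcs_def)
    qed
    then have "\<exists>p\<in>?T. \<forall>v\<in>?W. p v = (if v \<in> snd ` B h then h v else h' v)" using p(1) by blast
    ultimately show "snd ` B h = snd ` B h' \<and> (\<exists>p\<in>?T. \<forall>v\<in>?W. p v = (if v \<in> snd ` B h then h v else h' v))"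
      by blast
  qed
qed

section \<open>Products of permutations\<close>

primrec seg :: "(nat \<Rightarrow> nat \<Rightarrow> nat) \<Rightarrow> nat \<Rightarrow> nat \<Rightarrow> nat \<Rightarrow> nat" where
  "seg \<rho> i 0 = id"
| "seg \<rho> i (Suc n) = \<rho> (i + n) \<circ> seg \<rho> i n"

lemma seg_add: "seg \<rho> i (n + n') = seg \<rho> (i + n) n' \<circ> seg \<rho> i n"
  by (induction n') (simp_all add: comp_assoc add.assoc)

lemma seg_cong: "(\<And>j. i \<le> j \<Longrightarrow> j < i + n \<Longrightarrow> \<rho> j = \<rho>' j) \<Longrightarrow> seg \<rho> i n = seg \<rho>' i n"
  by (induction n) auto

lemma seg_permutes:
  "(\<And>j. i \<le> j \<Longrightarrow> j < i + n \<Longrightarrow> \<rho> j permutes A) \<Longrightarrow> seg \<rho> i n permutes A"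
  by (induction n) (auto intro: permutes_compose permutes_id)

text \<open>For a permutation of \<open>{..<m}\<close> this means being a single cycle of length
  \<open>m\<close>. The form reflects its use: repeated turns around the ring arrive at position 0,
  where it is cut open.\<close>

definition cyclic_on :: "nat \<Rightarrow> (nat \<Rightarrow> nat) \<Rightarrow> bool" where
  "cyclic_on m f \<longleftrightarrow> (\<forall>a<m. \<exists>k. (f ^^ k) a = 0)"

text \<open>The orbit of \<open>x\<close> contains 0 and is closed under preimages, so it contains
  every point that reaches 0, which is all of \<open>{..<m}\<close>. But it has at most l < m
  elements.\<close>

lemma cyclic_on_no_short_cycle:
  assumes f: "f permutes {..<m}" and c: "cyclic_on m f" and x: "x < m" "(f ^^ l) x = x" "0 < l" "l < m"
  shows False
proof -
  define Orb where "Orb = (\<lambda>k. (f ^^ k) x) ` {..<l}"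
  have fin: "finite Orb" "card Orb \<le> l" unfolding Orb_def using card_image_le[of "{..<l}" "\<lambda>k. (f ^^ k) x"] by auto
  have inj: "inj f" using f permutes_inj by blast
  have "f ` Orb \<subseteq> Orb"
  proof
    fix y assume "y \<in> f ` Orb"
    then obtain k where k: "k < l" "y = (f ^^ Suc k) x" by (auto simp: Orb_def)
    show "y \<in> Orb"
    proof (cases "Suc k = l")
      case True
      then have "y = (f ^^ 0) x" using k x(2) by (simp only: funpow_0)
      then show ?thesis using x(3) unfolding Orb_def by blast
    next
      case False
      then have "Suc k < l" using k(1) by simp
      then show ?thesis using k(2) unfolding Orb_def by blast
    qed
  qed
  then have img: "f ` Orb = Orb" by (intro endo_inj_surj[OF fin(1)] inj_on_subset[OF inj]) auto
  have backward: "y \<in> Orb" if "(f ^^ k) y \<in> Orb" for k y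
    using that
  proof (induction k)
    case (Suc k)
    then have "f ((f ^^ k) y) \<in> f ` Orb" using img by simp
    then have "(f ^^ k) y \<in> Orb" using inj by (simp add: inj_image_mem_iff)
    then show ?case by (rule Suc.IH)
  qed simp
  have fwd: "(f ^^ k) y \<in> Orb" if "y \<in> Orb" for k y 
  proof (induction k)
    case (Suc k)
    then have "f ((f ^^ k) y) \<in> f ` Orb" by (rule imageI)
    then show ?case using img by simp
  qed (simp add: that)
  have "x \<in> Orb" unfolding Orb_def using x(3) by (intro image_eqI[of _ _ 0]) auto
  obtain k where k: "(f ^^ k) x = 0" using c x(1) unfolding cyclic_on_def by blast
  have "0 \<in> Orb" using fwd[OF \<open>x \<in> Orb\<close>, of k] unfolding k .
  have "y \<in> Orb" if "y < m" for y
  proof -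
    obtain k where k: "(f ^^ k) y = 0" using c \<open>y < m\<close> unfolding cyclic_on_def by blast
    show ?thesis by (rule backward[of k]) (simp only: k \<open>0 \<in> Orb\<close>)
  qed
  then have "{..<m} \<subseteq> Orb" by auto
  from card_mono[OF fin(1) this] have "m \<le> card Orb" by simp
  then show False using fin x by simp
qed

section \<open>Counting families of permutations with cyclic product\<close>

lemma finite_permutes_lessThan: "finite {f. f permutes {..<m::nat}}"
  by (rule finite_permutations) simp

lemma card_permutes_lessThan: "card {f. f permutes {..<m::nat}} = fact m"
  by (rule card_permutations) auto

text \<open>All conjugates of the cyclic shift by permutations g of \<open>{..<m}\<close> are
  cyclic. If g gives the conjugate f, then g k is the k-th iterate of f at g 0; hence g 0 determines
  g, and at most \<open>m\<close> permutations give the same f.\<close>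

lemma card_cyclic_permutations:
  assumes m: "m > 0"
  shows "fact m \<le> m * card {f. f permutes {..<m} \<and> cyclic_on m f}"
proof -
  let ?P = "{f. f permutes {..<m}}" and ?C = "{f. f permutes {..<m} \<and> cyclic_on m f}"
  define sh where "sh x = (if x < m then Suc x mod m else x)" for x
  have shp: "sh permutes {..<m}"
  proof (rule bij_imp_permutes)
    have inj: "inj_on sh {..<m}"
    proof (rule inj_onI)
      fix x y assume "x \<in> {..<m}" "y \<in> {..<m}" "sh x = sh y"
      then show "x = y" by (auto simp: sh_def mod_Suc split: if_splits)
    qed
    moreover have "sh ` {..<m} \<subseteq> {..<m}" using m by (auto simp: sh_def)
    ultimately show "bij_betw sh {..<m} {..<m}" by (simp add: bij_betw_def endo_inj_surj)
  qed (auto simp: sh_def)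
  have shk: "(sh ^^ k) x = (x + k) mod m" if "x < m" for k x
    using that m by (induction k) (auto simp: sh_def mod_Suc_eq)
  define conj where "conj g = g \<circ> sh \<circ> inv g" for g :: "nat \<Rightarrow> nat"
  have conjk: "(conj g ^^ k) (g x) = g ((sh ^^ k) x)" if "g \<in> ?P" for g k x
    using that by (induction k) (auto simp: conj_def permutes_inverses)
  have sub: "conj ` ?P \<subseteq> ?C"
  proof
    fix f assume "f \<in> conj ` ?P"
    then obtain g where g: "g permutes {..<m}" "f = conj g" by auto
    have "f permutes {..<m}" unfolding g(2) conj_def
      by (intro permutes_compose permutes_inv g shp)
    moreover have "\<exists>k. (f ^^ k) a = 0" if a: "a < m" for a
    proof -
      define x y where "x = inv g a" and "y = inv g 0"
      have xy: "x < m" "y < m" "g x = a" "g y = 0"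
        using g(1) a m permutes_in_image[OF permutes_inv[OF g(1)]] by (auto simp: x_def y_def permutes_inverses)
      have "(f ^^ (m - x + y)) (g x) = g ((x + (m - x + y)) mod m)"
        using conjk[of g "m - x + y" x] g shk xy by simp
      also have "x + (m - x + y) = m + y" using xy by simp
      finally show ?thesis using xy by auto
    qed
    ultimately show "f \<in> ?C" by (simp add: cyclic_on_def)
  qed
  have finC: "finite ?C" by (rule finite_subset[OF _ finite_permutes_lessThan[of m]]) auto
  have "?P \<subseteq> (\<Union>f\<in>?C. {g \<in> ?P. conj g = f})" using sub by auto
  then have "card ?P \<le> card (\<Union>f\<in>?C. {g \<in> ?P. conj g = f})"
    using finC finite_permutes_lessThan[of m] by (intro card_mono) auto
  also have "\<dots> \<le> (\<Sum>f\<in>?C. card {g \<in> ?P. conj g = f})" by (rule card_UN_le[OF finC])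
  also have "\<dots> \<le> (\<Sum>f\<in>?C. m)"
  proof (rule sum_mono)
    fix f assume "f \<in> ?C"
    have "inj_on (\<lambda>g. g 0) {g \<in> ?P. conj g = f}"
    proof (rule inj_onI)
      fix g g' assume gg: "g \<in> {g \<in> ?P. conj g = f}" "g' \<in> {g \<in> ?P. conj g = f}" "g 0 = g' 0"
      show "g = g'"
      proof
        fix k show "g k = g' k"
        proof (cases "k < m")
          case True
          then have "(sh ^^ k) 0 = k" using shk[of 0 k] m by simp
          then have "g k = (f ^^ k) (g 0)" "g' k = (f ^^ k) (g' 0)"
            using conjk[of g k 0] conjk[of g' k 0] gg by auto
          then show ?thesis using gg(3) by simp
        next
          case False
          then show ?thesis using gg permutes_not_in by (metis (mono_tags, lifting) lessThan_iff mem_Collect_eq)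
        qed
      qed
    qed
    moreover have "(\<lambda>g. g 0) ` {g \<in> ?P. conj g = f} \<subseteq> {..<m}"
      using m permutes_in_image by fastforce
    ultimately have "card {g \<in> ?P. conj g = f} \<le> card {..<m}" by (intro card_inj_on_le) auto
    then show "card {g \<in> ?P. conj g = f} \<le> m" by simp
  qed
  finally show ?thesis by (simp add: card_permutes_lessThan mult.commute)
qed

definition cyclic_families :: "nat \<Rightarrow> nat \<Rightarrow> (nat \<Rightarrow> nat \<Rightarrow> nat) set" where
  "cyclic_families m N = {\<rho> \<in> PiE {..<N} (\<lambda>_. {f. f permutes {..<m}}). cyclic_on m (seg \<rho> 0 N)}"

lemma finite_cyclic_families: "finite (cyclic_families m N)"
  unfolding cyclic_families_def
  by (intro finite_subset[OF _ finite_PiE[of "{..<N}" "\<lambda>_. {f. f permutes {..<m}}"]])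
    (auto simp: finite_permutes_lessThan)

text \<open>The first \<open>n\<close> permutations are free, and the last one corrects the product
  to any prescribed cyclic permutation.\<close>

lemma card_cyclic_families:
  assumes m: "m > 0"
  shows "fact m ^ Suc n \<le> m * card (cyclic_families m (Suc n))"
proof -
  let ?P = "{f. f permutes {..<m}}" and ?C = "{f. f permutes {..<m} \<and> cyclic_on m f}"
  let ?D = "PiE {..<n} (\<lambda>_. ?P) \<times> ?C"
  define F where "F = (\<lambda>(\<rho>, f). \<rho>(n := f \<circ> inv (seg \<rho> 0 n)))"
  have perm: "seg \<rho> 0 n permutes {..<m}" if "\<rho> \<in> PiE {..<n} (\<lambda>_. ?P)" for \<rho>
    using that by (intro seg_permutes) auto
  have seg: "seg (\<rho>(n := f')) 0 n = seg \<rho> 0 n" for \<rho> f' by (rule seg_cong) auto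
  have "inj_on F ?D"
  proof (rule inj_onI, clarify)
    fix \<rho> f \<rho>' f' assume D: "\<rho> \<in> PiE {..<n} (\<lambda>_. ?P)" "\<rho>' \<in> PiE {..<n} (\<lambda>_. ?P)"
      and eq: "F (\<rho>, f) = F (\<rho>', f')"
    have "\<rho> i = \<rho>' i" for i
    proof (cases "i < n")
      case True
      then show ?thesis using fun_cong[OF eq, of i] by (simp add: F_def)
    next
      case False
      then show ?thesis using D by (auto simp: PiE_def extensional_def)
    qed
    then have r: "\<rho> = \<rho>'" by auto
    have "f \<circ> inv (seg \<rho> 0 n) = f' \<circ> inv (seg \<rho> 0 n)" using fun_cong[OF eq, of n] r by (simp add: F_def)
    then have "f \<circ> (inv (seg \<rho> 0 n) \<circ> seg \<rho> 0 n) = f' \<circ> (inv (seg \<rho> 0 n) \<circ> seg \<rho> 0 n)"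
      by (simp only: comp_assoc[symmetric])
    then have "f = f'" using permutes_inv_o(2)[OF perm[OF D(1)]] by simp
    then show "\<rho> = \<rho>' \<and> f = f'" using r by simp
  qed
  moreover have "F ` ?D \<subseteq> cyclic_families m (Suc n)"
  proof clarify
    fix \<rho> f assume D: "\<rho> \<in> PiE {..<n} (\<lambda>_. ?P)" and f: "f permutes {..<m}" "cyclic_on m f"
    have "seg (F (\<rho>, f)) 0 (Suc n) = f \<circ> (inv (seg \<rho> 0 n) \<circ> seg \<rho> 0 n)"
      by (simp add: F_def seg comp_assoc)
    then have "seg (F (\<rho>, f)) 0 (Suc n) = f" using permutes_inv_o(2)[OF perm[OF D]] by simp
    moreover have "f \<circ> inv (seg \<rho> 0 n) permutes {..<m}" by (intro permutes_compose permutes_inv perm D f)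
    ultimately show "F (\<rho>, f) \<in> cyclic_families m (Suc n)"
      using D f by (auto simp: cyclic_families_def F_def PiE_def extensional_def Pi_def)
  qed
  ultimately have "card ?D \<le> card (cyclic_families m (Suc n))"
    using finite_cyclic_families by (intro card_inj_on_le) auto
  then have "fact m ^ n * card ?C \<le> card (cyclic_families m (Suc n))"
    by (simp add: card_cartesian_product card_PiE card_permutes_lessThan)
  then have "m * (fact m ^ n * card ?C) \<le> m * card (cyclic_families m (Suc n))" by (rule mult_le_mono2)
  moreover have "fact m ^ n * fact m \<le> fact m ^ n * (m * card ?C)"
    by (rule mult_le_mono2[OF card_cyclic_permutations[OF m]])
  ultimately show ?thesis by (simp only: power_Suc2 mult.left_commute[of m])
qed

text \<open>Two coordinates that can be exchanged independently between the members of a family whose products are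
  all cyclic form a combinatorial rectangle without short cycles.\<close>
lemma card_exchangeable_le:
  fixes q :: real
  assumes q: "q \<ge> 0" "q + 2 \<le> J / 2 ^ 15" and m: "ln m \<ge> 2 ^ (3 * J + 10)"
    and ij: "i < j" "j < N"
    and Z: "Z \<subseteq> PiE {..<N} (\<lambda>_. {f. f permutes {..<m}})"
    and agree: "\<And>\<rho> \<rho>' l. \<rho> \<in> Z \<Longrightarrow> \<rho>' \<in> Z \<Longrightarrow> l < N \<Longrightarrow> l \<noteq> i \<Longrightarrow> l \<noteq> j \<Longrightarrow> \<rho> l = \<rho>' l"
    and ex: "\<And>\<rho> \<rho>'. \<rho> \<in> Z \<Longrightarrow> \<rho>' \<in> Z \<Longrightarrow> cyclic_on m (seg (\<rho>(j := \<rho>' j)) 0 N)"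
  shows "card Z \<le> fact m ^ 2 * exp (- q * m)"
proof (cases "Z = {}")
  case False
  then obtain \<tau> where \<tau>: "\<tau> \<in> Z" by blast
  let ?P = "{f. f permutes {..<m}}"
  define A1 A2 A3 where "A1 = seg \<tau> 0 i" and "A2 = seg \<tau> (Suc i) (j - Suc i)" and "A3 = seg \<tau> (Suc j) (N - Suc j)"
  have P: "\<rho> l permutes {..<m}" if "\<rho> \<in> Z" "l < N" for \<rho> l using Z that by (auto simp: PiE_def Pi_def)
  have A: "A1 permutes {..<m}" "A2 permutes {..<m}" "A3 permutes {..<m}"
    unfolding A1_def A2_def A3_def using ij P[OF \<tau>] by (auto intro!: seg_permutes)
  have dec: "seg \<rho> 0 N = A3 \<circ> \<rho> j \<circ> A2 \<circ> \<rho> i \<circ> A1" if "\<And>l. l < N \<Longrightarrow> l \<noteq> i \<Longrightarrow> l \<noteq> j \<Longrightarrow> \<rho> l = \<tau> l" for \<rho>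
  proof -
    have "i + (1 + ((j - Suc i) + (1 + (N - Suc j)))) = N" using ij by simp
    then have "seg \<rho> 0 N = seg \<rho> 0 (i + (1 + ((j - Suc i) + (1 + (N - Suc j)))))" by (simp only:)
    also have "\<dots> = seg \<rho> (Suc j) (N - Suc j) \<circ> \<rho> j \<circ> seg \<rho> (Suc i) (j - Suc i) \<circ> \<rho> i \<circ> seg \<rho> 0 i"
      using ij by (simp only: seg_add) (simp add: comp_assoc)
    also have "seg \<rho> 0 i = A1" unfolding A1_def using that ij by (intro seg_cong) auto
    also have "seg \<rho> (Suc i) (j - Suc i) = A2" unfolding A2_def using that ij by (intro seg_cong) auto
    also have "seg \<rho> (Suc j) (N - Suc j) = A3" unfolding A3_def using that ij by (intro seg_cong) auto
    finally show ?thesis .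
  qed
  \<comment> \<open>The product of \<open>A3\<close>, \<open>\<rho> j\<close>, \<open>A2\<close>,
    \<open>\<rho> i\<close>, \<open>A1\<close> is conjugate under \<open>A1\<close> to an element of
    \<open>G\<close> after an element of \<open>F\<close>. Since \<open>\<rho> i\<close> and
    \<open>\<rho> j\<close> may come from different members of \<open>Z\<close>, this holds for all
    pairs from \<open>F\<close> and \<open>G\<close>.\<close>
  define F G where "F = (\<lambda>\<rho>. A2 \<circ> \<rho> i) ` Z" and "G = (\<lambda>\<rho>. A1 \<circ> A3 \<circ> \<rho> j) ` Z"
  have sub: "F \<subseteq> ?P" "G \<subseteq> ?P" unfolding F_def G_def using A P ij by (auto intro!: permutes_compose)
  have fin: "finite F" "finite G" using sub finite_permutes_lessThan finite_subset by blast+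
  have cardle: "card F \<le> fact m" "card G \<le> fact m"
    using card_mono[OF finite_permutes_lessThan sub(1)] card_mono[OF finite_permutes_lessThan sub(2)]
    by (simp_all add: card_permutes_lessThan)
  have "card Z \<le> card (F \<times> G)"
  proof (rule card_inj_on_le)
    show "inj_on (\<lambda>\<rho>. (A2 \<circ> \<rho> i, A1 \<circ> A3 \<circ> \<rho> j)) Z"
    proof (rule inj_onI)
      fix \<rho> \<rho>' assume *: "\<rho> \<in> Z" "\<rho>' \<in> Z" "(A2 \<circ> \<rho> i, A1 \<circ> A3 \<circ> \<rho> j) = (A2 \<circ> \<rho>' i, A1 \<circ> A3 \<circ> \<rho>' j)"
      have "inj A2" "inj (A1 \<circ> A3)" using A permutes_inj permutes_compose by blast+
      moreover have "f = g" if "inj h" "h \<circ> f = h \<circ> g" for h f g :: "nat \<Rightarrow> nat"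
        using that by (simp add: fun_eq_iff inj_eq)
      ultimately have eq: "\<rho> i = \<rho>' i" "\<rho> j = \<rho>' j" using *(3) unfolding prod.inject by blast+
      show "\<rho> = \<rho>'"
      proof
        fix l show "\<rho> l = \<rho>' l"
        proof (cases "l < N")
          case True
          then show ?thesis using eq agree[OF *(1,2)] by (cases "l = i"; cases "l = j") auto
        next
          case False
          then show ?thesis using subsetD[OF Z *(1)] subsetD[OF Z *(2)] by (auto simp: PiE_def extensional_def)
        qed
      qed
    qed
  qed (use fin in \<open>auto simp: F_def G_def\<close>)
  then have cZ: "real (card Z) \<le> real (card F) * real (card G)" by (simp add: card_cartesian_product flip: of_nat_mult)
  have "card F < fact m * exp (- q * m) \<or> card G < fact m * exp (- q * m)"
  proof (rule ccontr)
    assume "\<not> ?thesis"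
    then have "card F \<ge> fact m * exp (- q * m)" "card G \<ge> fact m * exp (- q * m)" by auto
    from exists_short_cycle[OF q m sub(1) this(1) sub(2) this(2)]
    obtain f g x l where fg: "f \<in> F" "g \<in> G" "x < m" "0 < l" "l < m" "((g \<circ> f) ^^ l) x = x" by metis
    then obtain \<rho> \<rho>' where \<rho>: "\<rho> \<in> Z" "\<rho>' \<in> Z" "f = A2 \<circ> \<rho> i" "g = A1 \<circ> A3 \<circ> \<rho>' j" by (auto simp: F_def G_def)
    define Q where "Q = seg (\<rho>(j := \<rho>' j)) 0 N"
    have Q: "Q = A3 \<circ> \<rho>' j \<circ> A2 \<circ> \<rho> i \<circ> A1"
      unfolding Q_def using dec[of "\<rho>(j := \<rho>' j)"] agree[OF \<rho>(1) \<tau>] ij by auto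
    define y where "y = inv A1 x"
    have y: "A1 y = x" "y < m" using A(1) fg(3) permutes_in_image[OF permutes_inv[OF A(1)]]
      by (auto simp: y_def permutes_inverses)
    have "A1 ((Q ^^ k) y) = ((g \<circ> f) ^^ k) x" for k
      by (induction k) (simp_all add: y Q \<rho>(3,4))
    then have "A1 ((Q ^^ l) y) = A1 y" using fg(6) y by simp
    then have "(Q ^^ l) y = y" using permutes_inj[OF A(1)] by (auto dest: injD)
    moreover have "Q permutes {..<m}" unfolding Q using A P \<rho> ij by (auto intro!: permutes_compose)
    moreover have "cyclic_on m Q" unfolding Q_def by (rule ex[OF \<rho>(1,2)])
    ultimately show False using cyclic_on_no_short_cycle y(2) fg(4,5) by blast
  qed
  then have "real (card F) * real (card G) \<le> fact m * exp (- q * m) * fact m"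
  proof
    assume "card F < fact m * exp (- q * m)"
    moreover have "real (card G) \<le> fact m" using cardle(2) by (metis of_nat_fact of_nat_le_iff)
    ultimately show ?thesis by (intro mult_mono) auto
  next
    assume "card G < fact m * exp (- q * m)"
    moreover have "real (card F) \<le> fact m" using cardle(1) by (metis of_nat_fact of_nat_le_iff)
    ultimately have "real (card F) * real (card G) \<le> fact m * (fact m * exp (- q * m))" by (intro mult_mono) auto
    then show ?thesis by (simp add: mult_ac)
  qed
  then show ?thesis using cZ by (simp add: power2_eq_square mult_ac)
qed simp

section \<open>The ring graph\<close>

text \<open>The vertex \<open>0\<close> is the root; the other vertices come in \<open>2 * N\<close> copies of \<open>{..<m}\<close>, and copy \<open>c\<close> lies in
  layer \<open>c div 2\<close>. The layers are arranged in a ring.\<close>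
definition vtx :: "nat \<Rightarrow> nat \<Rightarrow> nat \<Rightarrow> nat" where
  "vtx m c a = Suc (c * m + a)"

abbreviation active :: "nat \<Rightarrow> (nat \<Rightarrow> bool \<times> bool) \<Rightarrow> nat \<Rightarrow> nat \<Rightarrow> nat" where
  "active m s i \<equiv> vtx m (2 * i + of_bool (fst (s i)))"

definition ring_graph :: "nat \<Rightarrow> nat \<Rightarrow> nat pair_pre_digraph" where
  "ring_graph m N = \<lparr> pverts = {..2 * N * m},
     parcs = {(0, v) | v. v \<in> {1..2 * N * m}} \<union>
       {(vtx m c' b, vtx m c a) | c' b c a. c < 2 * N \<and> c' < 2 * N \<and> c' div 2 = Suc (c div 2) mod N \<and> a < m \<and> b < m} \<union>
       {(vtx m c a, vtx m c b) | c a b. c < 2 * N \<and> a < m \<and> b < m \<and> (b = Suc a \<or> a = Suc b)} \<rparr>"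

text \<open>In layer \<open>i\<close> the first component of \<open>s i\<close> selects the active copy, whose vertices are attached to the active copy
  of the next layer through the permutation \<open>\<rho> i\<close>, and the second component is the direction in which the other
  copy is traversed by a path from the root. The ring is cut open at position \<open>0\<close> of layer \<open>0\<close>.\<close>
definition ring_tree :: "nat \<Rightarrow> nat \<Rightarrow> (nat \<Rightarrow> bool \<times> bool) \<Rightarrow> (nat \<Rightarrow> nat \<Rightarrow> nat) \<Rightarrow> nat \<Rightarrow> nat" where
  "ring_tree m N s \<rho> v =
     (if v > 2 * N * m then undefined else if v = 0 then 0 else
      let c = (v - 1) div m; a = (v - 1) mod m; i = c div 2; i' = Suc i mod N in
      if odd c = fst (s i) then (if i = 0 \<and> a = 0 then 0 else active m s i' (\<rho> i a))
      else if snd (s i) then (if a = 0 then 0 else vtx m c (a - 1))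
      else (if Suc a = m then 0 else vtx m c (Suc a)))"

lemma vtx_neq_0 [simp]: "vtx m c a \<noteq> 0" "0 < vtx m c a"
  by (simp_all add: vtx_def)

lemma vtx_le: "c < 2 * N \<Longrightarrow> a < m \<Longrightarrow> vtx m c a \<le> 2 * N * m"
proof -
  assume "c < 2 * N" "a < m"
  then have "Suc c * m \<le> 2 * N * m" by (intro mult_le_mono1) simp
  then show ?thesis using \<open>a < m\<close> by (simp add: vtx_def)
qed

lemma vtx_decode: "a < m \<Longrightarrow> (vtx m c a - 1) div m = c" "a < m \<Longrightarrow> (vtx m c a - 1) mod m = a"
  by (simp_all add: vtx_def)

lemma vtx_inject: "a < m \<Longrightarrow> b < m \<Longrightarrow> vtx m c a = vtx m d b \<longleftrightarrow> c = d \<and> a = b"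
  using vtx_decode by metis

lemma vtx_cases:
  assumes "v \<le> 2 * N * m" "v \<noteq> 0"
  obtains c a where "v = vtx m c a" "c < 2 * N" "a < m"
proof -
  have m: "m > 0" using assms by (cases "m = 0") auto
  have "v = vtx m ((v - 1) div m) ((v - 1) mod m)" using assms(2) by (simp add: vtx_def)
  moreover have "(v - 1) div m < 2 * N" using assms m by (intro less_mult_imp_div_less) linarith
  ultimately show ?thesis using that m by (meson mod_less_divisor)
qed

lemma ring_tree_0 [simp]: "ring_tree m N s \<rho> 0 = 0"
  by (simp add: ring_tree_def)

lemma ring_tree_active:
  assumes "i < N" "a < m" "i \<noteq> 0 \<or> a \<noteq> 0"
  shows "ring_tree m N s \<rho> (active m s i a) =
    active m s (Suc i mod N) (\<rho> i a)"
proof -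
  have "active m s i a \<le> 2 * N * m" using assms by (intro vtx_le) auto
  moreover have "(2 * i + of_bool (fst (s i))) div 2 = i" by simp
  moreover have "odd (2 * i + of_bool (fst (s i)) :: nat) = fst (s i)" by simp
  ultimately show ?thesis using assms
    by (simp only: ring_tree_def Let_def vtx_decode not_less[symmetric]) auto
qed

lemma ring_tree_cut:
  assumes "0 < N" "0 < m"
  shows "ring_tree m N s \<rho> (vtx m (of_bool (fst (s 0))) 0) = 0"
proof -
  have "vtx m (of_bool (fst (s 0))) 0 \<le> 2 * N * m" using assms by (intro vtx_le) auto
  moreover have "(of_bool (fst (s 0)) :: nat) div 2 = 0" by simp
  moreover have "odd (of_bool (fst (s 0)) :: nat) = fst (s 0)" by simp
  ultimately show ?thesis using assms
    by (simp only: ring_tree_def Let_def vtx_decode not_less[symmetric]) auto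
qed

lemma ring_tree_inactive:
  assumes "c < 2 * N" "a < m" "odd c \<noteq> fst (s (c div 2))"
  shows "ring_tree m N s \<rho> (vtx m c a) =
    (if snd (s (c div 2)) then (if a = 0 then 0 else vtx m c (a - 1))
     else (if Suc a = m then 0 else vtx m c (Suc a)))"
proof -
  have "vtx m c a \<le> 2 * N * m" using assms by (intro vtx_le) auto
  then show ?thesis using assms
    by (simp only: ring_tree_def Let_def vtx_decode not_less[symmetric]) auto
qed

lemma ring_tree_local:
  assumes "a < m" "\<rho> (c div 2) = \<rho>' (c div 2)"
  shows "ring_tree m N s \<rho> (vtx m c a) = ring_tree m N s \<rho>' (vtx m c a)"
  by (simp only: ring_tree_def Let_def vtx_decode[OF assms(1)] assms(2))

lemma pair_digraph_ring_graph:
  assumes "N \<ge> 2"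
  shows "pair_digraph (ring_graph m N)"
proof
  have ne: "Suc i mod N \<noteq> i" if "i < N" for i using assms that by (auto simp: mod_Suc)
  show "finite (pverts (ring_graph m N))" by (simp add: ring_graph_def)
  have "parcs (ring_graph m N) \<subseteq> {..2 * N * m} \<times> {..2 * N * m}"
    by (auto simp: ring_graph_def intro!: vtx_le)
  then show "finite (parcs (ring_graph m N))" by (rule finite_subset) simp
  fix e assume e: "e \<in> parcs (ring_graph m N)"
  then show "fst e \<in> pverts (ring_graph m N)" "snd e \<in> pverts (ring_graph m N)"
    by (auto simp: ring_graph_def intro!: vtx_le)
  show "fst e \<noteq> snd e"
  proof
    assume "fst e = snd e"
    then consider v where "0 = v" "v \<in> {1..2 * N * m}"
      | c' b c a where "vtx m c' b = vtx m c a" "c < 2 * N" "c' div 2 = Suc (c div 2) mod N" "a < m" "b < m"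
      | c a b where "vtx m c a = vtx m c b" "a < m" "b < m" "b = Suc a \<or> a = Suc b"
      using e unfolding ring_graph_def by auto
    then show False
    proof cases
      case 2
      then have "c div 2 = Suc (c div 2) mod N" by (simp add: vtx_inject)
      moreover have "c div 2 < N" using 2 by auto
      ultimately show False using ne by metis
    qed (auto simp: vtx_inject)
  qed
qed

section \<open>Pathwidth of the ring graph\<close>

definition layer :: "nat \<Rightarrow> nat \<Rightarrow> nat set" where
  "layer m i = {vtx m c a | c a. c div 2 = i \<and> a < m}"

lemma card_layer_le: "finite (layer m i)" "card (layer m i) \<le> 2 * m"
proof -
  let ?f = "\<lambda>(e, a). vtx m (2 * i + of_bool e) a" and ?S = "(UNIV :: bool set) \<times> {..<m}"
  have sub: "layer m i \<subseteq> ?f ` ?S"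
  proof
    fix v assume "v \<in> layer m i"
    then obtain c a where v: "v = vtx m c a" "c div 2 = i" "a < m" by (auto simp: layer_def)
    have "c = 2 * i + of_bool (odd c)" using v(2) by (cases "odd c") auto
    then have "v = ?f (odd c, a)" using v(1) by simp
    then show "v \<in> ?f ` ?S" by (rule image_eqI) (use v(3) in simp)
  qed
  have "finite (?f ` ?S)" by simp
  then show "finite (layer m i)" by (rule finite_subset[OF sub])
  have "card (layer m i) \<le> card (?f ` ?S)" by (rule card_mono[OF \<open>finite (?f ` ?S)\<close> sub])
  also have "\<dots> \<le> card ?S" by (rule card_image_le) simp
  finally show "card (layer m i) \<le> 2 * m" by (simp add: card_cartesian_product)
qed

text \<open>A bag consists of two consecutive layers, the root, and layer 0, which takes care of the
  arcs that close the ring. This makes 1 + 3 (2 m) vertices.\<close>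

lemma pathwidth_ring_graph:
  assumes N: "N \<ge> 2"
  shows "pathwidth (ring_graph m N) \<le> 6 * int m"
proof -
  let ?G = "ring_graph m N"
  define bag where "bag i = insert 0 (layer m 0 \<union> layer m i \<union> layer m (Suc i))" for i
  define bs where "bs = map bag [0..<N - 1]"
  have ne: "bs \<noteq> []" using N by (simp add: bs_def)
  have set: "set bs = bag ` {..<N - 1}" by (auto simp: bs_def)
  have disj: "i = j" if "v \<in> layer m i" "v \<in> layer m j" for v i j
    using that by (auto simp: layer_def vtx_inject)
  have vl: "vtx m c a \<in> layer m (c div 2)" if "a < m" for c a using that by (auto simp: layer_def)
  have sub: "layer m i \<subseteq> {..2 * N * m}" if "i < N" for i
  proof
    fix v assume "v \<in> layer m i"
    then obtain c a where "v = vtx m c a" "c div 2 = i" "a < m" by (auto simp: layer_def)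
    then show "v \<in> {..2 * N * m}" using that vtx_le[of c N a m] by auto
  qed
  have pd: "path_decomposition (pverts ?G) (underlying_edges ?G) bs"
    unfolding path_decomposition_def
  proof (intro conjI ballI allI impI)
    show "bs \<noteq> []" by (rule ne)
    have cov: "\<exists>i<N - 1. {u, v} \<subseteq> bag i" if "c < 2 * N" "c' < 2 * N" "a < m" "b < m" "u = vtx m c' b" "v = vtx m c a"
      "c' div 2 = Suc (c div 2) mod N \<or> c' div 2 = c div 2" for c c' a b u v
    proof -
      have c: "c div 2 < N" using that by auto
      have u: "u \<in> layer m (c' div 2)" "v \<in> layer m (c div 2)" using that vl by auto
      show ?thesis
      proof (cases "c div 2 = N - 1")
        case True
        \<comment> \<open>The last layer starts no bag of its own and is found as the second layer
          of bag \<open>N - 2\<close>.\<close>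
        have N2: "Suc (N - 2) = N - 1" "N - 2 < N - 1" using N by auto
        have "c' div 2 = 0 \<or> c' div 2 = N - 1" using that(7) True N by auto
        then have "u \<in> layer m 0 \<or> u \<in> layer m (N - 1)" using u(1) by metis
        moreover have "v \<in> layer m (N - 1)" using u(2) True by simp
        ultimately have "{u, v} \<subseteq> bag (N - 2)" unfolding bag_def N2(1) by blast
        then show ?thesis using N2(2) by blast
      next
        case False
        then have lt: "c div 2 < N - 1" using c by linarith
        then have "Suc (c div 2) mod N = Suc (c div 2)" by (intro mod_less) linarith
        then have "c' div 2 = Suc (c div 2) \<or> c' div 2 = c div 2" using that(7) by simp
        then have "u \<in> layer m (Suc (c div 2)) \<or> u \<in> layer m (c div 2)" using u(1) by metis
        then have "{u, v} \<subseteq> bag (c div 2)" unfolding bag_def using u(2) by blast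
        then show ?thesis using lt by blast
      qed
    qed
    show "\<Union>(set bs) = pverts ?G"
    proof
      have "bag i \<subseteq> pverts ?G" if "i < N - 1" for i
        using sub[of 0] sub[of i] sub[of "Suc i"] that N by (auto simp: bag_def ring_graph_def)
      then show "\<Union>(set bs) \<subseteq> pverts ?G" by (auto simp: set)
      show "pverts ?G \<subseteq> \<Union>(set bs)"
      proof
        fix v assume v: "v \<in> pverts ?G"
        show "v \<in> \<Union>(set bs)"
        proof (cases "v = 0")
          case True
          then have "v \<in> bag 0" by (simp add: bag_def)
          moreover have "bag 0 \<in> set bs" unfolding set using N by (intro imageI) simp
          ultimately show ?thesis by blast
        next
          case False
          then obtain c a where "v = vtx m c a" "c < 2 * N" "a < m" using vtx_cases[of v N m] v by (auto simp: ring_graph_def)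
          then show ?thesis using cov[of c c a a v v] by (auto simp: set)
        qed
      qed
    qed
    fix e assume "e \<in> underlying_edges ?G"
    then obtain u v where e: "e = {u, v}" "(u, v) \<in> parcs ?G" by (auto simp: underlying_edges_def)
    then consider "u = 0" "v \<in> {1..2 * N * m}"
      | c' b c a where "u = vtx m c' b" "v = vtx m c a" "c < 2 * N" "c' < 2 * N" "c' div 2 = Suc (c div 2) mod N" "a < m" "b < m"
      | c a b where "u = vtx m c a" "v = vtx m c b" "c < 2 * N" "a < m" "b < m"
      unfolding ring_graph_def by auto
    then have "\<exists>i<N - 1. e \<subseteq> bag i"
    proof cases
      case 1
      then obtain c a where "v = vtx m c a" "c < 2 * N" "a < m" using vtx_cases[of v N m] by auto
      then show ?thesis using cov[of c c a a v v] 1(1) e by (auto simp: bag_def)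
    next
      case 2
      then show ?thesis using cov[of c c' a b u v] e by auto
    next
      case 3
      then show ?thesis using cov[of c c b a u v] e by auto
    qed
    then show "\<exists>b\<in>set bs. e \<subseteq> b" by (auto simp: set)
  next
    fix i j l assume "i \<le> j" "j \<le> l" "l < length bs"
    moreover have "x \<in> bag j" if x: "x \<in> bag i" "x \<in> bag l" and ij: "i \<le> j" "j \<le> l" for x
    proof (cases "x = 0 \<or> x \<in> layer m 0")
      case False
      then obtain p where p: "x \<in> layer m p" "p = i \<or> p = Suc i" using x(1) by (auto simp: bag_def)
      have "p = l \<or> p = Suc l" using x(2) False p(1) disj by (auto simp: bag_def)
      then have "p = j \<or> p = Suc j" using p(2) ij by linarith
      then show ?thesis using p(1) by (auto simp: bag_def)
    qed (auto simp: bag_def)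
    ultimately show "bs ! i \<inter> bs ! l \<subseteq> bs ! j" by (auto simp: bs_def)
  qed
  have "card b \<le> 6 * m + 1" if "b \<in> set bs" for b
  proof -
    obtain i where "b = bag i" using \<open>b \<in> set bs\<close> set by auto
    then have "card b \<le> Suc (card (layer m 0 \<union> layer m i \<union> layer m (Suc i)))"
      unfolding bag_def by (simp add: card_insert_if card_layer_le)
    also have "\<dots> \<le> Suc (card (layer m 0) + card (layer m i) + card (layer m (Suc i)))"
      using card_Un_le[of "layer m 0 \<union> layer m i" "layer m (Suc i)"] card_Un_le[of "layer m 0" "layer m i"] by linarith
    also have "\<dots> \<le> 6 * m + 1"
      using card_layer_le(2)[of m 0] card_layer_le(2)[of m i] card_layer_le(2)[of m "Suc i"] by linarith
    finally show ?thesis .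
  qed
  then have "Max (card ` set bs) \<le> 6 * m + 1" using ne by simp
  then have w: "width bs \<le> 6 * int m" by (simp add: width_def)
  have "bdd_below (width ` {bs. path_decomposition (pverts ?G) (underlying_edges ?G) bs})"
    by (intro bdd_belowI[of _ "-1"]) (auto simp: width_def)
  then have "pathwidth ?G \<le> width bs" unfolding pathwidth_def using pd by (intro cInf_lower) auto
  then show ?thesis using w by linarith
qed

text \<open>Formulated for any \<open>p\<close> that agrees with a ring tree, so as to apply to
  crossings of trees as well. Since i + n \<le> N, only the starting vertex can be the cut vertex
  among those from which a step is made, and the condition on \<open>b\<close> prevents
  this.\<close>

lemma ring_tree_steps:
  assumes p: "\<And>v. v \<noteq> 0 \<Longrightarrow> v \<le> 2 * N * m \<Longrightarrow> p v = ring_tree m N s \<rho> v"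
    and \<rho>: "\<And>i. i < N \<Longrightarrow> \<rho> i permutes {..<m}"
    and b: "b < m" "i \<noteq> 0 \<or> b \<noteq> 0" and n: "0 < n" "i + n \<le> N"
  shows "(p ^^ n) (active m s i b) =
     active m s ((i + n) mod N) (seg \<rho> i n b)"
  using n
proof (induction n)
  case (Suc n)
  have step: "p (active m s l x) =
      active m s (Suc l mod N) (\<rho> l x)"
    if "l < N" "x < m" "l \<noteq> 0 \<or> x \<noteq> 0" for l x
  proof -
    have "active m s l x \<le> 2 * N * m" using that by (intro vtx_le) auto
    then show ?thesis using p ring_tree_active[OF that] by simp
  qed
  show ?case
  proof (cases "n = 0")
    case True
    then show ?thesis using step[of i b] b Suc.prems by simp
  next
    case False
    have l: "i + n < N" using Suc.prems by simp
    have "seg \<rho> i n permutes {..<m}" using \<rho> l by (intro seg_permutes) auto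
    then have x: "seg \<rho> i n b < m" using b(1) permutes_in_image by fastforce
    have "(p ^^ n) (active m s i b) = active m s (i + n) (seg \<rho> i n b)"
      using Suc.IH False Suc.prems l by simp
    then have "(p ^^ Suc n) (active m s i b) = p (active m s (i + n) (seg \<rho> i n b))"
      by simp
    also have "\<dots> = active m s (Suc (i + n) mod N) (\<rho> (i + n) (seg \<rho> i n b))"
      using False by (intro step l x) simp
    finally show ?thesis by simp
  qed
qed simp

text \<open>From an active vertex the parents lead to layer 0. Each further turn applies the product
  of the permutations, until position 0 is reached, whose parent is the root. An inactive copy is a
  path that ends in the root.\<close>

lemma ring_tree_mem:
  assumes N: "N \<ge> 2" and m: "m > 0" and \<rho>: "\<rho> \<in> cyclic_families m N"
  shows "ring_tree m N s \<rho> \<in> spanning_out_trees (ring_graph m N)"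
proof -
  let ?G = "ring_graph m N" and ?p = "ring_tree m N s \<rho>"
  let ?av = "\<lambda>i. active m s i"
  have perm: "\<rho> i permutes {..<m}" if "i < N" for i using \<rho> that by (auto simp: cyclic_families_def PiE_def Pi_def)
  have V: "pverts ?G = {..2 * N * m}" by (simp add: ring_graph_def)
  interpret pair_digraph ?G by (rule pair_digraph_ring_graph[OF N])
  have cases: "P" if v: "v \<noteq> 0" "v \<le> 2 * N * m"
    and "\<And>i b. v = ?av i b \<Longrightarrow> i < N \<Longrightarrow> b < m \<Longrightarrow> P"
    and "\<And>c a. v = vtx m c a \<Longrightarrow> c < 2 * N \<Longrightarrow> a < m \<Longrightarrow> odd c \<noteq> fst (s (c div 2)) \<Longrightarrow> P" for v P
  proof -
    obtain c a where ca: "v = vtx m c a" "c < 2 * N" "a < m" using vtx_cases[OF v(2,1)] .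
    show P
    proof (cases "odd c = fst (s (c div 2))")
      case True
      have "c = 2 * (c div 2) + of_bool (odd c)" by (cases "odd c") auto
      then have "v = ?av (c div 2) a" using True ca by simp
      then show P using that(3)[of "c div 2" a] ca by auto
    next
      case False
      then show P using that(4) ca by blast
    qed
  qed
  have arcs: "(?p v, v) \<in> parcs ?G" if v: "v \<noteq> 0" "v \<le> 2 * N * m" for v
  proof (rule cases[OF v])
    fix i b assume i: "v = ?av i b" "i < N" "b < m"
    have ri: "\<rho> i b < m" using perm[OF i(2)] i(3) permutes_in_image by fastforce
    show "(?p v, v) \<in> parcs ?G"
    proof (cases "i = 0 \<and> b = 0")
      case True
      then have "?p v = 0" using ring_tree_cut[of N m s \<rho>] i m by simp
      then show ?thesis using v by (auto simp: ring_graph_def)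
    next
      case False
      define i' where "i' = Suc i mod N"
      have i': "i' < N" using N by (simp add: i'_def)
      have "?p v = ?av i' (\<rho> i b)" using ring_tree_active[OF i(2,3)] False i(1) by (simp add: i'_def)
      moreover have "(2 * i' + of_bool (fst (s i'))) div 2 = Suc ((2 * i + of_bool (fst (s i))) div 2) mod N"
        by (simp add: i'_def)
      moreover have "2 * i' + of_bool (fst (s i')) < 2 * N" "2 * i + of_bool (fst (s i)) < 2 * N" using i' i(2) by auto
      ultimately show ?thesis unfolding ring_graph_def using i(1,3) ri by (simp only: pair_pre_digraph.simps) blast
    qed
  next
    fix c a assume c: "v = vtx m c a" "c < 2 * N" "a < m" "odd c \<noteq> fst (s (c div 2))"
    have "?p v = 0 \<or> (\<exists>b<m. ?p v = vtx m c b \<and> (b = Suc a \<or> a = Suc b))"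
    proof (cases "snd (s (c div 2))")
      case True
      then have "?p v = (if a = 0 then 0 else vtx m c (a - 1))"
        using ring_tree_inactive[of c N a m s \<rho>, OF c(2,3,4)] c(1) by simp
      then show ?thesis using c(3) by (cases "a = 0") (auto intro!: exI[of _ "a - 1"])
    next
      case False
      then have "?p v = (if Suc a = m then 0 else vtx m c (Suc a))"
        using ring_tree_inactive[of c N a m s \<rho>, OF c(2,3,4)] c(1) by simp
      then show ?thesis using c(3) by (cases "Suc a = m") (auto intro!: exI[of _ "Suc a"])
    qed
    then show "(?p v, v) \<in> parcs ?G"
    proof
      assume "?p v = 0"
      then show ?thesis using v by (auto simp: ring_graph_def)
    next
      assume "\<exists>b<m. ?p v = vtx m c b \<and> (b = Suc a \<or> a = Suc b)"
      then show ?thesis unfolding ring_graph_def using c(1-3) by (simp only: pair_pre_digraph.simps) blast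
    qed
  qed
  have reach0: "\<exists>n. (?p ^^ n) (?av 0 a) = 0" if "(seg \<rho> 0 N ^^ k) a = 0" "a < m" for k a
    using that
  proof (induction k arbitrary: a)
    case 0
    then show ?case using ring_tree_cut[of N m s \<rho>] N m by (intro exI[of _ 1]) simp
  next
    case (Suc k)
    show ?case
    proof (cases "a = 0")
      case True
      then show ?thesis using ring_tree_cut[of N m s \<rho>] N m by (intro exI[of _ 1]) simp
    next
      case False
      have Q: "seg \<rho> 0 N permutes {..<m}" using perm by (intro seg_permutes) auto
      have "(?p ^^ N) (?av 0 a) = ?av 0 (seg \<rho> 0 N a)"
        using ring_tree_steps[of N m ?p s \<rho> a 0 N] perm False Suc.prems N by simp
      moreover obtain n where "(?p ^^ n) (?av 0 (seg \<rho> 0 N a)) = 0"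
        using Suc.IH[of "seg \<rho> 0 N a"] Suc.prems permutes_in_image[OF Q, of a] by (auto simp: funpow_swap1)
      ultimately have "(?p ^^ (n + N)) (?av 0 a) = 0" by (simp only: funpow_add comp_apply)
      then show ?thesis by blast
    qed
  qed
  have reach: "\<exists>n. (?p ^^ n) v = 0" if v: "v \<noteq> 0" "v \<le> 2 * N * m" for v
  proof (rule cases[OF v])
    fix i b assume i: "v = ?av i b" "i < N" "b < m"
    have r: "\<exists>n. (?p ^^ n) (?av 0 a) = 0" if "a < m" for a
      using \<rho> that reach0 by (auto simp: cyclic_families_def cyclic_on_def)
    show "\<exists>n. (?p ^^ n) v = 0"
    proof (cases "i = 0")
      case True
      then show ?thesis using r[OF i(3)] i(1) by simp
    next
      case False
      have "seg \<rho> i (N - i) permutes {..<m}" using perm by (intro seg_permutes) auto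
      then have lt: "seg \<rho> i (N - i) b < m" using i(3) permutes_in_image by fastforce
      have "(?p ^^ (N - i)) v = ?av 0 (seg \<rho> i (N - i) b)"
        using ring_tree_steps[of N m ?p s \<rho> b i "N - i"] perm False i by simp
      moreover obtain n where "(?p ^^ n) (?av 0 (seg \<rho> i (N - i) b)) = 0" using r[OF lt] by blast
      ultimately have "(?p ^^ (n + (N - i))) v = 0" by (simp only: funpow_add comp_apply)
      then show ?thesis by blast
    qed
  next
    fix c a assume c: "v = vtx m c a" "c < 2 * N" "a < m" "odd c \<noteq> fst (s (c div 2))"
    note step = ring_tree_inactive[of c N _ m s \<rho>, OF c(2) _ c(4)]
    show "\<exists>n. (?p ^^ n) v = 0"
    proof (cases "snd (s (c div 2))")
      case True
      have "(?p ^^ Suc a) (vtx m c a) = 0" if "a < m" for a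
        using that
      proof (induction a)
        case 0
        then show ?case using step[of 0] True by simp
      next
        case (Suc a)
        then show ?case using step[of "Suc a"] True by (simp only: funpow_Suc_right comp_apply) simp
      qed
      then show ?thesis using c(1,3) by blast
    next
      case False
      \<comment> \<open>Upward paths leave at position m - 1, so the induction runs over the
        distance from there.\<close>
      have "(?p ^^ Suc n) (vtx m c (m - Suc n)) = 0" if "n < m" for n
        using that
      proof (induction n)
        case 0
        then show ?case using step[of "m - 1"] False by simp
      next
        case (Suc n)
        then have "?p (vtx m c (m - Suc (Suc n))) = vtx m c (m - Suc n)"
          using step[of "m - Suc (Suc n)"] False by (simp add: Suc_diff_Suc)
        then show ?case using Suc by (simp only: funpow_Suc_right comp_apply)
      qed
      from this[of "m - Suc a"] show ?thesis using c(1,3) by (metis Suc_diff_Suc diff_Suc_less diff_diff_cancel less_imp_le_nat less_Suc_eq_le Suc_leI m)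
    qed
  qed
  show ?thesis
  proof (rule spanning_out_treesI[where r = 0])
    show "pair_wf_digraph ?G" by unfold_locales
    show "?p \<in> pverts ?G \<rightarrow>\<^sub>E pverts ?G"
    proof (rule PiE_I)
      fix v assume "v \<in> pverts ?G"
      then show "?p v \<in> pverts ?G"
        using arcs[of v] arc_fst_in_verts[of "(?p v, v)"] by (cases "v = 0") (auto simp: V)
    next
      fix v assume "v \<notin> pverts ?G"
      then show "?p v = undefined" by (simp add: V ring_tree_def)
    qed
    show "0 \<in> pverts ?G" "?p 0 = 0" by (simp_all add: V)
    fix v assume v: "v \<in> pverts ?G"
    show "\<exists>k. (?p ^^ k) v = 0"
    proof (cases "v = 0")
      case True
      then show ?thesis by (intro exI[of _ 0]) simp
    qed (use reach v V in auto)
    assume "v \<noteq> 0"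
    then have "(?p v, v) \<in> parcs ?G" using arcs v V by auto
    then show "(?p v, v) \<in> parcs ?G \<and> ?p v \<noteq> v" using pair_no_loops by fastforce
  qed
qed

text \<open>If the orbit of a never met 0, the parents would go around the ring forever without
  meeting the cut. Orbits of a permutation of a finite set are periodic, so a vertex of layer 0
  would be periodic under \<open>p\<close> without being the root.\<close>

lemma cyclic_on_if_tree:
  assumes N: "N \<ge> 2"
    and p: "p \<in> spanning_out_trees (ring_graph m N)"
      "\<And>v. v \<noteq> 0 \<Longrightarrow> v \<le> 2 * N * m \<Longrightarrow> p v = ring_tree m N s \<rho> v"
    and \<rho>: "\<And>i. i < N \<Longrightarrow> \<rho> i permutes {..<m}"
  shows "cyclic_on m (seg \<rho> 0 N)"
  unfolding cyclic_on_def
proof (intro allI impI, rule ccontr)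
  fix a assume a: "a < m" and "\<nexists>k. (seg \<rho> 0 N ^^ k) a = 0"
  then have neg: "(seg \<rho> 0 N ^^ k) a \<noteq> 0" for k by simp
  let ?Q = "seg \<rho> 0 N" and ?v = "vtx m (of_bool (fst (s 0)))"
  have Q: "?Q permutes {..<m}" using \<rho> by (intro seg_permutes) auto
  have lt: "(?Q ^^ k) a < m" for k
    using a permutes_in_image[OF Q] by (induction k) auto
  have iter: "(p ^^ (k * N)) (?v a) = ?v ((?Q ^^ k) a)" for k
  proof (induction k)
    case (Suc k)
    have "(p ^^ N) (?v ((?Q ^^ k) a)) = ?v (?Q ((?Q ^^ k) a))"
      using ring_tree_steps[of N m p s \<rho> "(?Q ^^ k) a" 0 N] p(2) \<rho> lt neg N by simp
    then show ?case using Suc by (simp add: funpow_add)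
  qed simp
  have "finite {y. \<exists>k. y = (?Q ^^ k) a}"
    by (rule finite_subset[of _ "{..<m}"]) (use lt in auto)
  then obtain k where k: "k > 0" "(?Q ^^ k) a = a"
    using funpow_inj_finite[OF permutes_inj[OF Q]] by metis
  then have "(p ^^ (k * N)) (?v a) = ?v a" using iter by simp
  moreover have "?v a \<in> pverts (ring_graph m N)" using vtx_le[of "of_bool (fst (s 0))" N a m] a N by (simp add: ring_graph_def)
  moreover have "0 \<in> pverts (ring_graph m N)" "(u, 0) \<notin> parcs (ring_graph m N)" for u
    by (auto simp: ring_graph_def)
  ultimately have "?v a = 0"
    using spanning_out_treesD(4)[OF p(1), of 0 "?v a" "k * N"] k N by simp
  then show False by simp
qed

lemma card_le_sum_fibres:
  fixes c :: real
  assumes "finite A" "finite B" "f ` A \<subseteq> B" "\<And>b. b \<in> B \<Longrightarrow> real (card {a \<in> A. f a = b}) \<le> c"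
  shows "real (card A) \<le> card B * c"
proof -
  have "A \<subseteq> (\<Union>b\<in>B. {a \<in> A. f a = b})" using assms(3) by auto
  then have "card A \<le> card (\<Union>b\<in>B. {a \<in> A. f a = b})" using assms(1,2) by (intro card_mono) auto
  also have "\<dots> \<le> (\<Sum>b\<in>B. card {a \<in> A. f a = b})" by (rule card_UN_le[OF assms(2)])
  finally have "real (card A) \<le> (\<Sum>b\<in>B. real (card {a \<in> A. f a = b}))" by (metis of_nat_le_iff of_nat_sum)
  also have "\<dots> \<le> (\<Sum>b\<in>B. c)" by (rule sum_mono) (rule assms(4))
  finally show ?thesis by simp
qed

section \<open>Classes of crossing trees\<close>

abbreviation states :: "nat \<Rightarrow> (nat \<Rightarrow> bool \<times> bool) set" where
  "states N \<equiv> PiE {..<N} (\<lambda>_. UNIV)"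

abbreviation perm_families :: "nat \<Rightarrow> nat \<Rightarrow> (nat \<Rightarrow> nat \<Rightarrow> nat) set" where
  "perm_families m N \<equiv> PiE {..<N} (\<lambda>_. {f. f permutes {..<m}})"

lemma card_states: "card (states N) = 4 ^ N"
proof -
  have "card (UNIV :: (bool \<times> bool) set) = 4" by (simp only: card_prod UNIV_bool) (simp add: card_UNIV_bool)
  then show ?thesis by (simp add: card_PiE)
qed

lemma card_restricted_states:
  fixes B :: "nat \<Rightarrow> (bool \<times> bool) set" and b :: nat
  assumes A: "A \<subseteq> {..<N}" and b: "\<And>i. i \<in> A \<Longrightarrow> card (B i) \<le> b"
  shows "real (card {s \<in> states N. \<forall>i\<in>A. s i \<in> B i}) \<le> 4 ^ N * (b / 4) ^ card A"
proof -
  have c4: "card (UNIV :: (bool \<times> bool) set) = 4" by (simp only: card_prod UNIV_bool) (simp add: card_UNIV_bool)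
  have fA: "finite A" using A finite_subset by blast
  have "{s \<in> states N. \<forall>i\<in>A. s i \<in> B i} \<subseteq> PiE {..<N} (\<lambda>i. if i \<in> A then B i else UNIV)"
    using A by (auto simp: PiE_def Pi_def)
  moreover have "finite (PiE {..<N} (\<lambda>i. if i \<in> A then B i else UNIV))" by (intro finite_PiE) auto
  ultimately have "card {s \<in> states N. \<forall>i\<in>A. s i \<in> B i} \<le> card (PiE {..<N} (\<lambda>i. if i \<in> A then B i else UNIV))"
    by (rule card_mono[rotated])
  also have "\<dots> = (\<Prod>i<N. card (if i \<in> A then B i else UNIV))" by (simp add: card_PiE)
  also have "\<dots> \<le> (\<Prod>i<N. if i \<in> A then b else 4)" by (intro prod_mono) (auto simp: b c4)
  also have "\<dots> = b ^ card A * 4 ^ card ({..<N} - A)"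
    using A by (subst prod.If_cases) (auto simp: Int_absorb1 Diff_eq)
  also have "card ({..<N} - A) = N - card A" using A fA by (simp add: card_Diff_subset)
  finally have "real (card {s \<in> states N. \<forall>i\<in>A. s i \<in> B i}) \<le> real (b ^ card A * 4 ^ (N - card A))"
    unfolding of_nat_le_iff .
  also have "\<dots> = 4 ^ N * (b / 4) ^ card A"
  proof -
    have "card A \<le> N" using card_mono[OF _ A] by simp
    then have "(4::real) ^ N = 4 ^ card A * 4 ^ (N - card A)" by (simp flip: power_add)
    then show ?thesis by (simp add: power_divide)
  qed
  finally show ?thesis .
qed

text \<open>\<open>K\<close> stands for the trees assigned to one gate and \<open>U\<close> for the
  heads of the arcs accumulated there; \<open>cross\<close> is the conclusion of
  \<open>circuit_cover\<close>.\<close>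

locale crossing_class =
  fixes m N :: nat and U :: "nat set" and K :: "((nat \<Rightarrow> bool \<times> bool) \<times> (nat \<Rightarrow> nat \<Rightarrow> nat)) set"
  assumes N: "N \<ge> 2" and m: "m \<ge> 2"
    and K: "K \<subseteq> states N \<times> cyclic_families m N"
    and cross: "\<And>s \<rho> s' \<rho>'. (s, \<rho>) \<in> K \<Longrightarrow> (s', \<rho>') \<in> K \<Longrightarrow>
      \<exists>p\<in>spanning_out_trees (ring_graph m N). \<forall>v. v \<noteq> 0 \<longrightarrow> v \<le> 2 * N * m \<longrightarrow>
        p v = (if v \<in> U then ring_tree m N s \<rho> v else ring_tree m N s' \<rho>' v)"
begin

text \<open>The layers divided by \<open>U\<close>. The division is located between neighbours on a
  path, where it can create a 2-cycle.\<close>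

definition mixed :: "nat set" where
  "mixed = {i. i < N \<and> (\<exists>c a. c div 2 = i \<and> Suc a < m \<and> (vtx m c a \<in> U) \<noteq> (vtx m c (Suc a) \<in> U))}"

lemma finite_K: "finite K"
  by (rule finite_subset[OF K]) (auto intro!: finite_cartesian_product finite_PiE finite_cyclic_families)

lemma no_two_cycle:
  assumes "p \<in> spanning_out_trees (ring_graph m N)" "c < 2 * N" "Suc a < m"
    "p (vtx m c a) = vtx m c (Suc a)" "p (vtx m c (Suc a)) = vtx m c a"
  shows False
proof -
  have "vtx m c a \<in> pverts (ring_graph m N)" using vtx_le[of c N a m] assms by (simp add: ring_graph_def)
  moreover have "0 \<in> pverts (ring_graph m N)" "(u, 0) \<notin> parcs (ring_graph m N)" for u by (auto simp: ring_graph_def)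
  moreover have "(p ^^ 2) (vtx m c a) = vtx m c a" using assms by (simp add: numeral_2_eq_2)
  ultimately have "vtx m c a = 0" using spanning_out_treesD(4)[OF assms(1), of 0 "vtx m c a" 2] by simp
  then show False by simp
qed

text \<open>Two members with opposite directions in an inactive mixed copy would cross to a tree with a 2-cycle.\<close>
lemma mixed_excludes_state:
  assumes "i \<in> mixed"
  obtains x where "\<And>s \<rho>. (s, \<rho>) \<in> K \<Longrightarrow> s i \<noteq> x"
proof -
  obtain c a where c: "i < N" "c div 2 = i" "Suc a < m" "(vtx m c a \<in> U) \<noteq> (vtx m c (Suc a) \<in> U)"
    using assms by (auto simp: mixed_def)
  have c2: "c < 2 * N" using c by auto
  have le: "vtx m c a \<le> 2 * N * m" "vtx m c (Suc a) \<le> 2 * N * m" using vtx_le[OF c2] c(3) by auto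
  \<comment> \<open>Both states make copy \<open>c\<close> inactive. One attaches position a + 1 to
    a, the other a to a + 1; as \<open>U\<close> separates these two vertices, one crossing takes
    both arcs.\<close>
  have False if K1: "(s, \<rho>) \<in> K" "s i = (\<not> odd c, True)" and K2: "(s', \<rho>') \<in> K" "s' i = (\<not> odd c, False)" for s \<rho> s' \<rho>'
  proof -
    have 1: "ring_tree m N s \<rho> (vtx m c (Suc a)) = vtx m c a"
      using ring_tree_inactive[of c N "Suc a" m s \<rho>] c2 c K1(2) by simp
    have 2: "ring_tree m N s' \<rho>' (vtx m c a) = vtx m c (Suc a)"
      using ring_tree_inactive[of c N a m s' \<rho>'] c2 c K2(2) by simp
    show False
    proof (cases "vtx m c a \<in> U")
      case True
      obtain p where p: "p \<in> spanning_out_trees (ring_graph m N)"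
        "\<And>v. v \<noteq> 0 \<Longrightarrow> v \<le> 2 * N * m \<Longrightarrow> p v = (if v \<in> U then ring_tree m N s' \<rho>' v else ring_tree m N s \<rho> v)"
        using cross[OF K2(1) K1(1)] by blast
      show False using no_two_cycle[OF p(1) c2 c(3)] p(2)[OF _ le(1)] p(2)[OF _ le(2)] True c(4) 1 2 by simp
    next
      case False
      obtain p where p: "p \<in> spanning_out_trees (ring_graph m N)"
        "\<And>v. v \<noteq> 0 \<Longrightarrow> v \<le> 2 * N * m \<Longrightarrow> p v = (if v \<in> U then ring_tree m N s \<rho> v else ring_tree m N s' \<rho>' v)"
        using cross[OF K1(1) K2(1)] by blast
      show False using no_two_cycle[OF p(1) c2 c(3)] p(2)[OF _ le(1)] p(2)[OF _ le(2)] False c(4) 1 2 by simp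
    qed
  qed
  then have "(\<forall>s \<rho>. (s, \<rho>) \<in> K \<longrightarrow> s i \<noteq> (\<not> odd c, True)) \<or> (\<forall>s \<rho>. (s, \<rho>) \<in> K \<longrightarrow> s i \<noteq> (\<not> odd c, False))"
    by blast
  then show ?thesis using that by blast
qed

lemma card_perm_families: "card (perm_families m N) = fact m ^ N"
  by (simp add: card_PiE card_permutes_lessThan)

lemma card_K_le_states:
  assumes "\<And>s \<rho>. (s, \<rho>) \<in> K \<Longrightarrow> s \<in> S" "finite S"
  shows "real (card K) \<le> real (card S) * fact m ^ N"
proof -
  have "K \<subseteq> S \<times> perm_families m N" using K assms(1) by (auto simp: cyclic_families_def)
  moreover have "finite (S \<times> perm_families m N)"
    using assms(2) by (auto intro!: finite_cartesian_product finite_PiE finite_permutes_lessThan)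
  ultimately have "card K \<le> card (S \<times> perm_families m N)" by (rule card_mono[rotated])
  then have "card K \<le> card S * fact m ^ N" by (simp add: card_cartesian_product card_perm_families)
  then have "real (card K) \<le> real (card S * fact m ^ N)" by (rule of_nat_mono)
  then show ?thesis by simp
qed

text \<open>Each mixed layer admits at most 3 of its 4 states, while the permutations are simply
  bounded by all of them.\<close>

lemma many_mixed:
  assumes "card mixed \<ge> M"
  shows "real (card K) \<le> 4 ^ N * (3 / 4) ^ M * fact m ^ N"
proof -
  obtain x where x: "\<And>i s \<rho>. i \<in> mixed \<Longrightarrow> (s, \<rho>) \<in> K \<Longrightarrow> s i \<noteq> x i"
  proof -
    have "\<forall>i\<in>mixed. \<exists>x. \<forall>s \<rho>. (s, \<rho>) \<in> K \<longrightarrow> s i \<noteq> x" using mixed_excludes_state by metis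
    from bchoice[OF this] show ?thesis using that by blast
  qed
  let ?S = "{s \<in> states N. \<forall>i\<in>mixed. s i \<in> UNIV - {x i}}"
  have "real (card K) \<le> real (card ?S) * fact m ^ N"
    by (rule card_K_le_states) (use x K in \<open>auto intro!: finite_subset[OF _ finite_PiE[of "{..<N}" "\<lambda>_. UNIV"]]\<close>)
  also have "\<dots> \<le> 4 ^ N * (real 3 / 4) ^ card mixed * fact m ^ N"
  proof (intro mult_right_mono card_restricted_states)
    show "mixed \<subseteq> {..<N}" by (auto simp: mixed_def)
    have "card (UNIV :: (bool \<times> bool) set) = 4" by (simp only: card_prod UNIV_bool) (simp add: card_UNIV_bool)
    then show "card (UNIV - {x i}) \<le> 3" for i by (simp add: card_Diff_singleton)
  qed simp
  also have "\<dots> \<le> 4 ^ N * (3 / 4) ^ M * fact m ^ N"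
    using assms by (intro mult_right_mono mult_left_mono) (auto intro!: power_decreasing)
  finally show ?thesis .
qed

lemma pure_layer:
  assumes "i < N" "i \<notin> mixed" "c div 2 = i" "a < m"
  shows "vtx m c a \<in> U \<longleftrightarrow> vtx m c 0 \<in> U"
  using assms(4)
proof (induction a)
  case (Suc a)
  then have "(vtx m c a \<in> U) = (vtx m c (Suc a) \<in> U)" using assms(1-3) unfolding mixed_def by blast
  then show ?case using Suc by simp
qed simp

text \<open>For a fixed state only the active copies depend on the permutations. Those of
  \<open>i\<close> and \<open>j\<close> are on different sides of \<open>U\<close>, so crossing two
  trees that agree in all other layers replaces just \<open>\<rho> j\<close>. Thus
  \<open>card_exchangeable_le\<close> applies once the other N - 2 permutations are fixed.\<close>

lemma card_fibre_le:
  fixes q :: real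
  assumes q: "q \<ge> 0" "q + 2 \<le> J / 2 ^ 15" and lm: "ln m \<ge> 2 ^ (3 * J + 10)"
    and ij: "i < j" "j < N" "i \<noteq> 0"
    and side: "\<And>a. a < m \<Longrightarrow> active m s i a \<in> U \<longleftrightarrow> b"
      "\<And>a. a < m \<Longrightarrow> active m s j a \<in> U \<longleftrightarrow> \<not> b"
  shows "real (card {\<rho>. (s, \<rho>) \<in> K}) \<le> fact m ^ N * exp (- q * m)"
proof -
  let ?K = "{\<rho>. (s, \<rho>) \<in> K}" and ?I = "{..<N} - {i, j}"
  have Ksub: "?K \<subseteq> cyclic_families m N" using K by auto
  have perm: "?K \<subseteq> perm_families m N" using Ksub by (auto simp: cyclic_families_def)
  have finK: "finite ?K" using Ksub finite_cyclic_families finite_subset by blast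
  let ?B = "PiE ?I (\<lambda>_. {f. f permutes {..<m}})"
  have finB: "finite ?B" by (auto intro!: finite_PiE finite_permutes_lessThan)
  have "real (card ?K) \<le> card ?B * (fact m ^ 2 * exp (- q * m))"
  proof (rule card_le_sum_fibres[where f = "\<lambda>\<rho>. restrict \<rho> ?I"])
    show "(\<lambda>\<rho>. restrict \<rho> ?I) ` ?K \<subseteq> ?B" using perm by (auto simp: PiE_def Pi_def)
    fix \<tau> assume "\<tau> \<in> ?B"
    let ?Z = "{\<rho> \<in> ?K. restrict \<rho> ?I = \<tau>}"
    show "real (card ?Z) \<le> fact m ^ 2 * exp (- q * m)"
    proof (rule card_exchangeable_le[OF q lm ij(1,2)])
      show "?Z \<subseteq> perm_families m N" using perm by auto
      fix \<rho> \<rho>' assume Z: "\<rho> \<in> ?Z" "\<rho>' \<in> ?Z"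
      have agree: "\<rho> l = \<rho>' l" if "l < N" "l \<noteq> i" "l \<noteq> j" for l
      proof -
        have "restrict \<rho> ?I = restrict \<rho>' ?I" using Z by simp
        from fun_cong[OF this, of l] show ?thesis using that by simp
      qed
      show "\<rho> l = \<rho>' l" if "l < N" "l \<noteq> i" "l \<noteq> j" for l by (rule agree[OF that])
      define \<sigma> where "\<sigma> = \<rho>(j := \<rho>' j)"
      \<comment> \<open>The tree of the exchanged family is the crossing of the two trees;
        \<open>b\<close> decides which of them supplies the arcs into \<open>U\<close>.\<close>
      have same: "ring_tree m N s \<sigma> v = (if (v \<in> U) = b then ring_tree m N s \<rho> v else ring_tree m N s \<rho>' v)"
        if v: "v \<noteq> 0" "v \<le> 2 * N * m" for v
      proof -
        obtain c a where ca: "v = vtx m c a" "c < 2 * N" "a < m" using vtx_cases[OF v(2,1)] .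
        have lN: "c div 2 < N" using ca by auto
        show ?thesis
        proof (cases "odd c = fst (s (c div 2))")
          case False
          show ?thesis using ring_tree_inactive[of c N a m s, OF ca(2,3) False] ca(1) by simp
        next
          case True
          have cc: "c = 2 * (c div 2) + of_bool (fst (s (c div 2)))" using True by (cases "odd c") auto
          show ?thesis
          proof (cases "c div 2 = i \<or> c div 2 = j")
            case False
            then have "\<sigma> (c div 2) = \<rho> (c div 2)" "\<rho>' (c div 2) = \<rho> (c div 2)" using agree lN by (auto simp: \<sigma>_def)
            then show ?thesis using ring_tree_local[OF ca(3)] ca(1) by metis
          next
            case True
            then show ?thesis
            proof
              assume l: "c div 2 = i"
              then have "v \<in> U \<longleftrightarrow> b" using side(1)[OF ca(3)] cc ca(1) by simp
              moreover have "\<sigma> (c div 2) = \<rho> (c div 2)" using l ij by (simp add: \<sigma>_def)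
              ultimately show ?thesis using ring_tree_local[OF ca(3)] ca(1) by metis
            next
              assume l: "c div 2 = j"
              then have "v \<in> U \<longleftrightarrow> \<not> b" using side(2)[OF ca(3)] cc ca(1) by simp
              moreover have "\<sigma> (c div 2) = \<rho>' (c div 2)" using l by (simp add: \<sigma>_def)
              ultimately show ?thesis using ring_tree_local[OF ca(3)] ca(1) by metis
            qed
          qed
        qed
      qed
      have mem: "(s, \<rho>) \<in> K" "(s, \<rho>') \<in> K" using Z by auto
      have "\<exists>p\<in>spanning_out_trees (ring_graph m N). \<forall>v. v \<noteq> 0 \<longrightarrow> v \<le> 2 * N * m \<longrightarrow> p v = ring_tree m N s \<sigma> v"
      proof (cases b)
        case True
        then have "ring_tree m N s \<sigma> v = (if v \<in> U then ring_tree m N s \<rho> v else ring_tree m N s \<rho>' v)"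
          if "v \<noteq> 0" "v \<le> 2 * N * m" for v using same[OF that] by simp
        then show ?thesis using cross[OF mem] by simp
      next
        case False
        then have "ring_tree m N s \<sigma> v = (if v \<in> U then ring_tree m N s \<rho>' v else ring_tree m N s \<rho> v)"
          if "v \<noteq> 0" "v \<le> 2 * N * m" for v using same[OF that] by simp
        then show ?thesis using cross[OF mem(2,1)] by simp
      qed
      then obtain p where p: "p \<in> spanning_out_trees (ring_graph m N)"
        "\<And>v. v \<noteq> 0 \<Longrightarrow> v \<le> 2 * N * m \<Longrightarrow> p v = ring_tree m N s \<sigma> v" by blast
      have "\<sigma> l permutes {..<m}" if "l < N" for l
        using perm Z that ij(2) by (auto simp: \<sigma>_def PiE_def Pi_def)
      then show "cyclic_on m (seg (\<rho>(j := \<rho>' j)) 0 N)"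
        using cyclic_on_if_tree[OF N p] unfolding \<sigma>_def by blast
    qed
  qed (use finK finB in auto)
  also have "card ?B = fact m ^ (N - 2)"
  proof -
    have "card ?I = N - 2" using ij by (simp add: card_Diff_subset)
    then show ?thesis by (simp add: card_PiE card_permutes_lessThan)
  qed
  also have "real (fact m ^ (N - 2)) * (fact m ^ 2 * exp (- q * m)) = fact m ^ N * exp (- q * m)"
  proof -
    have "(fact m :: real) ^ N = fact m ^ (N - 2) * fact m ^ 2"
      by (metis N le_add_diff_inverse2 power_add)
    then show ?thesis by (simp only: of_nat_fact of_nat_power mult.assoc)
  qed
  finally show ?thesis .
qed

end

context crossing_class
begin

text \<open>Of the 12 M m vertices other than the root, more than 4 M m are in \<open>U\<close> and
  at least 4 M m are not. A layer has at most 2 m vertices, so either side meets at least 2 M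
  layers. Removing layer 0 and the fewer than M mixed layers leaves M pure layers with a copy on
  that side. Most states activate such a copy on either side, and then \<open>card_fibre_le\<close>
  applies.\<close>

lemma few_mixed:
  fixes q :: real and M :: nat
  assumes q: "q \<ge> 0" "q + 2 \<le> J / 2 ^ 15" and lm: "ln m \<ge> 2 ^ (3 * J + 10)"
    and NM: "N = 6 * M" and few: "card mixed < M"
    and U: "U \<subseteq> {1..2 * N * m}" "8 * M * m < 2 * card U" "card U \<le> 8 * M * m"
  shows "real (card K) \<le> 4 ^ N * fact m ^ N * (2 * (1 / 2) ^ M + exp (- q * m))"
proof -
  define AU where "AU = {i. 0 < i \<and> i < N \<and> i \<notin> mixed \<and> (\<exists>e::bool. vtx m (2 * i + of_bool e) 0 \<in> U)}"
  define AW where "AW = {i. 0 < i \<and> i < N \<and> i \<notin> mixed \<and> (\<exists>e::bool. vtx m (2 * i + of_bool e) 0 \<notin> U)}"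
  have finA: "finite AU" "finite AW" by (auto simp: AU_def AW_def)
  have finM: "finite mixed" by (auto simp: mixed_def)
  have sub: "{v \<in> {1..2 * N * m}. v \<in> U \<longleftrightarrow> b} \<subseteq> (\<Union>i\<in>insert 0 (mixed \<union> {i. 0 < i \<and> i < N \<and> i \<notin> mixed \<and> (\<exists>e::bool. vtx m (2 * i + of_bool e) 0 \<in> U \<longleftrightarrow> b)}). layer m i)"
    for b
  proof
    fix v assume "v \<in> {v \<in> {1..2 * N * m}. v \<in> U \<longleftrightarrow> b}"
    then have v: "v \<in> {1..2 * N * m}" "v \<in> U \<longleftrightarrow> b" by blast+
    then obtain c a where ca: "v = vtx m c a" "c < 2 * N" "a < m" using vtx_cases[of v N m] by auto
    have lN: "c div 2 < N" using ca by auto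
    have "v \<in> layer m (c div 2)" using ca by (auto simp: layer_def)
    moreover have "c div 2 = 0 \<or> c div 2 \<in> mixed \<or>
      (0 < c div 2 \<and> c div 2 < N \<and> c div 2 \<notin> mixed \<and> (\<exists>e::bool. vtx m (2 * (c div 2) + of_bool e) 0 \<in> U \<longleftrightarrow> b))"
    proof (cases "c div 2 \<in> mixed")
      case False
      have "vtx m c 0 \<in> U \<longleftrightarrow> b" using pure_layer[OF lN False refl ca(3)] v(2) ca(1) by simp
      moreover have "c = 2 * (c div 2) + of_bool (odd c)" by (cases "odd c") auto
      ultimately have "\<exists>e::bool. vtx m (2 * (c div 2) + of_bool e) 0 \<in> U \<longleftrightarrow> b" by metis
      then show ?thesis using lN False by auto
    qed simp
    ultimately show "v \<in> (\<Union>i\<in>insert 0 (mixed \<union> {i. 0 < i \<and> i < N \<and> i \<notin> mixed \<and> (\<exists>e::bool. vtx m (2 * i + of_bool e) 0 \<in> U \<longleftrightarrow> b)}). layer m i)"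
      by blast
  qed
  have count: "card V \<le> Suc (card mixed + card A) * (2 * m)"
    if V: "V \<subseteq> (\<Union>i\<in>insert 0 (mixed \<union> A). layer m i)" and "finite A" for V A
  proof -
    have fin: "finite (insert 0 (mixed \<union> A))" using finM that(2) by simp
    have "card V \<le> card (\<Union>i\<in>insert 0 (mixed \<union> A). layer m i)"
      using V fin card_layer_le(1) by (intro card_mono) auto
    also have "\<dots> \<le> (\<Sum>i\<in>insert 0 (mixed \<union> A). card (layer m i))" by (rule card_UN_le[OF fin])
    also have "\<dots> \<le> (\<Sum>i\<in>insert 0 (mixed \<union> A). 2 * m)" by (intro sum_mono card_layer_le(2))
    also have "\<dots> = card (insert 0 (mixed \<union> A)) * (2 * m)" by simp
    also have "\<dots> \<le> Suc (card mixed + card A) * (2 * m)"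
    proof (rule mult_le_mono1)
      have "card (insert 0 (mixed \<union> A)) \<le> Suc (card (mixed \<union> A))" by (rule card_insert_le_m1) auto
      also have "\<dots> \<le> Suc (card mixed + card A)" using card_Un_le by simp
      finally show "card (insert 0 (mixed \<union> A)) \<le> Suc (card mixed + card A)" .
    qed
    finally show ?thesis .
  qed
  have m0: "m > 0" using m by simp
  have "{v \<in> {1..2 * N * m}. v \<in> U \<longleftrightarrow> True} = U" using U(1) by auto
  then have "card U \<le> Suc (card mixed + card AU) * (2 * m)"
    using count[OF sub[of True], folded AU_def] finA by (simp add: AU_def)
  then have "8 * M * m < Suc (card mixed + card AU) * 4 * m" using U(2) by linarith
  then have "2 * M < Suc (card mixed + card AU)" using m0 by simp
  then have cU: "M \<le> card AU" using few by linarith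
  have "{v \<in> {1..2 * N * m}. v \<in> U \<longleftrightarrow> False} = {1..2 * N * m} - U" by auto
  then have "card ({1..2 * N * m} - U) \<le> Suc (card mixed + card AW) * (2 * m)"
    using count[OF sub[of False]] finA by (simp add: AW_def)
  moreover have "card ({1..2 * N * m} - U) = 2 * N * m - card U"
    using U(1) by (simp add: card_Diff_subset finite_subset)
  ultimately have "12 * M * m - 8 * M * m \<le> Suc (card mixed + card AW) * (2 * m)" using U(3) NM by simp
  then have "2 * M * (2 * m) \<le> Suc (card mixed + card AW) * (2 * m)" by simp
  then have "2 * M \<le> Suc (card mixed + card AW)" using m0 by (simp only: mult_le_cancel2)
  then have cW: "M \<le> card AW" using few by linarith
  have cB: "card {x::bool \<times> bool. vtx m (2 * i + of_bool (fst x)) 0 \<in> U \<longleftrightarrow> b} \<le> 2"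
    if "\<exists>e::bool. vtx m (2 * i + of_bool e) 0 \<in> U \<longleftrightarrow> \<not> b" for i b
  proof -
    obtain e :: bool where e: "vtx m (2 * i + of_bool e) 0 \<in> U \<longleftrightarrow> \<not> b" using \<open>\<exists>e::bool. _ e\<close> by blast
    have "{x::bool \<times> bool. vtx m (2 * i + of_bool (fst x)) 0 \<in> U \<longleftrightarrow> b} \<subseteq> {\<not> e} \<times> UNIV"
    proof
      fix x :: "bool \<times> bool" assume x: "x \<in> {x. vtx m (2 * i + of_bool (fst x)) 0 \<in> U \<longleftrightarrow> b}"
      have "fst x \<noteq> e"
      proof
        assume "fst x = e"
        then show False using e x by simp
      qed
      then show "x \<in> {\<not> e} \<times> UNIV" by (cases x) auto
    qed
    then have "card {x::bool \<times> bool. vtx m (2 * i + of_bool (fst x)) 0 \<in> U \<longleftrightarrow> b} \<le> card ({\<not> e} \<times> (UNIV :: bool set))"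
      by (intro card_mono) auto
    then show ?thesis by (simp add: card_cartesian_product card_UNIV_bool)
  qed
  \<comment> \<open>States for which all layers of \<open>A\<close> have their active copy on side
    \<open>b\<close>. If each of these layers also has a copy on the other side, at most two of four
    states per layer remain.\<close>
  let ?bad = "\<lambda>A b. {s \<in> states N. \<forall>i\<in>A. s i \<in> {x. vtx m (2 * i + of_bool (fst x)) 0 \<in> U \<longleftrightarrow> b}}"
  have bad: "real (card (?bad A b)) \<le> 4 ^ N * (1 / 2) ^ M"
    if A: "A \<subseteq> {..<N}" "M \<le> card A" and e: "\<And>i. i \<in> A \<Longrightarrow> \<exists>e::bool. vtx m (2 * i + of_bool e) 0 \<in> U \<longleftrightarrow> \<not> b" for A b
  proof -
    have "real (card (?bad A b)) \<le> 4 ^ N * (real 2 / 4) ^ card A"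
      using A(1) cB e by (intro card_restricted_states) auto
    also have "\<dots> \<le> 4 ^ N * (1 / 2) ^ M" using A(2) by (intro mult_left_mono) (auto intro!: power_decreasing)
    finally show ?thesis .
  qed
  have finS: "finite (states N)" by (auto intro!: finite_PiE)
  define S where "S = ?bad AU False \<union> ?bad AW True"
  have "real (card S) \<le> real (card (?bad AU False)) + card (?bad AW True)"
    unfolding S_def using card_Un_le[of "?bad AU False" "?bad AW True"] by linarith
  also have "\<dots> \<le> 4 ^ N * (1 / 2) ^ M + 4 ^ N * (1 / 2) ^ M"
    using cU cW by (intro add_mono bad) (auto simp: AU_def AW_def)
  finally have cS: "real (card S) \<le> 4 ^ N * (2 * (1 / 2) ^ M)" by simp
  have good: "real (card {\<rho>. (s, \<rho>) \<in> K}) \<le> fact m ^ N * exp (- q * m)" if s: "s \<in> states N - S" for s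
  proof -
    obtain i where i: "i \<in> AU" "active m s i 0 \<in> U" using s unfolding S_def by blast
    obtain j where j: "j \<in> AW" "active m s j 0 \<notin> U" using s unfolding S_def by blast
    have ij: "i \<noteq> j" using i j by auto
    have Ui: "active m s i a \<in> U" if "a < m" for a
      using pure_layer[of i "2 * i + of_bool (fst (s i))" a] i that by (auto simp: AU_def)
    have Wj: "active m s j a \<notin> U" if "a < m" for a
      using pure_layer[of j "2 * j + of_bool (fst (s j))" a] j that by (auto simp: AW_def)
    show ?thesis
    proof (cases "i < j")
      case True
      show ?thesis by (rule card_fibre_le[OF q lm True, where b = True]) (use i j Ui Wj in \<open>auto simp: AU_def AW_def\<close>)
    next
      case False
      then have "j < i" using ij by simp
      show ?thesis by (rule card_fibre_le[OF q lm \<open>j < i\<close>, where b = False]) (use i j Ui Wj in \<open>auto simp: AU_def AW_def\<close>)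
    qed
  qed
  \<comment> \<open>Members with a bad state are bounded through the number of states, the others
    for each state separately.\<close>
  let ?K1 = "{k \<in> K. fst k \<in> S}" and ?K2 = "{k \<in> K. fst k \<notin> S}"
  interpret K1: crossing_class m N U ?K1
    by unfold_locales (use N m K cross in auto)
  have "real (card ?K1) \<le> real (card S) * fact m ^ N"
  proof (rule K1.card_K_le_states)
    show "finite S" by (rule finite_subset[OF _ finS]) (auto simp: S_def)
  qed simp
  also have "\<dots> \<le> 4 ^ N * (2 * (1 / 2) ^ M) * fact m ^ N" by (intro mult_right_mono cS) simp
  finally have k1: "real (card ?K1) \<le> 4 ^ N * (2 * (1 / 2) ^ M) * fact m ^ N" .
  have "real (card ?K2) \<le> card (states N) * (fact m ^ N * exp (- q * m))"
  proof (rule card_le_sum_fibres[where f = fst])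
    show "finite ?K2" using finite_K by simp
    show "fst ` ?K2 \<subseteq> states N"
    proof (rule image_subsetI)
      fix k assume "k \<in> ?K2"
      then have "k \<in> states N \<times> cyclic_families m N" using K by blast
      then show "fst k \<in> states N" by (simp only: mem_Times_iff)
    qed
    fix s assume s: "s \<in> states N"
    show "real (card {k \<in> ?K2. fst k = s}) \<le> fact m ^ N * exp (- q * m)"
    proof (cases "s \<in> S")
      case True
      then have "{k \<in> ?K2. fst k = s} = {}" by auto
      then show ?thesis by (simp only: card.empty) simp
    next
      case False
      have fin: "finite {\<rho>. (s, \<rho>) \<in> K}"
        by (rule finite_subset[OF _ finite_cyclic_families[of m N]]) (use K in auto)
      have "card {k \<in> ?K2. fst k = s} \<le> card (Pair s ` {\<rho>. (s, \<rho>) \<in> K})"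
        using fin by (intro card_mono) auto
      also have "\<dots> \<le> card {\<rho>. (s, \<rho>) \<in> K}" by (rule card_image_le[OF fin])
      finally show ?thesis using good[of s] False s by simp
    qed
  qed (rule finS)
  then have k2: "real (card ?K2) \<le> 4 ^ N * (fact m ^ N * exp (- q * m))" by (simp add: card_states)
  have "card (?K1 \<union> ?K2) \<le> card ?K1 + card ?K2" by (rule card_Un_le)
  moreover have "?K1 \<union> ?K2 = K" by auto
  ultimately have "card K \<le> card ?K1 + card ?K2" by (simp only:)
  then have "real (card K) \<le> real (card ?K1) + card ?K2" by linarith
  then show ?thesis using k1 k2 by (simp add: algebra_simps)
qed

lemma card_K_le:
  fixes q :: real and M :: nat
  assumes q: "q \<ge> 0" "q + 2 \<le> J / 2 ^ 15" and lm: "ln m \<ge> 2 ^ (3 * J + 10)"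
    and NM: "N = 6 * M"
    and U: "U \<subseteq> {1..2 * N * m}" "8 * M * m < 2 * card U" "card U \<le> 8 * M * m"
  shows "real (card K) \<le> 4 ^ N * fact m ^ N * (2 * (3 / 4) ^ M + exp (- q * m))"
proof (cases "card mixed < M")
  case True
  have "real (card K) \<le> 4 ^ N * fact m ^ N * (2 * (1 / 2) ^ M + exp (- q * m))"
    by (rule few_mixed[OF q lm NM True U])
  also have "\<dots> \<le> 4 ^ N * fact m ^ N * (2 * (3 / 4) ^ M + exp (- q * m))"
    by (intro mult_left_mono add_mono power_mono) auto
  finally show ?thesis .
next
  case False
  then have "real (card K) \<le> 4 ^ N * fact m ^ N * (3 / 4) ^ M" using many_mixed[of M] by (simp add: mult_ac)
  also have "\<dots> \<le> 4 ^ N * fact m ^ N * (2 * (3 / 4) ^ M + exp (- q * m))"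
    by (intro mult_left_mono) (auto simp: add_increasing2)
  finally show ?thesis .
qed

end

text \<open>At least 4^N (m!)^N / m pairs \<open>(s, \<rho>)\<close> are distributed over the gates
  by the nodes of their trees, and \<open>card_K_le\<close> bounds the share of each gate.\<close>

lemma ring_graph_circuit_size:
  fixes C :: "('n, nat \<times> nat) circuit" and q :: real
  assumes q: "q \<ge> 0" "q + 2 \<le> J / 2 ^ 15" and lm: "ln m \<ge> 2 ^ (3 * J + 10)" and m: "m \<ge> 2" and M: "M > 0"
    and C: "tropical_circuit (parcs (ring_graph m (6 * M))) C" "calculates C (DST (ring_graph m (6 * M)))"
  shows "1 \<le> m * circuit_size C * (2 * (3 / 4) ^ M + exp (- q * m))"
proof -
  define N where "N = 6 * M"
  let ?G = "ring_graph m N" and ?I = "states N \<times> cyclic_families m N"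
  note C = C[folded N_def]
  have N: "N \<ge> 2" using M by (simp add: N_def)
  have m0: "m > 0" using m by simp
  interpret pair_digraph ?G by (rule pair_digraph_ring_graph[OF N])
  have V: "pverts ?G - {0} = {1..2 * N * m}" by (auto simp: ring_graph_def)
  define h where "h = (\<lambda>(s, \<rho>). ring_tree m N s \<rho>)"
  have finI: "finite ?I" by (intro finite_cartesian_product finite_cyclic_families finite_PiE) auto
  have cI: "4 ^ N * fact m ^ N \<le> m * card ?I"
  proof -
    have "fact m ^ N \<le> m * card (cyclic_families m N)"
      using card_cyclic_families[OF m0, of "N - 1"] N by simp
    then show ?thesis by (simp add: card_cartesian_product card_states)
  qed
  have "card ?I > 0"
  proof (rule ccontr)
    assume "\<not> card ?I > 0"
    then have "(4::nat) ^ N * fact m ^ N \<le> 0" using cI by simp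
    then show False by simp
  qed
  then have ne: "?I \<noteq> {}" by auto
  have H: "h ` ?I \<subseteq> spanning_out_trees ?G" "h ` ?I \<noteq> {}"
    using ring_tree_mem[OF N m0] ne by (auto simp: h_def)
  have wf: "pair_wf_digraph ?G" by unfold_locales
  have r: "0 \<in> pverts ?G" "\<And>u. (u, 0) \<notin> parcs ?G" by (auto simp: ring_graph_def)
  \<comment> \<open>The bound 8 M m is two thirds of the 12 M m vertices other than the
    root.\<close>
  have t: "0 < 8 * M * m" "8 * M * m < 2 * card (pverts ?G - {0})" using M m0 unfolding V by (auto simp: N_def)
  obtain node U where nU: "node ` h ` ?I \<subseteq> nodes C"
    "\<And>f. f \<in> h ` ?I \<Longrightarrow> U f \<subseteq> pverts ?G - {0} \<and> 8 * M * m < 2 * card (U f) \<and> card (U f) \<le> 8 * M * m"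
    "\<And>f f'. f \<in> h ` ?I \<Longrightarrow> f' \<in> h ` ?I \<Longrightarrow> node f = node f' \<Longrightarrow> U f = U f' \<and>
      (\<exists>p\<in>spanning_out_trees ?G. \<forall>v\<in>pverts ?G - {0}. p v = (if v \<in> U f then f v else f' v))"
  proof (rule circuit_cover[OF wf pair_finite_verts pair_finite_arcs r C H t], goal_cases)
    case (1 node U)
    from 1(2-) show ?case by (rule 1(1))
  qed
  have "real (card ?I) \<le> card (nodes C) * (4 ^ N * fact m ^ N * (2 * (3 / 4) ^ M + exp (- q * m)))"
  proof (rule card_le_sum_fibres[where f = "\<lambda>k. node (h k)"])
    show "(\<lambda>k. node (h k)) ` ?I \<subseteq> nodes C" using nU(1) by auto
    show "finite (nodes C)" using C(1) by (simp add: tropical_circuit_def)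
    fix n assume "n \<in> nodes C"
    let ?K = "{k \<in> ?I. node (h k) = n}"
    show "real (card ?K) \<le> 4 ^ N * fact m ^ N * (2 * (3 / 4) ^ M + exp (- q * m))"
    proof (cases "?K = {}")
      case True
      then show ?thesis by (simp only: card.empty) (simp add: add_nonneg_nonneg)
    next
      case False
      then obtain k where k: "k \<in> ?K" by blast
      interpret crossing_class m N "U (h k)" ?K
      proof
        show "N \<ge> 2" "m \<ge> 2" by fact+
        show "?K \<subseteq> ?I" by blast
        fix s \<rho> s' \<rho>' assume a: "(s, \<rho>) \<in> ?K" "(s', \<rho>') \<in> ?K"
        then have mem: "h (s, \<rho>) \<in> h ` ?I" "h (s', \<rho>') \<in> h ` ?I" "h k \<in> h ` ?I"
          and nd: "node (h (s, \<rho>)) = node (h (s', \<rho>'))" "node (h (s, \<rho>)) = node (h k)" using k by auto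
        have eq: "U (h (s, \<rho>)) = U (h k)" by (rule conjunct1[OF nU(3)[OF mem(1,3) nd(2)]])
        obtain p where p: "p \<in> spanning_out_trees ?G"
          "\<forall>v\<in>pverts ?G - {0}. p v = (if v \<in> U (h (s, \<rho>)) then h (s, \<rho>) v else h (s', \<rho>') v)"
          using conjunct2[OF nU(3)[OF mem(1,2) nd(1)]] by (rule bexE)
        show "\<exists>p\<in>spanning_out_trees ?G. \<forall>v. v \<noteq> 0 \<longrightarrow> v \<le> 2 * N * m \<longrightarrow>
            p v = (if v \<in> U (h k) then ring_tree m N s \<rho> v else ring_tree m N s' \<rho>' v)"
        proof (rule bexI[OF _ p(1)], intro allI impI)
          fix v assume "v \<noteq> 0" "v \<le> 2 * N * m"
          then have "v \<in> pverts ?G - {0}" unfolding V by simp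
          from p(2)[rule_format, OF this]
          show "p v = (if v \<in> U (h k) then ring_tree m N s \<rho> v else ring_tree m N s' \<rho>' v)"
            unfolding eq by (simp add: h_def)
        qed
      qed
      have "h k \<in> h ` ?I" using k by blast
      note Uk = nU(2)[OF this, unfolded V]
      show ?thesis by (rule card_K_le[OF q lm N_def]) (use Uk in simp_all)
    qed
  qed (rule finI)
  then have le: "real m * card ?I \<le> m * (card (nodes C) * (4 ^ N * fact m ^ N * (2 * (3 / 4) ^ M + exp (- q * m))))"
    by (rule mult_left_mono) simp
  define A :: real where "A = 4 ^ N * fact m ^ N"
  define X where "X = 2 * (3 / 4) ^ M + exp (- q * m)"
  have "real (4 ^ N * fact m ^ N) \<le> real (m * card ?I)" using cI by (rule of_nat_mono)
  then have "A \<le> real m * card ?I" by (simp add: A_def)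
  also have "\<dots> \<le> m * (card (nodes C) * (A * X))" using le unfolding A_def X_def .
  also have "\<dots> = A * (m * card (nodes C) * X)" by simp
  finally have "A * 1 \<le> A * (m * card (nodes C) * X)" by simp
  moreover have "A > 0" by (simp add: A_def)
  ultimately have "1 \<le> m * card (nodes C) * X" by (simp only: mult_le_cancel_left_pos)
  then show ?thesis by (simp only: X_def circuit_size_def)
qed

section \<open>The choice of parameters\<close>

text \<open>The witness for the finitely many small k, where the exponent of the lower bound is set
  to 0.\<close>

lemma trivial_graph:
  fixes G :: "nat pair_pre_digraph"
  defines "G \<equiv> \<lparr> pverts = {0}, parcs = {} \<rparr>"
  shows "pair_digraph G" "spanning_out_trees G \<noteq> {}" "pathwidth G \<le> 0" "card (pverts G) = 1"
proof -
  show pd: "pair_digraph G" by unfold_locales (auto simp: G_def)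
  interpret pair_digraph G by (rule pd)
  have "restrict id {0} \<in> spanning_out_trees G"
  proof (rule spanning_out_treesI[where r = 0])
    show "pair_wf_digraph G" by unfold_locales
    show "\<exists>k. (restrict id {0} ^^ k) v = 0" if "v \<in> pverts G" for v
      using that by (intro exI[of _ 0]) (simp add: G_def)
  qed (auto simp: G_def)
  then show "spanning_out_trees G \<noteq> {}" by blast
  have "path_decomposition (pverts G) (underlying_edges G) [{0}]"
    by (auto simp: path_decomposition_def G_def underlying_edges_def)
  then have "width [{0 :: nat}] \<in> width ` {bs. path_decomposition (pverts G) (underlying_edges G) bs}"
    by (intro image_eqI[of _ _ "[{0}]"]) simp_all
  moreover have "bdd_below (width ` {bs. path_decomposition (pverts G) (underlying_edges G) bs})"
    by (intro bdd_belowI[of _ "-1"]) (auto simp: width_def)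
  ultimately have "pathwidth G \<le> width [{0 :: nat}]" unfolding pathwidth_def by (intro cInf_lower)
  then show "pathwidth G \<le> 0" by (simp add: width_def)
  show "card (pverts G) = 1" by (simp add: G_def)
qed

lemma circuit_size_pos: "tropical_circuit X C \<Longrightarrow> circuit_size C \<ge> 1"
  by (auto simp: tropical_circuit_def circuit_size_def Suc_le_eq card_gt_0_iff)

text \<open>The number J of averaging steps. The condition 2^(3J+10) \<le> ln m, with m about k / 6,
  holds for large k because 3 / 8 < 1.\<close>

definition loglog_depth :: "nat \<Rightarrow> nat" where
  "loglog_depth k = nat \<lfloor>log 2 (log 2 (real k)) / 8\<rfloor>"

lemma eventually_parameters:
  "eventually (\<lambda>k::nat. ln (real (k div 6)) \<ge> 2 ^ (3 * loglog_depth k + 10) \<and> 2 ^ 17 \<le> loglog_depth k \<and>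
     k div 6 \<ge> 2 \<and> real (loglog_depth k) \<ge> log 2 (log 2 k) / 16 \<and> real (k div 6) \<ge> k / 12 \<and>
     real (loglog_depth k) \<le> k div 6 \<and> 3 * real k \<le> exp (k / 2 ^ 18)) at_top"
proof -
  have "eventually (\<lambda>x::real. ln (x / 12) \<ge> 1024 * (log 2 x) powr (3 / 8)) at_top" by real_asymp
  moreover have "eventually (\<lambda>x::real. log 2 (log 2 x) / 8 - 1 \<ge> 2 ^ 17) at_top" by real_asymp
  moreover have "eventually (\<lambda>x::real. log 2 (log 2 x) / 8 - 1 \<ge> log 2 (log 2 x) / 16) at_top" by real_asymp
  moreover have "eventually (\<lambda>x::real. log 2 (log 2 x) / 8 \<le> x / 12) at_top" by real_asymp
  moreover have "eventually (\<lambda>x::real. 3 * x \<le> exp (x / 2 ^ 18)) at_top" by real_asymp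
  moreover have "eventually (\<lambda>x::real. x \<ge> 24) at_top" by real_asymp
  ultimately have "eventually (\<lambda>x::real. ln (x / 12) \<ge> 1024 * (log 2 x) powr (3 / 8) \<and>
     log 2 (log 2 x) / 8 - 1 \<ge> 2 ^ 17 \<and> log 2 (log 2 x) / 8 - 1 \<ge> log 2 (log 2 x) / 16 \<and>
     log 2 (log 2 x) / 8 \<le> x / 12 \<and> 3 * x \<le> exp (x / 2 ^ 18) \<and> x \<ge> 24) at_top"
    by (intro eventually_conj)
  then have "eventually (\<lambda>k::nat. ln (real k / 12) \<ge> 1024 * (log 2 k) powr (3 / 8) \<and>
     log 2 (log 2 k) / 8 - 1 \<ge> 2 ^ 17 \<and> log 2 (log 2 k) / 8 - 1 \<ge> log 2 (log 2 k) / 16 \<and>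
     log 2 (log 2 k) / 8 \<le> real k / 12 \<and> 3 * real k \<le> exp (k / 2 ^ 18) \<and> real k \<ge> 24) at_top"
    by (rule eventually_compose_filterlim[OF _ filterlim_real_sequentially])
  then show ?thesis
  proof (rule eventually_mono, goal_cases)
    case (1 k)
    define L where "L = log 2 (log 2 k) / 8"
    define J where "J = loglog_depth k"
    have h: "1024 * (log 2 k) powr (3 / 8) \<le> ln (real k / 12)" "2 ^ 17 \<le> L - 1"
      "log 2 (log 2 k) / 16 \<le> L - 1" "L \<le> real k / 12" "3 * real k \<le> exp (k / 2 ^ 18)" "real k \<ge> 24"
      using 1 unfolding L_def by blast+
    have L1: "131073 \<le> L" using h(2) by simp
    then have L0: "L \<ge> 0" by linarith
    have J: "real J = of_int \<lfloor>L\<rfloor>" using L0 by (simp add: J_def loglog_depth_def L_def)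
    have JL: "real J \<le> L" "L - 1 \<le> real J" unfolding J by linarith+
    have m: "real (k div 6) \<ge> k / 12"
    proof -
      have "k \<le> 6 * (k div 6) + 5" by presburger
      then have "real k \<le> 6 * real (k div 6) + 5" by linarith
      then show ?thesis using h(6) by linarith
    qed
    have "2 ^ (3 * J + 10) = 2 powr real (3 * J + 10)" by (rule powr_realpow[symmetric]) simp
    also have "\<dots> \<le> 2 powr (3 * L + 10)" using JL by (intro powr_mono) auto
    also have "\<dots> = 1024 * (log 2 k) powr (3 / 8)"
    proof -
      have "log 2 k > 0" using h(6) by simp
      then have "2 powr (log 2 (log 2 k) * (3 / 8)) = (log 2 k) powr (3 / 8)"
        by (simp only: powr_powr[symmetric]) simp
      moreover have "3 * L + 10 = log 2 (log 2 k) * (3 / 8) + 10" by (simp add: L_def)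
      ultimately show ?thesis by (simp only: powr_add) simp
    qed
    also have "\<dots> \<le> ln (k / 12)" using h(1) by simp
    also have "\<dots> \<le> ln (k div 6)" using m h(6) by (subst ln_le_cancel_iff) auto
    finally have 1: "2 ^ (3 * J + 10) \<le> ln (k div 6)" .
    have "131072 \<le> real J" using L1 JL(2) by linarith
    then have 2: "2 ^ 17 \<le> J" by simp
    have 3: "k div 6 \<ge> 2" using h(6) by linarith
    have 4: "real J \<ge> log 2 (log 2 k) / 16" using h(3) JL(2) by linarith
    have 5: "real J \<le> k div 6" using h(4) JL(1) m by linarith
    show ?case unfolding J_def[symmetric] using 1 2 3 4 5 m h(5) by (intro conjI)
  qed
qed

lemma pow_three_quarters_le: "(3 / 4 :: real) ^ M \<le> exp (- real M / 4)"
proof -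
  have "3 / 4 \<le> exp (- 1 / 4 :: real)" using exp_ge_add_one_self[of "- 1 / 4 :: real"] by simp
  then have "(3 / 4 :: real) ^ M \<le> exp (- 1 / 4) ^ M" by (intro power_mono) auto
  also have "\<dots> = exp (- real M / 4)" by (simp flip: exp_of_nat_mult)
  finally show ?thesis .
qed

text \<open>M = m^2 makes (3 / 4)^M at most exp (- q m), as 4 q \<le> m. This leaves exp (q m) \<le>
  3 m times the circuit size, where q is proportional to log log k.\<close>

lemma ring_graph_superpolynomial:
  fixes k :: nat and C :: "(nat, nat \<times> nat) circuit"
  defines "m \<equiv> k div 6" and "J \<equiv> loglog_depth k"
  defines "M \<equiv> m\<^sup>2"
  assumes h: "2 ^ (3 * J + 10) \<le> ln (real m)" "2 ^ 17 \<le> J" "2 \<le> m"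
    "log 2 (log 2 k) / 16 \<le> real J" "k / 12 \<le> real m" "real J \<le> real m" "3 * real k \<le> exp (k / 2 ^ 18)"
    and C: "tropical_circuit (parcs (ring_graph m (6 * M))) C" "calculates C (DST (ring_graph m (6 * M)))"
  shows "2 powr (1 / 2 ^ 26 * (real k * max 0 (log 2 (log 2 k)))) \<le> circuit_size C"
proof -
  \<comment> \<open>Half of J / 2^15; the other half is at least 2 because J \<ge> 2^17.\<close>
  define q where "q = J / 2 ^ 16"
  define c0 :: real where "c0 = 1 / 2 ^ 26"
  define F where "F = c0 * (real k * max 0 (log 2 (log 2 k)))"
  have c0: "c0 > 0" by (simp add: c0_def)
  have F0: "F \<ge> 0" using c0 by (simp add: F_def)
  note m2 = h(3)
  have "real (2 ^ 17) \<le> real J" using h(2) by (simp only: of_nat_le_iff)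
  then have J: "2 ^ 17 \<le> real J" by simp
  have q: "q \<ge> 0" "q + 2 \<le> J / 2 ^ 15" using J by (simp_all add: q_def)
  have "4 * q \<le> real J" using J by (simp add: q_def)
  then have q4: "4 * q \<le> m" using h(6) by linarith
  have M0: "M > 0" using m2 by (simp add: M_def)
  have "(3 / 4 :: real) ^ M \<le> exp (- real M / 4)" by (rule pow_three_quarters_le)
  also have "\<dots> \<le> exp (- q * m)"
  proof -
    have "4 * q * m \<le> real m * m" using q4 by (intro mult_right_mono) auto
    then show ?thesis by (simp add: M_def power2_eq_square)
  qed
  finally have "2 * (3 / 4 :: real) ^ M + exp (- q * m) \<le> 3 * exp (- q * m)" by simp
  then have "real (m * circuit_size C) * (2 * (3 / 4) ^ M + exp (- q * m)) \<le> real (m * circuit_size C) * (3 * exp (- q * m))"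
    by (rule mult_left_mono) simp
  moreover have "1 \<le> m * circuit_size C * (2 * (3 / 4 :: real) ^ M + exp (- q * m))"
    using ring_graph_circuit_size[OF q h(1) m2 M0 C] .
  ultimately have "1 \<le> real (m * circuit_size C) * (3 * exp (- q * m))" by linarith
  then have "exp (q * m) * 1 \<le> exp (q * m) * (real (m * circuit_size C) * (3 * exp (- q * m)))"
    by (intro mult_left_mono) auto
  also have "\<dots> = 3 * m * circuit_size C" by (simp add: exp_minus)
  finally have e: "exp (q * m) \<le> 3 * real m * circuit_size C" by simp
  have qm: "q * m \<ge> 2 * (k / 2 ^ 18)"
  proof -
    note h(5)
    moreover have "2 \<le> q" using J by (simp add: q_def)
    ultimately have "2 * (k / 12) \<le> q * m" by (intro mult_mono) auto
    moreover have "real k / 2 ^ 18 \<le> k / 12" by (simp add: divide_left_mono)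
    ultimately show ?thesis unfolding F_def c0_def by linarith
  qed
  \<comment> \<open>Half of the exponent absorbs the polynomial factor.\<close>
  have "3 * real m \<le> exp (q * m / 2)"
  proof -
    have "m \<le> k" by (simp add: m_def)
    then have "3 * real m \<le> 3 * real k" by simp
    also have "\<dots> \<le> exp (k / 2 ^ 18)" by (rule h(7))
    also have "\<dots> \<le> exp (q * m / 2)" using qm by simp
    finally show ?thesis .
  qed
  then have "3 * real m * circuit_size C \<le> exp (q * m / 2) * circuit_size C" by (rule mult_right_mono) simp
  then have "exp (q * m / 2) * exp (q * m / 2) \<le> exp (q * m / 2) * circuit_size C"
    using e by (simp flip: exp_add)
  then have "exp (q * m / 2) \<le> circuit_size C" by simp
  moreover have "2 powr F \<le> exp (q * m / 2)"
  proof -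
    have "F \<le> q * m / 2"
    proof -
      have 1: "max 0 (log 2 (log 2 k)) \<le> 16 * real J" using h(4) by simp
      have 2: "real k \<le> 12 * real m" using h(5) by simp
      have "real k * max 0 (log 2 (log 2 k)) \<le> (12 * real m) * (16 * real J)" by (rule mult_mono[OF 2 1]) simp_all
      then have "c0 * (real k * max 0 (log 2 (log 2 k))) \<le> c0 * ((12 * real m) * (16 * real J))"
        using c0 by (simp only: mult_le_cancel_left_pos)
      \<comment> \<open>Here q m / 2 = J m / 2^17, and 12 * 16 / 2^26 \<le> 1 / 2^17.\<close>
      also have "\<dots> \<le> q * m / 2" by (simp add: c0_def q_def mult_right_mono)
      finally show ?thesis by (simp add: F_def)
    qed
    moreover have "F * ln 2 \<le> F" using F0 ln_2_less_1 by (intro mult_left_le) auto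
    ultimately show ?thesis by (simp add: powr_def)
  qed
  ultimately show ?thesis unfolding F_def c0_def by linarith
qed

text \<open>Six layers for each unit of M = m^2 give 12 m^3 + 1 vertices, below (6 m)^4 \<le> k^4.
  The divisor 6 in m matches the pathwidth bound 6 m.\<close>

lemma ring_graph_shape:
  fixes k :: nat
  defines "m \<equiv> k div 6"
  defines "G \<equiv> ring_graph m (6 * m\<^sup>2)"
  assumes m2: "2 \<le> m"
  shows "pair_digraph G" "spanning_out_trees G \<noteq> {}" "pathwidth G \<le> int k" "real (card (pverts G)) \<le> real k powr 4"
proof -
  define M where "M = m\<^sup>2"
  have G: "G = ring_graph m (6 * M)" by (simp add: G_def M_def)
  have M0: "M > 0" using m2 by (simp add: M_def)
  have N2: "6 * M \<ge> 2" using M0 by simp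
  show "pair_digraph G" unfolding G by (rule pair_digraph_ring_graph[OF N2])
  have "cyclic_families m (6 * M) \<noteq> {}"
  proof
    assume "cyclic_families m (6 * M) = {}"
    then show False using card_cyclic_families[of m "6 * M - 1"] m2 M0 by simp
  qed
  then obtain \<rho> where "\<rho> \<in> cyclic_families m (6 * M)" by blast
  then show "spanning_out_trees G \<noteq> {}" unfolding G using ring_tree_mem[OF N2, of m \<rho>] m2 by auto
  show "pathwidth G \<le> int k" unfolding G using pathwidth_ring_graph[OF N2, of m] by (simp add: m_def)
  show "real (card (pverts G)) \<le> real k powr 4"
  proof -
    have "6 * m \<le> k" by (simp add: m_def)
    have "card (pverts G) = Suc (12 * m^3)" by (simp add: G_def ring_graph_def power2_eq_square power3_eq_cube mult_ac)
    also have "\<dots> \<le> 6 * m^3 * (6 * m)"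
    proof -
      have "1 \<le> m^3" using m2 by simp
      then have "Suc (12 * m^3) \<le> 36 * m^3 * 1" by simp
      also have "\<dots> \<le> 36 * m^3 * m" using m2 by (intro mult_le_mono2) simp
      finally show ?thesis by (simp add: mult_ac)
    qed
    also have "\<dots> \<le> (6 * m)^3 * (6 * m)" by (intro mult_le_mono1) (simp add: power_mult_distrib)
    also have "\<dots> = (6 * m)^4" by (simp add: eval_nat_numeral)
    also have "\<dots> \<le> k^4" using \<open>6 * m \<le> k\<close> by (rule power_mono) simp
    finally have "real (card (pverts G)) \<le> real k ^ 4" by (simp only: of_nat_le_iff flip: of_nat_power)
    moreover have "real k > 0" using m2 by (simp add: m_def)
    ultimately show ?thesis by simp
  qed
qed

theorem theorem1p4:
  shows "\<exists>c::real. c > 0 \<and>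
    (\<exists>f :: nat \<Rightarrow> real.
       f \<in> \<Omega>(\<lambda>k. real k * log 2 (log 2 (real k))) \<and> (\<forall>k. f k \<ge> 0) \<and>
       (\<forall>k::nat. k \<ge> 1 \<longrightarrow>
          (\<exists>G :: nat pair_pre_digraph.
             pair_digraph G \<and> spanning_out_trees G \<noteq> {} \<and>
             pathwidth G \<le> int k \<and>
             real (card (pverts G)) \<le> real k powr c \<and>
             (\<forall>C :: (nat, nat \<times> nat) circuit.
                tropical_circuit (parcs G) C \<longrightarrow> calculates C (DST G) \<longrightarrow>
                real (circuit_size C) \<ge> 2 powr f k))))"
proof -
  obtain k0 where k0: "\<forall>k\<ge>k0. ln (real (k div 6)) \<ge> 2 ^ (3 * loglog_depth k + 10) \<and> 2 ^ 17 \<le> loglog_depth k \<and>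
     k div 6 \<ge> 2 \<and> real (loglog_depth k) \<ge> log 2 (log 2 k) / 16 \<and> real (k div 6) \<ge> k / 12 \<and>
     real (loglog_depth k) \<le> real (k div 6) \<and> 3 * real k \<le> exp (k / 2 ^ 18)"
    using eventually_parameters unfolding eventually_sequentially ..
  \<comment> \<open>The maximum keeps \<open>f\<close> nonnegative whatever \<open>k0\<close> is;
    eventually it equals log log k.\<close>
  define f where "f k = (if k \<ge> k0 then 1 / 2 ^ 26 * (real k * max 0 (log 2 (log 2 (real k)))) else 0)" for k
  have f0: "\<forall>k. f k \<ge> 0" by (simp add: f_def)
  have f\<Omega>: "f \<in> \<Omega>(\<lambda>k. real k * log 2 (log 2 (real k)))"
  proof (rule landau_omega.bigI[of "1 / 2 ^ 26"])
    have pos: "eventually (\<lambda>k::nat. log 2 (log 2 (real k)) \<ge> 0) at_top" by real_asymp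
    show "eventually (\<lambda>k. 1 / 2 ^ 26 * norm (real k * log 2 (log 2 (real k))) \<le> norm (f k)) at_top"
      using pos eventually_ge_at_top[of k0] by eventually_elim (simp add: f_def abs_mult)
  qed simp
  have main: "\<exists>G :: nat pair_pre_digraph.
             pair_digraph G \<and> spanning_out_trees G \<noteq> {} \<and>
             pathwidth G \<le> int k \<and>
             real (card (pverts G)) \<le> real k powr 4 \<and>
             (\<forall>C :: (nat, nat \<times> nat) circuit.
                tropical_circuit (parcs G) C \<longrightarrow> calculates C (DST G) \<longrightarrow>
                real (circuit_size C) \<ge> 2 powr f k)" if k: "k \<ge> 1" for k :: nat
  proof (cases "k \<ge> k0")
    case False
    let ?G = "\<lparr> pverts = {0 :: nat}, parcs = {} \<rparr>"
    have "real (circuit_size C) \<ge> 2 powr f k" if "tropical_circuit X C" for X and C :: "(nat, nat \<times> nat) circuit"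
      using circuit_size_pos[OF that] False by (simp add: f_def)
    moreover have "(1::real) \<le> real k powr 4" using k by (intro ge_one_powr_ge_zero) auto
    then have "real (card (pverts ?G)) \<le> real k powr 4" by simp
    moreover have "pathwidth ?G \<le> int k" using trivial_graph(3) by (rule order_trans) simp
    ultimately show ?thesis using trivial_graph(1,2)
      by (intro exI[of _ ?G] conjI allI impI)
  next
    case True
    note h = k0[rule_format, OF True]
    let ?G = "ring_graph (k div 6) (6 * (k div 6)\<^sup>2)"
    have m2: "2 \<le> k div 6" using h by (elim conjE)
    have "2 powr f k \<le> circuit_size C"
      if "tropical_circuit (parcs ?G) C" "calculates C (DST ?G)" for C :: "(nat, nat \<times> nat) circuit"
    proof -
      have "2 powr (1 / 2 ^ 26 * (real k * max 0 (log 2 (log 2 k)))) \<le> circuit_size C"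
        using h by (elim conjE) (rule ring_graph_superpolynomial[OF _ _ _ _ _ _ _ that])
      then show ?thesis using True by (simp only: f_def if_True)
    qed
    then show ?thesis using ring_graph_shape[OF m2]
      by (intro exI[of _ ?G] conjI allI impI)
  qed
  show ?thesis
    by (rule exI[of _ 4], rule conjI, simp, rule exI[of _ f]) (intro conjI f\<Omega> f0 allI impI main)
qed

end
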